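(* Let $\mathbb F$ be an algebraically closed field of any characteristic, let $\mathcal L$ be a set of $b\ge 3$ skew lines in $\mathbb P^3_{\mathbb F}$, and let $Z\subset\bigcup_{L\in\mathcal L}L$ be a set of points with exactly $a$ points on each of the $b$ lines ($a\geq 1$). Then $Z$ is collinearly complete for $\mathcal L$ (or equivalently, $Z$ is a union of $C_{\mathcal L}$-orbits) if and only if either $Z$ is an $\{a,b\}$-grid or $Z$ is an $[a,b]$-half grid with respect to $\mathcal L$.
   Context: Groupoid. Let $\mathcal L=\{L_1,\dots,L_s\}$ be a set of $s\ge3$ distinct pairwise disjoint (skew) lines in $\mathbb P^3$. For distinct indices $i,j,k$ let $f_{ijk}\colon L_i\to L_j$ be the linear isomorphism sending $p\in L_i$ to the point where the plane spanned by $p$ and $L_k$ meets $L_j$. The groupoid $C_{\mathcal L}$ has the lines $L_i$ as objects and all possible compositions of the maps $f_{ijk}$ as arrows. For $p\in L_i$ its $C_{\mathcal L}$-orbit is $[p]=\bigcup_j\{g(p): g\in \mathrm{Hom}_{C_{\mathcal L}}(L_i,L_j)\}$. Collinear completeness. A nonempty $Z\subseteq\bigcup_i L_i$ is collinearly complete with respect to (for) $\mathcal L$ if whenever a line $T$ meets three or more of the lines $L_i$ (and is not one of them) and $T\cap Z\neq\varnothing$, then $T\cap(\bigcup_iL_i)\subseteq Z$. Geproci sets. For a finite set $Z\subset\mathbb P^3_{\mathbb F}$, $\overline{Z}$ denotes its image under projection from a general point $P\in\mathbb P^3_{\mathbb F}$ to a plane $H$ (similarly $\overline L$ for a line $L$).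 A set $Z$ of $ab$ points is $\{a,b\}$-geproci if $\overline Z$ is the transverse intersection (in $ab$ distinct points) of plane curves in $H$ of degrees $a$ and $b$. An $\{a,b\}$-geproci set $Z$ is $[a,b]$-geproci with respect to a set $\mathcal L$ of $b$ skew lines if $Z$ consists of $a$ points on each of the $b$ lines and $\overline Z$ is the transverse intersection of a plane curve of degree $a$ with $\bigcup_{L\in\mathcal L}\overline L$. $Z$ is an $\{a,b\}$-grid if $Z=C_1\cap C_2$ where $C_1$ is a union of $a$ skew lines, $C_2$ is a union of $b$ skew lines, and each component of $C_1$ meets each component of $C_2$ in exactly one point. $Z$ is an $[a,b]$-half grid (with respect to $\mathcal L$) if it is $[a,b]$-geproci (with respect to $\mathcal L$) but is not a grid. *)

theory Defs
  imports
    "HOL-Analysis.Cartesian_Space"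
    "HOL-Library.Poly_Mapping"
    "HOL-Library.FuncSet"
    "HOL-Computational_Algebra.Polynomial"
begin

section \<open>Projective space\<close>

text \<open>
  The linear subspaces of the projective space of \<open>'a^'n\<close> are represented by the vector subspaces
  of \<open>'a^'n\<close>; projective dimension \<open>k\<close> means vector space dimension \<open>k + 1\<close>. In particular a
  point is a one-dimensional vector subspace, and the projective 3-space over \<open>'a\<close> is the case
  \<open>'a^4\<close>. A set of points is a set of such subspaces.
\<close>

definition flat :: "nat \<Rightarrow> ('a::field^'n) set \<Rightarrow> bool" where
  "flat k W \<longleftrightarrow> vec.subspace W \<and> vec.dim W = k + 1"

abbreviation "point \<equiv> flat 0"
abbreviation "line \<equiv> flat 1"
abbreviation "plane \<equiv> flat 2"

definition pts :: "('a::field^'n) set \<Rightarrow> ('a^'n) set set" where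
  "pts W = {p. point p \<and> p \<subseteq> W}"

text \<open>
  The flat cut out on \<open>W\<close> by the span of \<open>X\<close> and \<open>C\<close>. With center a point \<open>C\<close> not on the plane
  \<open>W\<close> this is the image of \<open>X\<close> under projection from \<open>C\<close> to \<open>W\<close>; with \<open>C\<close>, \<open>W\<close> skew lines and
  \<open>X\<close> a point off \<open>C\<close> it is the point in which the plane spanned by \<open>X\<close> and \<open>C\<close> meets \<open>W\<close>.
\<close>

definition projection :: "('a::field^'n) set \<Rightarrow> ('a^'n) set \<Rightarrow> ('a^'n) set \<Rightarrow> ('a^'n) set" where
  "projection C W X = vec.span (X \<union> C) \<inter> W"

definition skew_lines :: "('a::field^'n) set set \<Rightarrow> bool" where
  "skew_lines \<L> \<longleftrightarrow>
     finite \<L> \<and> (\<forall>L\<in>\<L>. line L) \<and> (\<forall>L\<in>\<L>. \<forall>M\<in>\<L>. L \<noteq> M \<longrightarrow> pts L \<inter> pts M = {})"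

section \<open>The groupoid of a set of skew lines and collinear completeness\<close>

text \<open>
  \<open>groupoid_arrow \<L> L M g\<close>: \<open>g\<close> is an arrow from \<open>L\<close> to \<open>M\<close> in the groupoid of \<open>\<L>\<close>, as an
  extensional function on the points of \<open>L\<close>. The generator from \<open>L\<^sub>i\<close> to \<open>L\<^sub>j\<close> given by a third
  line \<open>L\<^sub>k\<close> is \<open>projection L\<^sub>k L\<^sub>j\<close>.
\<close>

inductive groupoid_arrow ::
  "('a::field^'n) set set \<Rightarrow> ('a^'n) set \<Rightarrow> ('a^'n) set \<Rightarrow> (('a^'n) set \<Rightarrow> ('a^'n) set) \<Rightarrow> bool"
  for \<L> where
  identity: "L \<in> \<L> \<Longrightarrow> groupoid_arrow \<L> L L (\<lambda>p\<in>pts L. p)"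
| comp: "groupoid_arrow \<L> L Li g \<Longrightarrow> Li \<in> \<L> \<Longrightarrow> Lj \<in> \<L> \<Longrightarrow> Lk \<in> \<L> \<Longrightarrow> distinct [Li, Lj, Lk] \<Longrightarrow>
     groupoid_arrow \<L> L Lj (compose (pts L) (projection Lk Lj) g)"

definition groupoid_orbit :: "('a::field^'n) set set \<Rightarrow> ('a^'n) set \<Rightarrow> ('a^'n) set set" where
  "groupoid_orbit \<L> p = {g p | g L M. p \<in> pts L \<and> groupoid_arrow \<L> L M g}"

definition union_of_orbits :: "('a::field^'n) set set \<Rightarrow> ('a^'n) set set \<Rightarrow> bool" where
  "union_of_orbits \<L> Z \<longleftrightarrow>
     (\<exists>S. S \<subseteq> (\<Union>L\<in>\<L>. pts L) \<and> Z = (\<Union>p\<in>S. groupoid_orbit \<L> p))"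

definition collinearly_complete :: "('a::field^'n) set set \<Rightarrow> ('a^'n) set set \<Rightarrow> bool" where
  "collinearly_complete \<L> Z \<longleftrightarrow>
     Z \<noteq> {} \<and> Z \<subseteq> (\<Union>L\<in>\<L>. pts L) \<and>
     (\<forall>T. line T \<and> T \<notin> \<L> \<and> card {L\<in>\<L>. pts T \<inter> pts L \<noteq> {}} \<ge> 3 \<and> pts T \<inter> Z \<noteq> {}
        \<longrightarrow> pts T \<inter> (\<Union>L\<in>\<L>. pts L) \<subseteq> Z)"

section \<open>Forms, general points and transverse intersections\<close>

type_synonym ('a, 'n) mpoly = "('n \<Rightarrow>\<^sub>0 nat) \<Rightarrow>\<^sub>0 'a"

definition mpoly_eval :: "('a::field, 'n::finite) mpoly \<Rightarrow> 'a^'n \<Rightarrow> 'a" where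
  "mpoly_eval F v =
     (\<Sum>m\<in>Poly_Mapping.keys F. Poly_Mapping.lookup F m * (\<Prod>i\<in>UNIV. v $ i ^ Poly_Mapping.lookup m i))"

definition mpoly_pderiv :: "'n::finite \<Rightarrow> ('a::field, 'n) mpoly \<Rightarrow> ('a, 'n) mpoly" where
  "mpoly_pderiv i F =
     (\<Sum>m\<in>Poly_Mapping.keys F. Poly_Mapping.single (m - Poly_Mapping.single i 1)
        (of_nat (Poly_Mapping.lookup m i) * Poly_Mapping.lookup F m))"

definition form :: "nat \<Rightarrow> ('a::field, 'n::finite) mpoly \<Rightarrow> bool" where
  "form d F \<longleftrightarrow> (\<forall>m\<in>Poly_Mapping.keys F. (\<Sum>i\<in>UNIV. Poly_Mapping.lookup m i) = d)"

definition zeros :: "('a::field, 'n::finite) mpoly \<Rightarrow> ('a^'n) set set" where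
  "zeros F = {p. point p \<and> (\<forall>v\<in>p. mpoly_eval F v = 0)}"

definition zariski_closed :: "('a::field^'n) set set \<Rightarrow> bool" where
  "zariski_closed X \<longleftrightarrow>
     (\<exists>S. (\<forall>F\<in>S. \<exists>d. form d F) \<and> X = {p. point p \<and> (\<forall>F\<in>S. p \<in> zeros F)})"

definition general_point :: "(('a::field^'n) set \<Rightarrow> bool) \<Rightarrow> bool" where
  "general_point Q \<longleftrightarrow>
     (\<exists>X. zariski_closed X \<and> X \<noteq> {P. point P} \<and> (\<forall>P. point P \<and> P \<notin> X \<longrightarrow> Q P))"

text \<open>
  A plane curve of degree \<open>d\<close> in the plane \<open>H\<close> is given by a form of degree \<open>d\<close> on \<open>H\<close>, and every
  such form is the restriction of a form of degree \<open>d\<close> in the ambient coordinates. Over an infinite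
  field the restriction is a nonzero form on \<open>H\<close> iff it is nonzero as a function. The same curve is
  given by many ambient forms, but the notions below only depend on the restrictions to \<open>H\<close>.
\<close>

definition plane_curve :: "('a::field^'n) set \<Rightarrow> nat \<Rightarrow> ('a, 'n) mpoly \<Rightarrow> bool" where
  "plane_curve H d F \<longleftrightarrow> form d F \<and> (\<exists>v\<in>H. mpoly_eval F v \<noteq> 0)"

text \<open>
  The projective tangent space at \<open>p\<close> of the hypersurface defined by \<open>F\<close>. The partial derivatives are
  homogeneous, so for every \<open>v \<noteq> 0\<close> in \<open>p\<close> the condition is the same.
\<close>

definition tangent_space :: "('a::field, 'n::finite) mpoly \<Rightarrow> ('a^'n) set \<Rightarrow> ('a^'n) set" where
  "tangent_space F p =
     {w. \<forall>v\<in>p. (\<Sum>i\<in>UNIV. mpoly_eval (mpoly_pderiv i F) v * w $ i) = 0}"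

text \<open>
  On a plane \<open>H\<close>, the tangent spaces of two curves at a common point \<open>p\<close> meet only in \<open>p\<close> iff both
  curves are smooth at \<open>p\<close> with distinct tangent lines (at a singular point the tangent space
  is all of \<open>H\<close>).
\<close>

definition transverse_intersection ::
  "('a::field^'n) set \<Rightarrow> ('a, 'n) mpoly \<Rightarrow> ('a, 'n) mpoly \<Rightarrow> ('a^'n) set set \<Rightarrow> bool" where
  "transverse_intersection H F G X \<longleftrightarrow>
     X = pts H \<inter> zeros F \<inter> zeros G \<and>
     (\<forall>p\<in>X. H \<inter> tangent_space F p \<inter> tangent_space G p = p)"

section \<open>Geproci sets, grids and half grids\<close>

definition geproci :: "nat \<Rightarrow> nat \<Rightarrow> ('a::field^4) set set \<Rightarrow> bool" where
  "geproci a b Z \<longleftrightarrow>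
     finite Z \<and> (\<forall>p\<in>Z. point p) \<and> card Z = a * b \<and>
     general_point (\<lambda>P. \<forall>H. plane H \<and> \<not> P \<subseteq> H \<longrightarrow>
       card (projection P H ` Z) = a * b \<and>
       (\<exists>F G. plane_curve H a F \<and> plane_curve H b G \<and>
          transverse_intersection H F G (projection P H ` Z)))"

text \<open>
  The projections of the \<open>b\<close> skew lines are \<open>b\<close> distinct lines of \<open>H\<close>; a curve of degree \<open>b\<close> with
  their union as its set of points is that union, each line occurring with multiplicity one.
\<close>

definition geproci_wrt ::
  "nat \<Rightarrow> nat \<Rightarrow> ('a::field^4) set set \<Rightarrow> ('a^4) set set \<Rightarrow> bool" where
  "geproci_wrt a b \<L> Z \<longleftrightarrow>
     geproci a b Z \<and> skew_lines \<L> \<and> card \<L> = b \<and>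
     Z \<subseteq> (\<Union>L\<in>\<L>. pts L) \<and> (\<forall>L\<in>\<L>. card (Z \<inter> pts L) = a) \<and>
     general_point (\<lambda>P. \<forall>H. plane H \<and> \<not> P \<subseteq> H \<longrightarrow>
       (\<exists>F G. plane_curve H a F \<and> plane_curve H b G \<and>
          pts H \<inter> zeros G = (\<Union>L\<in>\<L>. pts (projection P H L)) \<and>
          transverse_intersection H F G (projection P H ` Z)))"

definition grid :: "nat \<Rightarrow> nat \<Rightarrow> ('a::field^4) set set \<Rightarrow> bool" where
  "grid a b Z \<longleftrightarrow>
     (\<exists>A B. skew_lines A \<and> card A = a \<and> skew_lines B \<and> card B = b \<and>
        (\<forall>L\<in>A. \<forall>M\<in>B. \<exists>!p. p \<in> pts L \<inter> pts M) \<and>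
        Z = (\<Union>L\<in>A. pts L) \<inter> (\<Union>M\<in>B. pts M))"

definition half_grid ::
  "nat \<Rightarrow> nat \<Rightarrow> ('a::field^4) set set \<Rightarrow> ('a^4) set set \<Rightarrow> bool" where
  "half_grid a b \<L> Z \<longleftrightarrow> geproci_wrt a b \<L> Z \<and> \<not> (\<exists>a' b'. grid a' b' Z)"

end

theory Submission
  imports Defs
begin

text \<open>
  Let \<open>g\<^sub>i\<close> be the form of degree \<open>a\<close> on \<open>L\<^sub>i\<close> that defines \<open>Z \<inter> L\<^sub>i\<close>, and project from a general point \<open>P\<close>.
  A plane curve of degree \<open>a\<close> cutting out the image of \<open>Z\<close> on the images of the lines is the same
  as a choice of nonzero scalars \<open>c\<^sub>i\<close> for which the forms \<open>c\<^sub>i g\<^sub>i\<close> agree at the intersections of these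
  images. Such scalars exist iff a cocycle condition holds for every three lines. Writing
  \<open>P = x\<^sub>i\<^sub>j + x\<^sub>j\<^sub>i\<close> with \<open>x\<^sub>i\<^sub>j\<close> in \<open>L\<^sub>i\<close> and \<open>x\<^sub>j\<^sub>i\<close> in \<open>L\<^sub>j\<close>, this condition is a polynomial identity in \<open>P\<close>.
  It holds if \<open>Z\<close> is stable under the maps of the groupoid, because these pull \<open>g\<^sub>j\<close> back to a multiple
  of \<open>g\<^sub>i\<close>; conversely, evaluating it at points \<open>P\<close> of the plane spanned by a point of \<open>Z \<inter> L\<^sub>i\<close> and \<open>L\<^sub>j\<close> shows
  that \<open>Z\<close> is stable.

  Grids are treated directly. A line containing three points of a grid is one of its lines, which
  settles \<open>a \<ge> 3\<close>. For \<open>a \<le> 2\<close> the map from \<open>L\<^sub>i\<close> to \<open>L\<^sub>j\<close> given by a third line turns out not to depend on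
  that line as far as points of \<open>Z\<close> are concerned, and so \<open>Z\<close> lies on \<open>a\<close> common transversals.
\<close>

section \<open>Forms as functions\<close>

text \<open>A form is handled as a function on the 4-space, and identities are proved on affine
  lines, where a one-variable polynomial with infinitely many zeros vanishes. A plane curve is
  replaced by the cone over it, a form invariant under translation by the vertex; so no coordinates
  on \<open>H\<close> occur and one cone serves for every plane \<open>H\<close>. Compatible scalars
  give a global form however many lines there are: on a new line the discrepancy is a binary form of
  degree \<open>a\<close> with known zeros, hence divisible by their equations, and zero if there
  are more than \<open>a\<close> of them. Three lines at a time suffice because all scalars are
  determined from one fixed line, and each remaining pair of lines forms a triangle with it. A half
  grid is required not to be a grid of any type whatsoever, so a grid with unknown parameters has to
  be recognised as an {a,b}-grid. For \<open>a \<le> 2\<close> its own lines are of little help: a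
  line carrying only two of the points may join them without being a line of the grid. Hence the
  transversals are constructed anew there.\<close>

lemma infinite_UNIV_alg_closed: "infinite (UNIV :: 'a::alg_closed_field set)"
proof
  assume fin: "finite (UNIV :: 'a set)"
  \<comment> \<open>Nonconstant, yet with value 1 at every element of a finite field.\<close>
  define p :: "'a poly" where "p = 1 + (\<Prod>c\<in>UNIV. [:- c, 1:])"
  have "degree (\<Prod>c\<in>UNIV. [:- c, 1 :: 'a:]) = card (UNIV :: 'a set)"
    by (subst degree_prod_eq_sum_degree) auto
  moreover have "card (UNIV :: 'a set) > 0"
    using fin by (simp add: card_gt_0_iff)
  ultimately have "degree p > 0"
    by (simp add: p_def degree_add_eq_right)
  then obtain x where "poly p x = 0"
    using alg_closed_imp_poly_has_root by blast
  moreover have "poly p x = 1"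
    using fin by (simp add: p_def poly_prod prod_zero_iff)
  ultimately show False by simp
qed

lemma poly_eq_0_of_all_roots:
  fixes p :: "'a::alg_closed_field poly"
  assumes "\<And>t. poly p t = 0"
  shows "p = 0"
proof (rule ccontr)
  assume "p \<noteq> 0"
  then have "finite {t. poly p t = 0}" by (rule poly_roots_finite)
  then show False using assms infinite_UNIV_alg_closed[where 'a = 'a] by simp
qed

section \<open>Linear forms and functions that are polynomial along lines\<close>

abbreviation functional :: "('a::field^'n \<Rightarrow> 'a) \<Rightarrow> bool" where
  "functional \<equiv> Vector_Spaces.linear (*s) (*)"

lemma functional_add: "functional l \<Longrightarrow> l (x + y) = l x + l y"
  and functional_scale: "functional l \<Longrightarrow> l (c *s x) = c * l x"
  and functional_diff: "functional l \<Longrightarrow> l (x - y) = l x - l y"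
  and functional_neg: "functional l \<Longrightarrow> l (- x) = - l x"
  and functional_0: "functional l \<Longrightarrow> l 0 = 0"
proof -
  assume "functional l"
  then interpret Vector_Spaces.linear "(*s)" "(*)" l .
  show "l (x + y) = l x + l y" "l (c *s x) = c * l x" "l (x - y) = l x - l y" "l (- x) = - l x" "l 0 = 0"
    by (simp_all add: add scale diff neg)
qed

lemmas functional_simps = functional_add functional_scale functional_diff functional_neg functional_0

lemma functionalI:
  assumes "\<And>x y. l (x + y) = l x + l y" "\<And>c x. l (c *s x) = c * l x"
  shows "functional l"
  by unfold_locales (simp_all add: assms algebra_simps)

lemma functional_coordinate: "functional (\<lambda>x. x $ i)"
  by (rule functionalI) auto

lemma functional_comp:
  "Vector_Spaces.linear (*s) (*s) T \<Longrightarrow> functional l \<Longrightarrow> functional (\<lambda>x. l (T x))"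
  by (rule functionalI)
    (simp_all add: functional_simps Vector_Spaces.linear.axioms vec.linear_add vec.linear_scale)

text \<open>A weak notion of polynomial function, with no bound on degrees and no coefficients; it
  is enough for the statement that a product of two nonzero functions is nonzero.\<close>

definition polynomial_on_lines :: "('a::field^'n \<Rightarrow> 'a) \<Rightarrow> bool" where
  "polynomial_on_lines f \<longleftrightarrow> (\<forall>u w. \<exists>q. \<forall>t. f (u + t *s w) = poly q t)"

lemma polynomial_on_lines_const: "polynomial_on_lines (\<lambda>x. c)"
  unfolding polynomial_on_lines_def by (intro allI exI[of _ "[:c:]"]) simp

lemma polynomial_on_lines_add:
  "polynomial_on_lines f \<Longrightarrow> polynomial_on_lines g \<Longrightarrow> polynomial_on_lines (\<lambda>x. f x + g x)"
  unfolding polynomial_on_lines_def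
proof (intro allI, goal_cases)
  case (1 u w)
  then obtain p q where "\<forall>t. f (u + t *s w) = poly p t" "\<forall>t. g (u + t *s w) = poly q t"
    by blast
  then show ?case
    by (intro exI[of _ "p + q"]) simp
qed

lemma polynomial_on_lines_mult:
  "polynomial_on_lines f \<Longrightarrow> polynomial_on_lines g \<Longrightarrow> polynomial_on_lines (\<lambda>x. f x * g x)"
  unfolding polynomial_on_lines_def
proof (intro allI, goal_cases)
  case (1 u w)
  then obtain p q where "\<forall>t. f (u + t *s w) = poly p t" "\<forall>t. g (u + t *s w) = poly q t"
    by blast
  then show ?case
    by (intro exI[of _ "p * q"]) simp
qed

lemma polynomial_on_lines_diff:
  "polynomial_on_lines f \<Longrightarrow> polynomial_on_lines g \<Longrightarrow> polynomial_on_lines (\<lambda>x. f x - g x)"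
  unfolding polynomial_on_lines_def
proof (intro allI, goal_cases)
  case (1 u w)
  then obtain p q where "\<forall>t. f (u + t *s w) = poly p t" "\<forall>t. g (u + t *s w) = poly q t"
    by blast
  then show ?case
    by (intro exI[of _ "p - q"]) simp
qed

lemma polynomial_on_lines_functional:
  assumes "functional l"
  shows "polynomial_on_lines l"
proof -
  have "l (u + t *s w) = poly [:l u, l w:] t" for u t w
    using assms by (simp add: functional_simps)
  then show ?thesis
    unfolding polynomial_on_lines_def by blast
qed

lemma polynomial_on_lines_affine:
  assumes "polynomial_on_lines f" "Vector_Spaces.linear (*s) (*s) T"
  shows "polynomial_on_lines (\<lambda>x. f (c + T x))"
proof -
  have "f (c + T (u + t *s w)) = f ((c + T u) + t *s T w)" for u t w
    using assms(2) by (simp add: vec.linear_add vec.linear_scale add.assoc)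
  then show ?thesis
    using assms(1) unfolding polynomial_on_lines_def by simp
qed

text \<open>Restrict to the line joining \<open>u\<close> and \<open>w\<close>: the one-variable
  polynomials have product zero because the field is infinite, and the first is nonzero at
  \<open>t = 0\<close>.\<close>

lemma polynomial_on_lines_prod_eq_0:
  fixes f g :: "'a::alg_closed_field^'n \<Rightarrow> 'a"
  assumes "polynomial_on_lines f" "polynomial_on_lines g"
    and "\<And>v. f v * g v = 0" and "f u \<noteq> 0"
  shows "g w = 0"
proof -
  obtain p q where p: "\<And>t. f (u + t *s (w - u)) = poly p t"
    and q: "\<And>t. g (u + t *s (w - u)) = poly q t"
    using assms(1,2) unfolding polynomial_on_lines_def by metis
  have "p * q = 0"
    by (rule poly_eq_0_of_all_roots) (simp add: p[symmetric] q[symmetric] assms(3))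
  moreover have "p \<noteq> 0"
    using p[of 0] assms(4) by auto
  ultimately have "poly q 1 = 0" by simp
  then show ?thesis
    using q[of 1] by simp
qed

text \<open>Irreducibility of affine space: two nonempty open conditions have a common point. This
  is how general vertices are found.\<close>

lemma polynomial_on_lines_nonzero_mult:
  fixes f g :: "'a::alg_closed_field^'n \<Rightarrow> 'a"
  assumes "polynomial_on_lines f" "polynomial_on_lines g" "f u \<noteq> 0" "g w \<noteq> 0"
  shows "\<exists>v. f v * g v \<noteq> 0"
  using polynomial_on_lines_prod_eq_0[OF assms(1,2)] assms(3,4) by blast

lemma polynomial_on_lines_prod:
  assumes "\<And>i. i \<in> I \<Longrightarrow> polynomial_on_lines (f i)"
  shows "polynomial_on_lines (\<lambda>x. \<Prod>i\<in>I. f i x)"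
  using assms
  by (induction I rule: infinite_finite_induct)
    (auto intro: polynomial_on_lines_const polynomial_on_lines_mult)

lemma polynomial_on_lines_nonzero_prod:
  fixes f :: "'i \<Rightarrow> 'a::alg_closed_field^'n \<Rightarrow> 'a"
  assumes "finite I" "\<And>i. i \<in> I \<Longrightarrow> polynomial_on_lines (f i)" "\<And>i. i \<in> I \<Longrightarrow> \<exists>v. f i v \<noteq> 0"
  shows "\<exists>v. (\<Prod>i\<in>I. f i v) \<noteq> 0"
  using assms
proof (induction I rule: finite_induct)
  case (insert i I)
  obtain u where "f i u \<noteq> 0" using insert.prems by auto
  moreover obtain w where "(\<Prod>i\<in>I. f i w) \<noteq> 0" using insert by auto
  ultimately have "\<exists>v. f i v * (\<Prod>i\<in>I. f i v) \<noteq> 0"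
    using insert.prems
    by (intro polynomial_on_lines_nonzero_mult[where u = u and w = w] polynomial_on_lines_prod) auto
  then show ?case using insert.hyps by simp
qed simp

text \<open>Forms of degree \<open>d\<close> invariant under translation by \<open>P\<close>, that is, equations of cones with vertex
  \<open>P\<close>; for \<open>P = 0\<close> these are all forms of degree \<open>d\<close>.\<close>

inductive cone_form :: "'a::field^'n \<Rightarrow> nat \<Rightarrow> ('a^'n \<Rightarrow> 'a) \<Rightarrow> bool" for P where
  const: "cone_form P 0 (\<lambda>x. c)"
| add: "cone_form P d f \<Longrightarrow> cone_form P d g \<Longrightarrow> cone_form P d (\<lambda>x. f x + g x)"
| mult: "functional l \<Longrightarrow> l P = 0 \<Longrightarrow> cone_form P d f \<Longrightarrow> cone_form P (Suc d) (\<lambda>x. l x * f x)"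

lemma functional_zero: "functional (\<lambda>x. 0)"
  by (rule functionalI) auto

lemma cone_form_zero: "cone_form P d (\<lambda>x. 0)"
proof (induction d)
  case (Suc d)
  then show ?case using cone_form.mult[OF functional_zero, of P d] by simp
qed (rule cone_form.const)

lemma cone_form_scale: "cone_form P d f \<Longrightarrow> cone_form P d (\<lambda>x. c * f x)"
proof (induction rule: cone_form.induct)
  case (const k)
  then show ?case by (rule cone_form.const)
next
  case (add d f g)
  then show ?case
    using cone_form.add[of P d "\<lambda>x. c * f x" "\<lambda>x. c * g x"] by (simp add: algebra_simps)
next
  case (mult l d f)
  then show ?case
    using cone_form.mult[of l P d "\<lambda>x. c * f x"] by (simp add: algebra_simps)
qed

lemma cone_form_diff:
  "cone_form P d f \<Longrightarrow> cone_form P d g \<Longrightarrow> cone_form P d (\<lambda>x. f x - g x)"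
  using cone_form.add[of P d f "\<lambda>x. - 1 * g x"] cone_form_scale[of P d g "- 1"] by simp

lemma cone_form_times:
  "cone_form P d f \<Longrightarrow> cone_form P e g \<Longrightarrow> cone_form P (d + e) (\<lambda>x. f x * g x)"
proof (induction rule: cone_form.induct)
  case (const k)
  then show ?case by (simp add: cone_form_scale)
next
  case (add d f f')
  then show ?case
    using cone_form.add[of P "d + e" "\<lambda>x. f x * g x" "\<lambda>x. f' x * g x"] by (simp add: algebra_simps)
next
  case (mult l d f)
  then show ?case
    using cone_form.mult[of l P "d + e" "\<lambda>x. f x * g x"] by (simp add: algebra_simps)
qed

lemma cone_form_functional: "functional l \<Longrightarrow> l P = 0 \<Longrightarrow> cone_form P 1 l"
  using cone_form.mult[OF _ _ cone_form.const[of P 1], of l] by simp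

lemma cone_form_power: "cone_form P d f \<Longrightarrow> cone_form P (k * d) (\<lambda>x. f x ^ k)"
  by (induction k) (auto intro: cone_form.const cone_form_times)

lemma cone_form_prod:
  assumes "\<And>i. i \<in> I \<Longrightarrow> cone_form P (e i) (f i)"
  shows "cone_form P (\<Sum>i\<in>I. e i) (\<lambda>x. \<Prod>i\<in>I. f i x)"
  using assms
  by (induction I rule: infinite_finite_induct) (auto intro: cone_form.const cone_form_times)

lemma cone_form_sum:
  assumes "\<And>i. i \<in> I \<Longrightarrow> cone_form P d (f i)"
  shows "cone_form P d (\<lambda>x. \<Sum>i\<in>I. f i x)"
  using assms
  by (induction I rule: infinite_finite_induct) (auto intro: cone_form_zero cone_form.add)

lemma cone_form_prod_functionals:
  "(\<And>i. i \<in> I \<Longrightarrow> functional (l i)) \<Longrightarrow> (\<And>i. i \<in> I \<Longrightarrow> l i P = 0) \<Longrightarrow>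
    cone_form P (card I) (\<lambda>x. \<Prod>i\<in>I. l i x)"
  using cone_form_prod[of I P "\<lambda>_. 1" l] cone_form_functional[of "l _" P] by simp

lemma cone_form_homogeneous: "cone_form P d f \<Longrightarrow> f (c *s x) = c ^ d * f x"
  by (induction rule: cone_form.induct) (auto simp: functional_simps algebra_simps)

lemma cone_form_translate: "cone_form P d f \<Longrightarrow> f (x + t *s P) = f x"
  by (induction rule: cone_form.induct) (auto simp: functional_simps)

lemma cone_form_comp:
  "cone_form Q d f \<Longrightarrow> Vector_Spaces.linear (*s) (*s) T \<Longrightarrow> T P = Q \<Longrightarrow> cone_form P d (\<lambda>x. f (T x))"
proof (induction rule: cone_form.induct)
  case (mult l d f)
  then show ?case
    using cone_form.mult[of "\<lambda>x. l (T x)" P d "\<lambda>x. f (T x)"] by (simp add: functional_comp)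
qed (auto intro: cone_form.intros)

lemma cone_form_imp_cone_form_0: "cone_form P d f \<Longrightarrow> cone_form 0 d f"
  by (induction rule: cone_form.induct) (auto intro: cone_form.intros simp: functional_0)

lemma polynomial_on_lines_cone_form: "cone_form P d f \<Longrightarrow> polynomial_on_lines f"
  by (induction rule: cone_form.induct)
    (auto intro: polynomial_on_lines_const polynomial_on_lines_add polynomial_on_lines_mult
      polynomial_on_lines_functional)

text \<open>The hyperplane \<open>k = 0\<close> misses \<open>P\<close>, so a form on it extends to
  the cone over it by composition with the projection from \<open>P\<close>, one linear factor at a
  time.\<close>

lemma cone_form_restrict:
  assumes "functional k" "k P \<noteq> 0" "cone_form 0 d f"
  shows "\<exists>g. cone_form P d g \<and> (\<forall>x. k x = 0 \<longrightarrow> g x = f x)"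
  using assms(3)
proof (induction rule: cone_form.induct)
  case (const c)
  then show ?case using cone_form.const by blast
next
  case (add d f f')
  then obtain g g' where "cone_form P d g" "\<forall>x. k x = 0 \<longrightarrow> g x = f x"
    "cone_form P d g'" "\<forall>x. k x = 0 \<longrightarrow> g' x = f' x" by blast
  then show ?case by (intro exI[of _ "\<lambda>x. g x + g' x"]) (simp add: cone_form.add)
next
  case (mult l d f)
  then obtain g where g: "cone_form P d g" "\<forall>x. k x = 0 \<longrightarrow> g x = f x" by blast
  \<comment> \<open>The functional \<open>l\<close> composed with the projection from
    \<open>P\<close> onto \<open>k = 0\<close>: it kills \<open>P\<close> and agrees with
    \<open>l\<close> on the hyperplane.\<close>
  define m where "m = (\<lambda>x. l x - l P / k P * k x)"
  have "functional m"
    using mult.hyps assms(1) by (intro functionalI) (auto simp: m_def functional_simps algebra_simps add_divide_distrib)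
  moreover have "m P = 0"
    using assms(2) by (simp add: m_def)
  ultimately have "cone_form P (Suc d) (\<lambda>x. m x * g x)"
    using g(1) by (rule cone_form.mult)
  then show ?case
    using g(2) by (intro exI[of _ "\<lambda>x. m x * g x"]) (auto simp: m_def)
qed

text \<open>On \<open>L\<close> every admissible linear form is a combination of \<open>m\<close>
  and \<open>n\<close>, so \<open>f\<close> restricts to a binary form in them, and modulo
  \<open>m\<close> only a multiple of \<open>n ^ d\<close> survives. The quotient has degree
  \<open>d - 1\<close>; in degree 0 it has to be zero, which truncated subtraction would not
  express.\<close>

lemma cone_form_decompose:
  assumes "functional m" "functional n" "m P = 0" "n P = 0"
    and span: "\<And>l. functional l \<Longrightarrow> l P = 0 \<Longrightarrow> \<exists>s t. \<forall>x\<in>L. l x = s * m x + t * n x"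
    and "cone_form P d f"
  shows "\<exists>g c. (case d of 0 \<Rightarrow> g = (\<lambda>x. 0) | Suc e \<Rightarrow> cone_form P e g) \<and>
    (\<forall>x\<in>L. f x = m x * g x + c * n x ^ d)"
  using assms(6)
proof (induction rule: cone_form.induct)
  case (const c)
  then show ?case by (auto intro: exI[of _ "\<lambda>x. 0"])
next
  case (add d f f')
  then obtain g c g' c' where
    g: "case d of 0 \<Rightarrow> g = (\<lambda>x. 0) | Suc e \<Rightarrow> cone_form P e g"
      "\<forall>x\<in>L. f x = m x * g x + c * n x ^ d" and
    g': "case d of 0 \<Rightarrow> g' = (\<lambda>x. 0) | Suc e \<Rightarrow> cone_form P e g'"
      "\<forall>x\<in>L. f' x = m x * g' x + c' * n x ^ d"
    by blast
  have "case d of 0 \<Rightarrow> (\<lambda>x. g x + g' x) = (\<lambda>x. 0) | Suc e \<Rightarrow> cone_form P e (\<lambda>x. g x + g' x)"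
    using g(1) g'(1) by (cases d) (auto intro: cone_form.add)
  moreover have "\<forall>x\<in>L. f x + f' x = m x * (g x + g' x) + (c + c') * n x ^ d"
    using g(2) g'(2) by (simp add: algebra_simps)
  ultimately show ?case by blast
next
  case (mult l d f)
  then obtain g c where
    g: "case d of 0 \<Rightarrow> g = (\<lambda>x. 0) | Suc e \<Rightarrow> cone_form P e g"
      "\<forall>x\<in>L. f x = m x * g x + c * n x ^ d"
    by blast
  obtain s t where st: "\<forall>x\<in>L. l x = s * m x + t * n x"
    using span mult.hyps by blast
  define h where "h = (\<lambda>x. s * f x + t * (n x * g x))"
  have "cone_form P d (\<lambda>x. n x * g x)"
    using g(1) assms(2,4) by (cases d) (auto intro: cone_form_zero cone_form.mult)
  then have "cone_form P d h"
    unfolding h_def using mult.hyps(3) by (intro cone_form.add cone_form_scale)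
  moreover have "\<forall>x\<in>L. l x * f x = m x * h x + (t * c) * n x ^ Suc d"
    using g(2) st by (auto simp: h_def algebra_simps)
  ultimately show ?case
    by (intro exI[of _ h] exI[of _ "t * c"]) simp
qed

text \<open>A binary form is divisible by the linear equations of its distinct zeros, split off one
  by one; with more zeros than its degree it vanishes on \<open>L\<close>, which is the alternative
  \<open>g = (\<lambda>x. 0)\<close>. Applied with \<open>P = 0\<close> to compare a form with the
  equation of \<open>Z\<close> on a line, and with \<open>P\<close> the vertex to glue.\<close>

lemma cone_form_divide:
  assumes "finite K"
    and "\<And>i. i \<in> K \<Longrightarrow> functional (m i)" "\<And>i. i \<in> K \<Longrightarrow> m i P = 0"
    and "\<And>i. i \<in> K \<Longrightarrow> y i \<in> L" "\<And>i. i \<in> K \<Longrightarrow> m i (y i) = 0"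
    and "\<And>i k. i \<in> K \<Longrightarrow> k \<in> K \<Longrightarrow> i \<noteq> k \<Longrightarrow> m k (y i) \<noteq> 0"
    and "\<And>i. i \<in> K \<Longrightarrow> \<exists>n. functional n \<and> n P = 0 \<and> n (y i) \<noteq> 0 \<and>
      (\<forall>l. functional l \<longrightarrow> l P = 0 \<longrightarrow> (\<exists>s t. \<forall>x\<in>L. l x = s * m i x + t * n x))"
    and "cone_form P d f" and "\<And>i. i \<in> K \<Longrightarrow> f (y i) = 0"
  shows "\<exists>g. (if card K \<le> d then cone_form P (d - card K) g else g = (\<lambda>x. 0)) \<and>
    (\<forall>x\<in>L. f x = (\<Prod>i\<in>K. m i x) * g x)"
  using assms
proof (induction K arbitrary: d f rule: finite_induct)
  case empty
  then show ?case by auto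
next
  case (insert k K)
  obtain n where n: "functional n" "n P = 0" "n (y k) \<noteq> 0"
    "\<And>l. functional l \<Longrightarrow> l P = 0 \<Longrightarrow> \<exists>s t. \<forall>x\<in>L. l x = s * m k x + t * n x"
    using insert.prems(6)[of k] by blast
  have "\<exists>g c. (case d of 0 \<Rightarrow> g = (\<lambda>x. 0) | Suc e \<Rightarrow> cone_form P e g) \<and>
    (\<forall>x\<in>L. f x = m k x * g x + c * n x ^ d)"
    by (rule cone_form_decompose[OF insert.prems(1) n(1) insert.prems(2) n(2) n(4)
        insert.prems(7)]) auto
  then obtain g c where g: "case d of 0 \<Rightarrow> g = (\<lambda>x. 0) | Suc e \<Rightarrow> cone_form P e g"
    "\<And>x. x \<in> L \<Longrightarrow> f x = m k x * g x + c * n x ^ d"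
    by blast
  have "c = 0"
    using g(2)[of "y k"] insert.prems(3,4,8)[of k] n(3) by simp
  then have f: "f x = m k x * g x" if "x \<in> L" for x
    using g(2) that by simp
  show ?case
  proof (cases d)
    case 0
    then show ?thesis
      using insert.hyps g(1) f by (auto intro!: exI[of _ "\<lambda>x. 0"])
  next
    case (Suc e)
    have "g (y i) = 0" if "i \<in> K" for i
      using f[of "y i"] insert.prems(3,8)[of i] insert.prems(5)[of i k] insert.hyps(2) that by auto
    moreover have "cone_form P e g"
      using g(1) Suc by simp
    ultimately have "\<exists>h. (if card K \<le> e then cone_form P (e - card K) h else h = (\<lambda>x. 0)) \<and>
      (\<forall>x\<in>L. g x = (\<Prod>i\<in>K. m i x) * h x)"
      by (intro insert.IH insert.prems) auto
    then obtain h where h: "if card K \<le> e then cone_form P (e - card K) h else h = (\<lambda>x. 0)"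
      "\<And>x. x \<in> L \<Longrightarrow> g x = (\<Prod>i\<in>K. m i x) * h x"
      by blast
    then show ?thesis
      using insert.hyps Suc f by (intro exI[of _ h]) (auto split: if_splits)
  qed
qed

section \<open>Forms with coefficients, their functions and their derivatives\<close>

lemma mpoly_eval_superset:
  assumes "finite K" "Poly_Mapping.keys F \<subseteq> K"
  shows "mpoly_eval F v =
    (\<Sum>m\<in>K. Poly_Mapping.lookup F m * (\<Prod>i\<in>UNIV. v $ i ^ Poly_Mapping.lookup m i))"
  unfolding mpoly_eval_def
  using assms by (intro sum.mono_neutral_left) (auto simp: in_keys_iff)

lemma mpoly_eval_add: "mpoly_eval (F + G) v = mpoly_eval F v + mpoly_eval G v"
proof -
  let ?K = "Poly_Mapping.keys F \<union> Poly_Mapping.keys G"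
  have "mpoly_eval F v =
      (\<Sum>m\<in>?K. Poly_Mapping.lookup F m * (\<Prod>i\<in>UNIV. v $ i ^ Poly_Mapping.lookup m i))"
    "mpoly_eval G v =
      (\<Sum>m\<in>?K. Poly_Mapping.lookup G m * (\<Prod>i\<in>UNIV. v $ i ^ Poly_Mapping.lookup m i))"
    "mpoly_eval (F + G) v =
      (\<Sum>m\<in>?K. Poly_Mapping.lookup (F + G) m * (\<Prod>i\<in>UNIV. v $ i ^ Poly_Mapping.lookup m i))"
    using keys_add[of F G] by (auto intro!: mpoly_eval_superset)
  then show ?thesis
    by (simp add: lookup_add distrib_right sum.distrib)
qed

lemma mpoly_eval_0: "mpoly_eval 0 v = 0"
  by (simp add: mpoly_eval_def)

lemma mpoly_eval_sum: "mpoly_eval (\<Sum>j\<in>J. F j) v = (\<Sum>j\<in>J. mpoly_eval (F j) v)"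
  by (induction J rule: infinite_finite_induct) (auto simp: mpoly_eval_0 mpoly_eval_add)

lemma mpoly_eval_single:
  "mpoly_eval (Poly_Mapping.single m c) v = c * (\<Prod>i\<in>UNIV. v $ i ^ Poly_Mapping.lookup m i)"
  using mpoly_eval_superset[of "{m}" "Poly_Mapping.single m c" v] by simp

lemma form_add: "form d F \<Longrightarrow> form d G \<Longrightarrow> form d (F + G)"
  unfolding form_def using keys_add[of F G] by blast

lemma form_0: "form d 0"
  by (simp add: form_def)

lemma form_sum: "(\<And>j. j \<in> J \<Longrightarrow> form d (F j)) \<Longrightarrow> form d (\<Sum>j\<in>J. F j)"
  by (induction J rule: infinite_finite_induct) (auto simp: form_0 form_add)

lemma form_single:
  "(\<Sum>i\<in>UNIV. Poly_Mapping.lookup m i) = d \<Longrightarrow> form d (Poly_Mapping.single m c)"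
  by (simp add: form_def)

lemma functional_eq_sum:
  fixes l :: "'a::field^'n \<Rightarrow> 'a"
  assumes "functional l"
  shows "l x = (\<Sum>i\<in>UNIV. l (axis i 1) * x $ i)"
proof -
  interpret Vector_Spaces.linear "(*s)" "(*)" l by fact
  have "l x = l (\<Sum>i\<in>UNIV. x $ i *s axis i 1)"
    by (simp add: basis_expansion)
  also have "\<dots> = (\<Sum>i\<in>UNIV. l (axis i 1) * x $ i)"
    by (simp add: sum scale mult.commute)
  finally show ?thesis .
qed

lemma form_mult_functional:
  fixes l :: "'a::field^'n \<Rightarrow> 'a"
  assumes "functional l" "form d F"
  shows "\<exists>G. form (Suc d) G \<and> (\<forall>v. mpoly_eval G v = l v * mpoly_eval F v)"
proof (intro exI[of _ "\<Sum>i\<in>UNIV. \<Sum>m\<in>Poly_Mapping.keys F.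
      Poly_Mapping.single (m + Poly_Mapping.single i 1) (l (axis i 1) * Poly_Mapping.lookup F m)"] conjI allI)
  show "form (Suc d) (\<Sum>i\<in>UNIV. \<Sum>m\<in>Poly_Mapping.keys F.
      Poly_Mapping.single (m + Poly_Mapping.single i 1) (l (axis i 1) * Poly_Mapping.lookup F m))"
    using assms(2)
    by (intro form_sum form_single) (simp add: form_def lookup_add sum.distrib lookup_single when_def)
  fix v :: "'a^'n"
  have "(\<Prod>j\<in>UNIV. v $ j ^ Poly_Mapping.lookup (m + Poly_Mapping.single i 1) j) =
      v $ i * (\<Prod>j\<in>UNIV. v $ j ^ Poly_Mapping.lookup m j)" for m i
  proof -
    have "(\<Prod>j\<in>UNIV. v $ j ^ Poly_Mapping.lookup (m + Poly_Mapping.single i 1) j) =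
        (\<Prod>j\<in>UNIV. (if j = i then v $ j else 1) * v $ j ^ Poly_Mapping.lookup m j)"
      by (intro prod.cong refl) (simp add: lookup_add lookup_single when_def)
    then show ?thesis by (simp add: prod.distrib)
  qed
  then show "mpoly_eval (\<Sum>i\<in>UNIV. \<Sum>m\<in>Poly_Mapping.keys F.
      Poly_Mapping.single (m + Poly_Mapping.single i 1) (l (axis i 1) * Poly_Mapping.lookup F m)) v =
      l v * mpoly_eval F v"
    by (subst functional_eq_sum[OF assms(1), of v])
      (simp add: mpoly_eval_sum mpoly_eval_single sum_distrib_right sum_distrib_left
        mpoly_eval_def[of F] mult_ac sum.swap[of _ "Poly_Mapping.keys F" UNIV])
qed

text \<open>With \<open>form_imp_cone_form\<close> this lets all constructions take place among
  functions. Invariance under \<open>P\<close> is not recorded in \<open>F\<close>, but can be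
  recovered from its values.\<close>

lemma cone_form_imp_form:
  "cone_form P d f \<Longrightarrow> \<exists>F. form d F \<and> (\<forall>v. mpoly_eval F v = f v)"
proof (induction rule: cone_form.induct)
  case (const c)
  then show ?case
    by (intro exI[of _ "Poly_Mapping.single 0 c"]) (simp add: form_single mpoly_eval_single)
next
  case (add d f g)
  then obtain F G where "form d F" "\<forall>v. mpoly_eval F v = f v" "form d G" "\<forall>v. mpoly_eval G v = g v"
    by blast
  then show ?case
    by (intro exI[of _ "F + G"]) (simp add: form_add mpoly_eval_add)
next
  case (mult l d f)
  then obtain F where "form d F" "\<forall>v. mpoly_eval F v = f v"
    by blast
  then show ?case
    using form_mult_functional[OF mult.hyps(1), of d F] by simp
qed

lemma form_imp_cone_form:
  assumes "form d F"
  shows "cone_form 0 d (mpoly_eval F)"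
proof -
  have "cone_form 0 d (\<lambda>v. Poly_Mapping.lookup F m * (\<Prod>i\<in>UNIV. v $ i ^ Poly_Mapping.lookup m i))"
    if "m \<in> Poly_Mapping.keys F" for m
  proof -
    have "cone_form 0 (\<Sum>i\<in>UNIV. Poly_Mapping.lookup m i * 1)
        (\<lambda>v. \<Prod>i\<in>UNIV. v $ i ^ Poly_Mapping.lookup m i)"
      by (intro cone_form_prod cone_form_power cone_form_functional functional_coordinate) simp
    moreover have "(\<Sum>i\<in>UNIV. Poly_Mapping.lookup m i * 1) = d"
      using assms that by (simp add: form_def)
    ultimately show ?thesis
      by (intro cone_form_scale) simp
  qed
  then show ?thesis
    unfolding mpoly_eval_def[abs_def] by (rule cone_form_sum)
qed

lemma pderiv_sum: "pderiv (\<Sum>j\<in>J. p j) = (\<Sum>j\<in>J. pderiv (p j))"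
  by (induction J rule: infinite_finite_induct) (auto simp: pderiv_add)

text \<open>The chain rule for formal derivatives, valid in every characteristic: the left factors
  of the product rule applied to each monomial are the monomials of the partial derivatives.\<close>

lemma mpoly_pderiv_directional:
  fixes F :: "('a::field, 'n::finite) mpoly"
  shows "\<exists>q. (\<forall>t. mpoly_eval F (v + t *s w) = poly q t) \<and>
    poly (pderiv q) 0 = (\<Sum>i\<in>UNIV. mpoly_eval (mpoly_pderiv i F) v * w $ i)"
proof -
  let ?e = "Poly_Mapping.lookup"
  define q where "q = (\<Sum>m\<in>Poly_Mapping.keys F. smult (?e F m) (\<Prod>i\<in>UNIV. [:v $ i, w $ i:] ^ ?e m i))"
  \<comment> \<open>Exponents are subtracted with truncation. A monomial with exponent 0 at
    \<open>i\<close> is thus left unchanged, but its coefficient in \<open>mpoly_pderiv\<close> is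
    0.\<close>
  have mono: "(\<Prod>j\<in>UNIV. v $ j ^ ?e (m - Poly_Mapping.single i 1) j) =
      (\<Prod>j\<in>UNIV - {i}. v $ j ^ ?e m j) * v $ i ^ (?e m i - 1)" for m :: "'n \<Rightarrow>\<^sub>0 nat" and i
  proof -
    have "(\<Prod>j\<in>UNIV. v $ j ^ ?e (m - Poly_Mapping.single i 1) j) =
        v $ i ^ ?e (m - Poly_Mapping.single i 1) i *
        (\<Prod>j\<in>UNIV - {i}. v $ j ^ ?e (m - Poly_Mapping.single i 1) j)"
      by (rule prod.remove) auto
    also have "(\<Prod>j\<in>UNIV - {i}. v $ j ^ ?e (m - Poly_Mapping.single i 1) j) =
        (\<Prod>j\<in>UNIV - {i}. v $ j ^ ?e m j)"
      by (intro prod.cong refl) (auto simp: lookup_minus lookup_single when_def)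
    finally show ?thesis by (simp add: lookup_minus)
  qed
  have "poly (pderiv q) 0 = (\<Sum>m\<in>Poly_Mapping.keys F. ?e F m *
      (\<Sum>i\<in>UNIV. (\<Prod>j\<in>UNIV - {i}. v $ j ^ ?e m j) * (of_nat (?e m i) * (v $ i ^ (?e m i - 1) * w $ i))))"
    by (simp add: q_def pderiv_sum pderiv_smult pderiv_prod pderiv_power poly_sum poly_prod pderiv_pCons mult_ac)
  also have "\<dots> = (\<Sum>i\<in>UNIV. mpoly_eval (mpoly_pderiv i F) v * w $ i)"
    unfolding mpoly_pderiv_def mpoly_eval_sum mpoly_eval_single mono sum_distrib_left sum_distrib_right
    by (subst sum.swap) (simp add: mult_ac)
  finally have "poly (pderiv q) 0 = (\<Sum>i\<in>UNIV. mpoly_eval (mpoly_pderiv i F) v * w $ i)" .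
  moreover have "mpoly_eval F (v + t *s w) = poly q t" for t
    by (simp add: q_def mpoly_eval_def poly_sum poly_prod mult.commute)
  ultimately show ?thesis by blast
qed

text \<open>Over an infinite field the polynomial describing \<open>F\<close> on a line is unique,
  so tangent spaces can be computed from any factorisation of the values of \<open>F\<close>,
  without its coefficients.\<close>

lemma directional_derivative_eq:
  fixes F :: "('a::alg_closed_field, 'n::finite) mpoly"
  assumes "\<And>t. mpoly_eval F (v + t *s w) = poly q t"
  shows "(\<Sum>i\<in>UNIV. mpoly_eval (mpoly_pderiv i F) v * w $ i) = poly (pderiv q) 0"
proof -
  obtain p where p: "\<And>t. mpoly_eval F (v + t *s w) = poly p t"
    "poly (pderiv p) 0 = (\<Sum>i\<in>UNIV. mpoly_eval (mpoly_pderiv i F) v * w $ i)"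
    using mpoly_pderiv_directional[of F v w] by blast
  have "p - q = 0"
    by (rule poly_eq_0_of_all_roots) (simp add: p(1)[symmetric] assms)
  then show ?thesis using p(2) by simp
qed

section \<open>Points and skew lines\<close>

lemma mem_span_singleton: "v \<in> vec.span {x} \<longleftrightarrow> (\<exists>c. v = c *s x)"
  by (auto simp: vec.span_singleton)

lemma point_iff: "point p \<longleftrightarrow> (\<exists>x. x \<noteq> 0 \<and> p = vec.span {x})"
proof
  assume "point p"
  then have p: "vec.subspace p" "vec.dim p = 1"
    by (auto simp: flat_def)
  obtain B where B: "B \<subseteq> p" "vec.independent B" "p \<subseteq> vec.span B" "card B = vec.dim p"
    by (rule vec.basis_exists)
  then obtain x where "B = {x}"
    using p(2) by (auto simp: card_1_singleton_iff)
  then have "p = vec.span {x}"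
    using B(1,3) p(1) vec.span_minimal[of "{x}" p] by auto
  moreover have "x \<noteq> 0"
    using B(2) \<open>B = {x}\<close> by (auto dest: vec.dependent_zero)
  ultimately show "\<exists>x. x \<noteq> 0 \<and> p = vec.span {x}"
    by blast
qed (auto simp: flat_def)

lemma point_span: "x \<noteq> 0 \<Longrightarrow> point (vec.span {x})"
  by (auto simp: point_iff)

lemma span_singleton_subset: "vec.subspace W \<Longrightarrow> vec.span {x} \<subseteq> W \<longleftrightarrow> x \<in> W"
  using vec.span_minimal[of "{x}" W] vec.span_base[of x "{x}"] by blast

lemma span_singleton_eq:
  "y \<noteq> 0 \<Longrightarrow> y \<in> vec.span {x} \<Longrightarrow> vec.span {y} = vec.span {x}"
proof -
  assume "y \<noteq> 0" "y \<in> vec.span {x}"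
  then obtain c where c: "y = c *s x" "c \<noteq> 0"
    by (auto simp: mem_span_singleton)
  then have "x = inverse c *s y" by simp
  then have "x \<in> vec.span {y}"
    by (auto simp: mem_span_singleton)
  then show ?thesis
    using \<open>y \<in> vec.span {x}\<close> by (simp add: vec.span_eq)
qed

lemma pts_iff: "vec.subspace W \<Longrightarrow> p \<in> pts W \<longleftrightarrow> (\<exists>x\<in>W. x \<noteq> 0 \<and> p = vec.span {x})"
  unfolding pts_def point_iff using span_singleton_subset[of W] by blast

lemma span_mem_pts: "vec.subspace W \<Longrightarrow> x \<noteq> 0 \<Longrightarrow> vec.span {x} \<in> pts W \<longleftrightarrow> x \<in> W"
  by (auto simp: pts_def point_span span_singleton_subset)

lemma line_subspace: "line L \<Longrightarrow> vec.subspace L"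
  by (simp add: flat_def)

lemma line_eq_span:
  assumes "line L" "x \<in> L" "y \<in> L" "y \<noteq> 0" "x \<notin> vec.span {y}"
  shows "L = vec.span {x, y}"
proof -
  have "vec.dim (vec.span {x, y}) = 2"
    using assms(4,5) by (simp add: vec.dim_insert)
  moreover have "vec.span {x, y} \<subseteq> L"
    using assms(1,2,3) vec.span_minimal[of "{x, y}" L] by (simp add: flat_def)
  ultimately show ?thesis
    using assms(1) vec.subspace_dim_equal[of "vec.span {x, y}" L] by (simp add: flat_def)
qed

lemma mem_span_pair: "v \<in> vec.span {x, y} \<longleftrightarrow> (\<exists>s t. v = s *s x + t *s y)"
  by (auto simp: vec.span_insert[of x] mem_span_singleton algebra_simps)

lemma line_span_pair:
  assumes "y \<noteq> 0" "x \<notin> vec.span {y}"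
  shows "line (vec.span {x, y})"
  using assms by (simp add: flat_def vec.dim_insert)

lemma line_coordinates:
  assumes "line L" "x \<in> L" "y \<in> L" "y \<noteq> 0" "x \<notin> vec.span {y}" "v \<in> L"
  shows "\<exists>s t. v = s *s x + t *s y"
  using line_eq_span[OF assms(1-5)] assms(6) mem_span_pair by blast

lemma line_not_subset_point:
  assumes "line L"
  shows "\<exists>x\<in>L. x \<notin> vec.span {y}"
proof (rule ccontr)
  assume "\<not> ?thesis"
  then have "vec.dim L \<le> vec.dim {y}"
    by (intro vec.dim_mono) auto
  also have "\<dots> \<le> 1" by simp
  finally show False
    using assms by (simp add: flat_def)
qed

lemma line_eq_of_two_points:
  assumes "line L" "line M" "p \<in> pts L" "q \<in> pts L" "p \<in> pts M" "q \<in> pts M" "p \<noteq> q"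
  shows "L = M"
proof -
  obtain x y where x: "x \<in> L" "x \<noteq> 0" "p = vec.span {x}" and y: "y \<in> L" "y \<noteq> 0" "q = vec.span {y}"
    using assms(1,3,4) by (auto simp: pts_iff line_subspace)
  moreover have "x \<notin> vec.span {y}"
    using span_singleton_eq[of x y] x y assms(7) by auto
  moreover have "x \<in> M" "y \<in> M"
    using assms(2,5,6) x y by (auto simp: span_mem_pts line_subspace)
  ultimately show ?thesis
    using line_eq_span[of L x y] line_eq_span[of M x y] assms(1,2) by simp
qed

definition skew :: "('a::field^4) set \<Rightarrow> ('a^4) set \<Rightarrow> bool" where
  "skew L M \<longleftrightarrow> line L \<and> line M \<and> pts L \<inter> pts M = {}"

lemma skew_commute: "skew L M \<Longrightarrow> skew M L"
  by (auto simp: skew_def)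

lemma skew_linesD: "skew_lines \<L> \<Longrightarrow> L \<in> \<L> \<Longrightarrow> M \<in> \<L> \<Longrightarrow> L \<noteq> M \<Longrightarrow> skew L M"
  by (auto simp: skew_lines_def skew_def)

lemma skew_linesD_line: "skew_lines \<L> \<Longrightarrow> L \<in> \<L> \<Longrightarrow> line L"
  by (auto simp: skew_lines_def)

lemma skew_subspace: "skew L M \<Longrightarrow> vec.subspace L" "skew L M \<Longrightarrow> vec.subspace M"
  by (auto simp: skew_def flat_def)

lemma skew_linesD_subspace: "skew_lines \<L> \<Longrightarrow> L \<in> \<L> \<Longrightarrow> vec.subspace L"
  by (auto simp: skew_lines_def flat_def)

lemma skew_linesD_distinct:
  assumes "skew_lines \<L>" "L \<in> \<L>" "M \<in> \<L>" "N \<in> \<L>" "distinct [L, M, N]"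
  shows "skew L M" "skew M L" "skew L N" "skew N L" "skew M N" "skew N M"
  using assms(5) by (simp_all add: skew_linesD[OF assms(1)] assms(2-4) eq_commute)

lemma skew_Int:
  assumes "skew L M" "v \<in> L" "v \<in> M"
  shows "v = 0"
proof (rule ccontr)
  assume "v \<noteq> 0"
  then have "vec.span {v} \<in> pts L \<inter> pts M"
    using assms span_mem_pts[of L v] span_mem_pts[of M v] skew_subspace[OF assms(1)] \<open>v \<noteq> 0\<close> by simp
  then show False
    using assms(1) by (auto simp: skew_def)
qed

lemma skew_sum:
  assumes "skew L M"
  shows "\<exists>x\<in>L. v - x \<in> M"
proof -
  have lines: "vec.subspace L" "vec.subspace M" "vec.dim L = 2" "vec.dim M = 2"
    using assms by (auto simp: skew_def flat_def)
  let ?S = "{x + y | x y. x \<in> L \<and> y \<in> M}"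
  have "L \<inter> M \<subseteq> {0}"
    using skew_Int[OF assms] by blast
  then have "vec.dim (L \<inter> M) = 0"
    by (simp add: vec.dim_eq_0)
  then have "vec.dim ?S = vec.dim (UNIV :: ('a^4) set)"
    using vec.dim_sums_Int[of L M] lines by (simp add: vec_dim_card del: vec.dim_UNIV vec.dim_eq_0)
  then have "?S = UNIV"
    using lines by (intro vec.subspace_dim_equal vec.subspace_sums) auto
  then obtain x y where "v = x + y" "x \<in> L" "y \<in> M"
    by blast
  then show ?thesis by (intro bexI[of _ x]) auto
qed

text \<open>The linear projection onto \<open>L\<close> with kernel \<open>M\<close>, for skew
  lines; these are complementary subspaces of the 4-space. In the overview
  \<open>x\<^sub>i\<^sub>j\<close> is \<open>component L\<^sub>i L\<^sub>j P\<close>. The target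
  comes first here, whereas \<open>projection\<close> takes the centre first.\<close>

definition component :: "('a::field^4) set \<Rightarrow> ('a^4) set \<Rightarrow> 'a^4 \<Rightarrow> 'a^4" where
  "component L M v = (THE x. x \<in> L \<and> v - x \<in> M)"

lemma component_unique:
  assumes "skew L M" "x \<in> L" "v - x \<in> M"
  shows "component L M v = x"
  unfolding component_def
proof (rule the_equality)
  fix y assume y: "y \<in> L \<and> v - y \<in> M"
  have "y - x \<in> L"
    using y assms(2) skew_subspace[OF assms(1)] by (simp add: vec.subspace_diff)
  moreover have "(v - x) - (v - y) \<in> M"
    using vec.subspace_diff[OF skew_subspace(2)[OF assms(1)] assms(3)] y by blast
  then have "y - x \<in> M"
    by (simp add: algebra_simps)
  ultimately show "y = x"
    using skew_Int[OF assms(1), of "y - x"] by simp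
qed (use assms in blast)

lemma component_mem: "skew L M \<Longrightarrow> component L M v \<in> L"
  and diff_component_mem: "skew L M \<Longrightarrow> v - component L M v \<in> M"
  using component_unique skew_sum[of L M v] by metis+

lemma component_sum: "skew L M \<Longrightarrow> component L M v + component M L v = v"
  using component_unique[of M L "v - component L M v" v] component_mem[of L M v]
    diff_component_mem[of L M v] skew_commute[of L M] by simp

lemma linear_component:
  assumes "skew L M"
  shows "Vector_Spaces.linear (*s) (*s) (component L M)"
proof (rule Vector_Spaces.linear.intro[OF vec.vector_space_axioms vec.vector_space_axioms])
  have sub: "vec.subspace L" "vec.subspace M"
    using skew_subspace[OF assms] by auto
  have "component L M (x + y) = component L M x + component L M y" for x y
  proof (rule component_unique[OF assms])
    show "component L M x + component L M y \<in> L"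
      using sub component_mem[OF assms] by (simp add: vec.subspace_add)
    show "x + y - (component L M x + component L M y) \<in> M"
      using vec.subspace_add[OF sub(2) diff_component_mem[OF assms, of x] diff_component_mem[OF assms, of y]]
      by (simp add: algebra_simps)
  qed
  moreover have "component L M (c *s x) = c *s component L M x" for c x
  proof (rule component_unique[OF assms])
    show "c *s component L M x \<in> L"
      using sub component_mem[OF assms] by (simp add: vec.subspace_scale)
    show "c *s x - c *s component L M x \<in> M"
      using vec.subspace_scale[OF sub(2) diff_component_mem[OF assms, of x], of c]
      by (simp add: vec.scale_right_diff_distrib)
  qed
  ultimately show "module_hom (*s) (*s) (component L M)"
    by unfold_locales (simp_all add: vec.scale_right_distrib vec.scale_left_distrib)
qed

lemma component_add: "skew L M \<Longrightarrow> component L M (x + y) = component L M x + component L M y"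
  and component_scale: "skew L M \<Longrightarrow> component L M (c *s x) = c *s component L M x"
  and component_diff: "skew L M \<Longrightarrow> component L M (x - y) = component L M x - component L M y"
  by (rule vec.linear_add vec.linear_scale vec.linear_diff, erule linear_component)+

lemma component_self: "skew L M \<Longrightarrow> v \<in> L \<Longrightarrow> component L M v = v"
  using vec.subspace_0[of M] skew_subspace[of L M] by (intro component_unique) auto

lemma component_eq_0_iff: "skew L M \<Longrightarrow> component L M v = 0 \<longleftrightarrow> v \<in> M"
  using component_unique[of L M 0 v] diff_component_mem[of L M v] vec.subspace_0[of L]
    skew_subspace[of L M] by auto

lemma component_nonzero: "skew L M \<Longrightarrow> skew L N \<Longrightarrow> v \<in> N \<Longrightarrow> skew M N \<Longrightarrow> v \<noteq> 0 \<Longrightarrow> component L M v \<noteq> 0"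
  using skew_Int component_eq_0_iff by blast

text \<open>The kernel \<open>N\<close> of \<open>component M N\<close> meets \<open>L\<close> only
  in zero.\<close>

lemma component_span_inj:
  assumes "skew M N" "skew L N" "x \<in> L" "y \<in> L" "component M N x \<in> vec.span {component M N y}"
  shows "x \<in> vec.span {y}"
proof -
  obtain c where "component M N x = c *s component M N y"
    using assms(5) by (auto simp: mem_span_singleton)
  then have "component M N (x - c *s y) = 0"
    by (simp add: component_diff component_scale assms(1))
  then have "x - c *s y \<in> N"
    using component_eq_0_iff[OF assms(1)] by blast
  moreover have "x - c *s y \<in> L"
    using skew_subspace(1)[OF assms(2)] assms(3,4) by (simp add: vec.subspace_diff vec.subspace_scale)
  ultimately have "x - c *s y = 0"
    using skew_Int[OF assms(2)] by blast
  then show ?thesis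
    by (auto simp: mem_span_singleton)
qed

text \<open>Replaces the generators of the groupoid, given by spans and intersections, by linear
  maps: a vector of the span of \<open>x\<close> and \<open>N\<close> is a multiple of
  \<open>x\<close> modulo \<open>N\<close>.\<close>

lemma projection_eq_component:
  assumes "skew M N"
  shows "projection N M (vec.span {x}) = vec.span {component M N x}"
proof (intro equalityI subsetI)
  have N: "vec.subspace N" and M: "vec.subspace M"
    using skew_subspace[OF assms] by auto
  have span: "v \<in> vec.span (vec.span {x} \<union> N) \<longleftrightarrow> (\<exists>k. v - k *s x \<in> N)" for v
  proof -
    have "vec.span (vec.span {x} \<union> N) = vec.span (insert x N)"
    proof (intro equalityI vec.span_minimal)
      show "vec.span {x} \<union> N \<subseteq> vec.span (insert x N)"
        using vec.span_mono[of "{x}" "insert x N"] vec.span_superset[of "insert x N"] by auto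
      show "insert x N \<subseteq> vec.span (vec.span {x} \<union> N)"
        using vec.span_superset[of "vec.span {x} \<union> N"] vec.span_base[of x "{x}"] by auto
    qed auto
    moreover have "vec.span N = N"
      using N by simp
    ultimately show ?thesis
      by (simp add: vec.span_insert)
  qed
  fix v
  show "v \<in> vec.span {component M N x}" if "v \<in> projection N M (vec.span {x})"
  proof -
    obtain k where k: "v - k *s x \<in> N" and v: "v \<in> M"
      using \<open>v \<in> projection N M (vec.span {x})\<close> span[of v] unfolding projection_def by blast
    have "k *s x - v \<in> N"
      using vec.subspace_neg[OF N k] by simp
    then have "component M N (k *s x) = v"
      by (rule component_unique[OF assms v])
    then show ?thesis
      by (auto simp: component_scale[OF assms] mem_span_singleton)
  qed
  show "v \<in> projection N M (vec.span {x})" if "v \<in> vec.span {component M N x}"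
  proof -
    obtain k where "v = k *s component M N x"
      using \<open>v \<in> vec.span {component M N x}\<close> by (auto simp: mem_span_singleton)
    then have v: "v = component M N (k *s x)"
      by (simp add: component_scale[OF assms])
    have "v - k *s x \<in> N"
      using vec.subspace_neg[OF N diff_component_mem[OF assms, of "k *s x"]] v by simp
    then show ?thesis
      using component_mem[OF assms] v by (auto simp: projection_def span)
  qed
qed

section \<open>Collinear completeness and the groupoid\<close>

text \<open>Stability under the generators of the groupoid: the form to which completeness, unions
  of orbits, grids and half grids are all reduced.\<close>

definition projection_closed :: "('a::field^4) set set \<Rightarrow> ('a^4) set set \<Rightarrow> bool" where
  "projection_closed \<L> Z \<longleftrightarrow>
     (\<forall>L\<in>\<L>. \<forall>M\<in>\<L>. \<forall>N\<in>\<L>. distinct [L, M, N] \<longrightarrow> (\<forall>p\<in>Z \<inter> pts L. projection N M p \<in> Z))"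

lemma projection_mem_pts:
  fixes \<L> :: "('a::field^4) set set"
  assumes "skew_lines \<L>" "L \<in> \<L>" "M \<in> \<L>" "N \<in> \<L>" "distinct [L, M, N]" "p \<in> pts L"
  shows "projection N M p \<in> pts M"
proof -
  obtain x where x: "x \<in> L" "x \<noteq> 0" "p = vec.span {x}"
    using assms(2,6) pts_iff[OF skew_linesD_subspace[OF assms(1)]] by blast
  have sk: "skew M N" "skew N L" "skew M L"
    using skew_linesD_distinct[OF assms(1-5)] by blast+
  have "component M N x \<noteq> 0"
    using component_nonzero[of M N L x] sk x by blast
  then show ?thesis
    using sk component_mem[OF sk(1), of x] x
    by (simp add: projection_eq_component span_mem_pts skew_subspace(1))
qed

text \<open>Two distinct points \<open>p\<close> and \<open>r\<close> of \<open>T\<close> lie in the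
  plane spanned by \<open>p\<close> and \<open>N\<close>, so \<open>T\<close> does; hence
  \<open>q\<close> is the point where this plane meets \<open>M\<close>.\<close>

lemma transversal_meets_in_projection:
  assumes "skew M N" "line T" "p \<in> pts T" "q \<in> pts T" "r \<in> pts T" "q \<in> pts M" "r \<in> pts N"
    and "p \<noteq> r"
  shows "projection N M p = q"
proof -
  have sub: "vec.subspace T" "vec.subspace M" "vec.subspace N"
    using assms(2) skew_subspace[OF assms(1)] by (auto simp: flat_def)
  obtain x where x: "x \<in> T" "x \<noteq> 0" "p = vec.span {x}"
    using assms(3) sub by (auto simp: pts_iff)
  obtain y where y: "y \<in> M" "y \<noteq> 0" "q = vec.span {y}"
    using assms(6) sub by (auto simp: pts_iff)
  obtain z where z: "z \<in> N" "z \<noteq> 0" "r = vec.span {z}"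
    using assms(7) sub by (auto simp: pts_iff)
  have T: "y \<in> T" "z \<in> T"
    using assms(4,5) sub y z by (auto simp: span_mem_pts)
  have "x \<notin> vec.span {z}"
    using span_singleton_eq[of x z] x z assms(8) by auto
  then obtain s t where st: "y = s *s x + t *s z"
    using line_eq_span[OF assms(2) x(1) T(2) z(2)] T(1) by (auto simp: mem_span_pair)
  have "component M N (s *s x) = y"
    using y(1) z(1) st sub(3) assms(1) by (intro component_unique) (auto simp: vec.subspace_scale vec.subspace_neg)
  then have "y \<in> vec.span {component M N x}"
    using assms(1) by (auto simp: mem_span_singleton component_scale)
  then show ?thesis
    using span_singleton_eq[OF y(2)] projection_eq_component[OF assms(1), of x] x y by simp
qed

lemma skew_lines_unique:
  "skew_lines \<L> \<Longrightarrow> L \<in> \<L> \<Longrightarrow> M \<in> \<L> \<Longrightarrow> p \<in> pts L \<Longrightarrow> p \<in> pts M \<Longrightarrow> L = M"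
  unfolding skew_lines_def by blast

text \<open>The map from \<open>L\<close> to \<open>M\<close> with centre \<open>N\<close> moves a
  point along its transversal to \<open>M\<close> and \<open>N\<close>. Conversely, on a line
  meeting three lines, any two of its points on different lines are related by such a map, a third
  line being the centre.\<close>

lemma collinearly_complete_iff_projection_closed:
  assumes \<L>: "skew_lines \<L>" and Z: "Z \<noteq> {}" "Z \<subseteq> (\<Union>L\<in>\<L>. pts L)"
  shows "collinearly_complete \<L> Z \<longleftrightarrow> projection_closed \<L> Z"
proof
  have fin: "finite \<L>"
    using \<L> by (simp add: skew_lines_def)
  assume cc: "collinearly_complete \<L> Z"
  show "projection_closed \<L> Z"
    unfolding projection_closed_def
  proof (intro ballI impI)
    fix L M N p
    assume lmn: "L \<in> \<L>" "M \<in> \<L>" "N \<in> \<L>" "distinct [L, M, N]" and p: "p \<in> Z \<inter> pts L"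
    have sub: "vec.subspace L" "vec.subspace M" "vec.subspace N"
      using lmn skew_linesD_subspace[OF \<L>] by blast+
    have sk: "skew M N" "skew N M" "skew N L" "skew M L"
      using skew_linesD_distinct[OF \<L> lmn] by blast+
    obtain x where x: "x \<in> L" "x \<noteq> 0" "p = vec.span {x}"
      using p sub by (auto simp: pts_iff)
    define y z where "y = component M N x" and "z = component N M x"
    have y: "y \<in> M" "y \<noteq> 0" and z: "z \<in> N" "z \<noteq> 0" and xyz: "x = y + z"
      using component_nonzero[of M N L x] component_nonzero[of N M L x] sk x
      by (auto simp: y_def z_def component_mem component_sum)
    have nin: "y \<notin> vec.span {z}"
    proof
      assume "y \<in> vec.span {z}"
      then have "y \<in> N"
        using z(1) sub(3) span_singleton_subset by blast
      then show False
        using skew_Int[OF sk(1) y(1)] y(2) by simp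
    qed
    \<comment> \<open>The transversal of \<open>M\<close> and \<open>N\<close> through
      \<open>p\<close>, spanned by the two summands of \<open>x\<close>.\<close>
    define T where "T = vec.span {y, z}"
    have T: "line T" "vec.subspace T"
      using line_span_pair[OF z(2) nin] by (auto simp: T_def)
    have mem: "y \<in> T" "z \<in> T"
      using vec.span_base[of y "{y, z}"] vec.span_base[of z "{y, z}"] by (auto simp: T_def)
    then have "x \<in> T"
      using xyz T(2) vec.subspace_add by blast
    then have meet: "p \<in> pts T \<inter> pts L" "vec.span {y} \<in> pts T \<inter> pts M" "vec.span {z} \<in> pts T \<inter> pts N"
      using mem T x y z sub by (auto simp: span_mem_pts)
    have "T \<notin> \<L>"
      using skew_lines_unique[OF \<L>, of T M] skew_lines_unique[OF \<L>, of T N] lmn meet by auto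
    moreover have "card {L, M, N} \<le> card {L\<in>\<L>. pts T \<inter> pts L \<noteq> {}}"
      using meet lmn fin by (intro card_mono) auto
    then have "card {L\<in>\<L>. pts T \<inter> pts L \<noteq> {}} \<ge> 3"
      using lmn(4) by simp
    ultimately have "pts T \<inter> (\<Union>L\<in>\<L>. pts L) \<subseteq> Z"
      using cc T(1) meet(1) p unfolding collinearly_complete_def by blast
    then have "vec.span {y} \<in> Z"
      using meet(2) lmn(2) by blast
    then show "projection N M p \<in> Z"
      by (simp add: x(3) projection_eq_component[OF sk(1)] y_def)
  qed
next
  assume closed: "projection_closed \<L> Z"
  have "pts T \<inter> (\<Union>L\<in>\<L>. pts L) \<subseteq> Z"
    if T: "line T" "T \<notin> \<L>" "card {L\<in>\<L>. pts T \<inter> pts L \<noteq> {}} \<ge> 3" "pts T \<inter> Z \<noteq> {}" for T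
  proof
    fix r assume "r \<in> pts T \<inter> (\<Union>L\<in>\<L>. pts L)"
    then obtain M where r: "r \<in> pts T" "M \<in> \<L>" "r \<in> pts M" by blast
    obtain p L where p: "p \<in> pts T" "p \<in> Z" "L \<in> \<L>" "p \<in> pts L"
      using T(4) Z(2) by blast
    show "r \<in> Z"
    proof (cases "r = p")
      case False
      have "L \<noteq> M"
        using line_eq_of_two_points[OF T(1) skew_linesD_line[OF \<L> p(3)] p(1) r(1) p(4)] False T(2) p(3) r(3)
        by auto
      \<comment> \<open>At least three lines are met, so one remains besides \<open>L\<close> and
        \<open>M\<close> to serve as centre.\<close>
      have "\<not> {L\<in>\<L>. pts T \<inter> pts L \<noteq> {}} \<subseteq> {L, M}"
      proof
        assume "{L\<in>\<L>. pts T \<inter> pts L \<noteq> {}} \<subseteq> {L, M}"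
        then have "card {L\<in>\<L>. pts T \<inter> pts L \<noteq> {}} \<le> card {L, M}"
          by (intro card_mono) auto
        then show False
          using T(3) \<open>L \<noteq> M\<close> by simp
      qed
      then obtain N s where N: "N \<in> \<L>" "s \<in> pts T" "s \<in> pts N" "N \<noteq> L" "N \<noteq> M"
        by blast
      have "p \<noteq> s"
        using skew_lines_unique[OF \<L> p(3) N(1) p(4)] N(3,4) by auto
      then have "projection N M p = r"
        using transversal_meets_in_projection[of M N T p r s] skew_linesD[OF \<L> r(2) N(1)] N r p T(1) by auto
      then show ?thesis
        using closed p r(2) N \<open>L \<noteq> M\<close> unfolding projection_closed_def by fastforce
    qed (use p in simp)
  qed
  then show "collinearly_complete \<L> Z"
    using Z by (auto simp: collinearly_complete_def)
qed

lemma groupoid_arrow_maps: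
  fixes \<L> :: "('a::field^4) set set"
  assumes "skew_lines \<L>" "groupoid_arrow \<L> L M g" "p \<in> pts L"
  shows "L \<in> \<L> \<and> M \<in> \<L> \<and> g p \<in> pts M \<and> (projection_closed \<L> Z \<longrightarrow> p \<in> Z \<longrightarrow> g p \<in> Z)"
  using assms(2,3)
proof (induction rule: groupoid_arrow.induct)
  case (comp L Li g Lj Lk)
  have IH: "L \<in> \<L>" "Li \<in> \<L>" "g p \<in> pts Li" "projection_closed \<L> Z \<longrightarrow> p \<in> Z \<longrightarrow> g p \<in> Z"
    using comp.IH comp.prems by auto
  have "projection_closed \<L> Z \<longrightarrow> g p \<in> Z \<longrightarrow> projection Lk Lj (g p) \<in> Z"
    using comp.hyps IH(3) unfolding projection_closed_def by blast
  moreover have "compose (pts L) (projection Lk Lj) g p = projection Lk Lj (g p)"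
    using comp.prems by (simp add: compose_def)
  ultimately show ?case
    using projection_mem_pts[OF assms(1) comp.hyps(2-5) IH(3)] IH comp.hyps by metis
qed auto

text \<open>Orbits are stable since a generator can be appended to any arrow. Conversely a stable
  \<open>Z\<close> is the union of the orbits of its own points: induction on arrows keeps them
  inside \<open>Z\<close>, identities give the points back.\<close>

lemma union_of_orbits_iff_projection_closed:
  assumes \<L>: "skew_lines \<L>" and Z: "Z \<subseteq> (\<Union>L\<in>\<L>. pts L)"
  shows "union_of_orbits \<L> Z \<longleftrightarrow> projection_closed \<L> Z"
proof
  assume "union_of_orbits \<L> Z"
  then obtain S where S: "Z = (\<Union>p\<in>S. groupoid_orbit \<L> p)"
    by (auto simp: union_of_orbits_def)
  show "projection_closed \<L> Z"
    unfolding projection_closed_def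
  proof (intro ballI impI)
    fix L M N p
    assume lmn: "L \<in> \<L>" "M \<in> \<L>" "N \<in> \<L>" "distinct [L, M, N]" and p: "p \<in> Z \<inter> pts L"
    obtain s K L' g where s: "s \<in> S" "p = g s" "s \<in> pts K" "groupoid_arrow \<L> K L' g"
      using p S by (auto simp: groupoid_orbit_def)
    then have "L' = L"
      using groupoid_arrow_maps[OF \<L> s(4,3)] skew_lines_unique[OF \<L>] lmn(1) p by blast
    then have "groupoid_arrow \<L> K M (compose (pts K) (projection N M) g)"
      using groupoid_arrow.comp[OF s(4)[unfolded \<open>L' = L\<close>] lmn] by simp
    moreover have "compose (pts K) (projection N M) g s = projection N M p"
      using s by (simp add: compose_def)
    ultimately have "projection N M p \<in> groupoid_orbit \<L> s"
      using s(3) unfolding groupoid_orbit_def by (metis (mono_tags, lifting) mem_Collect_eq)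
    then show "projection N M p \<in> Z"
      using S s(1) by blast
  qed
next
  assume closed: "projection_closed \<L> Z"
  have "groupoid_orbit \<L> p \<subseteq> Z" if "p \<in> Z" for p
    using groupoid_arrow_maps[OF \<L>] closed that by (fastforce simp: groupoid_orbit_def)
  moreover have "p \<in> groupoid_orbit \<L> p" if "p \<in> Z" for p
  proof -
    obtain L where L: "L \<in> \<L>" "p \<in> pts L"
      using Z \<open>p \<in> Z\<close> by blast
    then have "(\<lambda>p\<in>pts L. p) p = p" by simp
    then show ?thesis
      unfolding groupoid_orbit_def using groupoid_arrow.identity[OF L(1)] L(2)
      by (metis (mono_tags, lifting) mem_Collect_eq)
  qed
  ultimately show "union_of_orbits \<L> Z"
    using Z unfolding union_of_orbits_def by blast
qed

section \<open>Equations of point sets on skew lines\<close>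

lemma functional_extension:
  fixes w :: "'a::field^'n"
  assumes "vec.subspace W" "w \<notin> W"
  shows "\<exists>l. functional l \<and> (\<forall>x\<in>W. l x = 0) \<and> l w = 1"
proof -
  obtain B where B: "finite B" "B \<subseteq> W" "vec.independent B" "vec.span B = W"
    using vec.basis_subspace_exists[OF assms(1)] by metis
  then have "vec.independent (insert w B)"
    using assms(2) vec.independent_insertI by blast
  \<comment> \<open>Vectors along one arbitrary axis stand in for scalars; the coordinate
    \<open>undefined\<close> of the extended map is the desired functional.\<close>
  then obtain T where T: "Vector_Spaces.linear (*s) (*s) T"
    "\<forall>x\<in>insert w B. T x = (if x = w then axis undefined 1 else 0 :: 'a^'n)"
    using vec.linear_independent_extend[of "insert w B" "\<lambda>x. if x = w then axis undefined 1 else 0"] by blast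
  have "T x = 0" if "x \<in> W" for x
  proof (rule vec.linear_eq_0_on_span[OF T(1)])
    show "T b = 0" if "b \<in> B" for b
      using T(2) that B(2) assms(2) by auto
    show "x \<in> vec.span B"
      using that B(4) by simp
  qed
  then show ?thesis
    using functional_comp[OF T(1) functional_coordinate[of undefined]] T(2)
    by (intro exI[of _ "\<lambda>x. T x $ undefined"]) (simp add: axis_def)
qed

lemma point_functional:
  assumes "line L" "p \<in> pts L"
  shows "\<exists>l. functional l \<and> (\<forall>x\<in>L. l x = 0 \<longleftrightarrow> x \<in> p)"
proof -
  have L: "vec.subspace L"
    using assms(1) by (simp add: flat_def)
  obtain y where y: "y \<in> L" "y \<noteq> 0" "p = vec.span {y}"
    using assms(2) pts_iff[OF L] by blast
  obtain x where x: "x \<in> L" "x \<notin> p"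
    using line_not_subset_point[OF assms(1)] y(3) by blast
  obtain l where l: "functional l" "\<forall>x\<in>p. l x = 0" "l x = 1"
    using functional_extension[of p x] x(2) y(3) by auto
  have "l v = 0 \<longleftrightarrow> v \<in> p" if "v \<in> L" for v
  proof -
    obtain s t where "v = s *s x + t *s y"
      using line_coordinates[OF assms(1) x(1) y(1,2), of v] x(2) y(3) \<open>v \<in> L\<close> by blast
    moreover have "l y = 0"
      using l(2) y(3) vec.span_base[of y "{y}"] by simp
    ultimately have "l v = s" "s = 0 \<Longrightarrow> v \<in> p"
      using l y(3) by (auto simp: functional_simps mem_span_singleton)
    then show ?thesis
      using l(2) by auto
  qed
  then show ?thesis
    using l(1) by blast
qed

text \<open>Both induce nonzero functionals on the one-dimensional quotient of \<open>L\<close> by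
  \<open>p\<close>.\<close>

lemma functionals_proportional:
  assumes "line L" "p \<in> pts L" "functional l" "functional m"
    and "\<And>x. x \<in> L \<Longrightarrow> l x = 0 \<longleftrightarrow> x \<in> p" "\<And>x. x \<in> L \<Longrightarrow> m x = 0 \<longleftrightarrow> x \<in> p"
  shows "\<exists>k. k \<noteq> 0 \<and> (\<forall>x\<in>L. m x = k * l x)"
proof -
  have L: "vec.subspace L"
    using assms(1) by (simp add: flat_def)
  obtain y where y: "y \<in> L" "y \<noteq> 0" "p = vec.span {y}"
    using assms(2) pts_iff[OF L] by blast
  obtain x where x: "x \<in> L" "x \<notin> p"
    using line_not_subset_point[OF assms(1)] y(3) by blast
  have y0: "l y = 0" "m y = 0"
    using assms(5,6)[OF y(1)] y(3) vec.span_base[of y "{y}"] by auto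
  have x0: "l x \<noteq> 0" "m x \<noteq> 0"
    using assms(5,6)[OF x(1)] x(2) by auto
  have "m v = m x / l x * l v" if "v \<in> L" for v
  proof -
    obtain s t where "v = s *s x + t *s y"
      using line_coordinates[OF assms(1) x(1) y(1,2), of v] x(2) y(3) \<open>v \<in> L\<close> by blast
    then show ?thesis
      using assms(3,4) y0 x0 by (simp add: functional_simps)
  qed
  then show ?thesis
    using x0 by (intro exI[of _ "m x / l x"]) simp
qed

lemma infinite_pts_line:
  fixes L :: "('a::alg_closed_field^'n) set"
  assumes "line L"
  shows "infinite (pts L)"
proof -
  have L: "vec.subspace L"
    using assms by (simp add: flat_def)
  obtain y where y: "y \<in> L" "y \<noteq> 0"
    using line_not_subset_point[OF assms, of 0] by auto
  obtain x where x: "x \<in> L" "x \<notin> vec.span {y}"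
    using line_not_subset_point[OF assms] by blast
  let ?f = "\<lambda>t. vec.span {x + t *s y}"
  have nz: "x + t *s y \<noteq> 0" for t
  proof
    assume "x + t *s y = 0"
    then have "x = (- t) *s y"
      by (simp add: eq_neg_iff_add_eq_0)
    then show False
      using x(2) unfolding mem_span_singleton by blast
  qed
  have "inj ?f"
  proof (rule injI)
    fix s t assume "?f s = ?f t"
    then obtain c where c: "x + s *s y = c *s (x + t *s y)"
      using vec.span_base[of "x + s *s y" "{x + s *s y}"] by (auto simp: mem_span_singleton)
    have eq: "(1 - c) *s x = (c * t - s) *s y"
      using c by (simp add: algebra_simps)
    have "c = 1"
    proof (rule ccontr)
      assume "c \<noteq> 1"
      then have "x = inverse (1 - c) *s ((1 - c) *s x)"
        by simp
      then have "x = (inverse (1 - c) * (c * t - s)) *s y"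
        using eq by (metis vec.scale_scale)
      then show False
        using x(2) by (auto simp: mem_span_singleton)
    qed
    then show "s = t"
      using eq y(2) by simp
  qed
  then have "infinite (range ?f)"
    using infinite_UNIV_alg_closed finite_imageD by blast
  moreover have "range ?f \<subseteq> pts L"
    using nz x y L by (auto simp: span_mem_pts vec.subspace_add vec.subspace_scale)
  ultimately show ?thesis
    using finite_subset by blast
qed

text \<open>The parameter \<open>ell\<close> fixes one linear equation for each point of
  \<open>Z\<close> on its line. It is indexed by the point alone because disjointness of the lines
  makes a point determine its line.\<close>

locale points_on_skew_lines =
  fixes \<L> :: "('a::alg_closed_field^4) set set" and Z :: "('a^4) set set" and a :: nat
    and ell :: "('a^4) set \<Rightarrow> 'a^4 \<Rightarrow> 'a"
  assumes skew_lines: "skew_lines \<L>"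
    and Z_subset: "Z \<subseteq> (\<Union>L\<in>\<L>. pts L)"
    and card_Z_pts: "\<And>L. L \<in> \<L> \<Longrightarrow> card (Z \<inter> pts L) = a"
    and a_pos: "a \<ge> 1"
    and functional_ell: "\<And>L z. L \<in> \<L> \<Longrightarrow> z \<in> Z \<inter> pts L \<Longrightarrow> functional (ell z)"
    and ell_eq_0_iff: "\<And>L z x. L \<in> \<L> \<Longrightarrow> z \<in> Z \<inter> pts L \<Longrightarrow> x \<in> L \<Longrightarrow> ell z x = 0 \<longleftrightarrow> x \<in> z"

lemma points_on_skew_lines_exists:
  fixes \<L> :: "('a::alg_closed_field^4) set set"
  assumes "skew_lines \<L>" "Z \<subseteq> (\<Union>L\<in>\<L>. pts L)" "\<And>L. L \<in> \<L> \<Longrightarrow> card (Z \<inter> pts L) = a" "a \<ge> 1"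
  shows "\<exists>ell. points_on_skew_lines \<L> Z a ell"
proof -
  have "\<exists>l. functional l \<and> (\<forall>L\<in>\<L>. z \<in> pts L \<longrightarrow> (\<forall>x\<in>L. l x = 0 \<longleftrightarrow> x \<in> z))" if "z \<in> Z" for z
  proof -
    obtain L where L: "L \<in> \<L>" "z \<in> pts L"
      using assms(2) \<open>z \<in> Z\<close> by blast
    obtain l where "functional l" "\<forall>x\<in>L. l x = 0 \<longleftrightarrow> x \<in> z"
      using point_functional[OF skew_linesD_line[OF assms(1) L(1)] L(2)] by blast
    then show ?thesis
      using skew_lines_unique[OF assms(1) L(1) _ L(2)] by blast
  qed
  then obtain ell where ell: "\<And>z. z \<in> Z \<Longrightarrow> functional (ell z)"
    "\<And>z L x. z \<in> Z \<Longrightarrow> L \<in> \<L> \<Longrightarrow> z \<in> pts L \<Longrightarrow> x \<in> L \<Longrightarrow> ell z x = 0 \<longleftrightarrow> x \<in> z"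
    by metis
  have "points_on_skew_lines \<L> Z a ell"
    unfolding points_on_skew_lines_def using assms ell by blast
  then show ?thesis by blast
qed

context points_on_skew_lines
begin

text \<open>The form \<open>g\<^sub>i\<close> of the overview. As a function it is defined on the
  whole space, but only its restriction to \<open>L\<close> is determined by \<open>Z\<close>, up to
  a scalar.\<close>

definition eqn :: "('a^4) set \<Rightarrow> 'a^4 \<Rightarrow> 'a" where
  "eqn L x = (\<Prod>z\<in>Z \<inter> pts L. ell z x)"

lemma finite_Z_pts: "L \<in> \<L> \<Longrightarrow> finite (Z \<inter> pts L)"
  using card_Z_pts[of L] a_pos card.infinite[of "Z \<inter> pts L"] by auto

lemma eqn_eq_0_iff:
  assumes "L \<in> \<L>" "x \<in> L" "x \<noteq> 0"
  shows "eqn L x = 0 \<longleftrightarrow> vec.span {x} \<in> Z"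
proof -
  have sub: "vec.subspace L"
    using assms(1) skew_linesD_subspace skew_lines by blast
  have "eqn L x = 0 \<longleftrightarrow> (\<exists>z\<in>Z \<inter> pts L. x \<in> z)"
    using assms finite_Z_pts ell_eq_0_iff by (auto simp: eqn_def prod_zero_iff)
  also have "\<dots> \<longleftrightarrow> vec.span {x} \<in> Z"
  proof
    assume "\<exists>z\<in>Z \<inter> pts L. x \<in> z"
    then obtain z where z: "z \<in> Z" "z \<in> pts L" "x \<in> z" by blast
    then obtain y where "z = vec.span {y}"
      using pts_iff[OF sub] by blast
    then show "vec.span {x} \<in> Z"
      using span_singleton_eq[OF assms(3)] z by simp
  next
    assume "vec.span {x} \<in> Z"
    then show "\<exists>z\<in>Z \<inter> pts L. x \<in> z"
      using span_mem_pts[OF sub assms(3)] assms(2) vec.span_base[of x "{x}"] by auto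
  qed
  finally show ?thesis .
qed

lemma cone_form_eqn: "L \<in> \<L> \<Longrightarrow> cone_form 0 a (eqn L)"
  using cone_form_prod_functionals[of "Z \<inter> pts L" ell 0] functional_ell card_Z_pts
  by (auto simp: eqn_def[abs_def] functional_0)

lemma eqn_0: "L \<in> \<L> \<Longrightarrow> eqn L 0 = 0"
  using cone_form_homogeneous[OF cone_form_eqn, of L 0 0] a_pos by (simp add: power_0_left)

lemma eqn_neg: "L \<in> \<L> \<Longrightarrow> eqn L (- x) = (- 1) ^ a * eqn L x"
  using cone_form_homogeneous[OF cone_form_eqn, of L "- 1" x] by simp

lemma eqn_nonzero: "L \<in> \<L> \<Longrightarrow> \<exists>x\<in>L. eqn L x \<noteq> 0"
proof -
  assume L: "L \<in> \<L>"
  have "\<not> pts L \<subseteq> Z \<inter> pts L"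
    using infinite_pts_line[OF skew_linesD_line[OF skew_lines L]] finite_Z_pts[OF L] finite_subset by blast
  then obtain p where "p \<in> pts L" "p \<notin> Z" by blast
  then obtain x where "x \<in> L" "x \<noteq> 0" "p = vec.span {x}"
    using pts_iff[OF skew_linesD_subspace[OF skew_lines L], of p] by blast
  moreover have "vec.span {x} \<notin> Z"
    using \<open>p \<notin> Z\<close> \<open>p = vec.span {x}\<close> by simp
  ultimately have "x \<in> L \<and> x \<noteq> 0 \<and> vec.span {x} \<notin> Z" by simp
  then show ?thesis
    using eqn_eq_0_iff[OF L] by blast
qed

text \<open>The map is injective on points and sends \<open>Z \<inter> pts L\<close> into
  \<open>Z \<inter> pts M\<close>. Both sets have \<open>a\<close> elements, so it is a bijection
  between them, and the linear factors that correspond to each other are proportional.\<close>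

lemma eqn_component:
  assumes closed: "projection_closed \<L> Z"
    and lmn: "L \<in> \<L>" "M \<in> \<L>" "N \<in> \<L>" "distinct [L, M, N]"
  shows "\<exists>k. k \<noteq> 0 \<and> (\<forall>x\<in>L. eqn M (component M N x) = k * eqn L x)"
proof -
  note sk = skew_linesD_distinct[OF skew_lines lmn]
  let ?f = "component M N" and ?p = "projection N M"
  have sub: "vec.subspace L" "vec.subspace M"
    using skew_linesD_subspace[OF skew_lines] lmn by auto
  have inj0: "x \<in> vec.span {y}" if "?f x \<in> vec.span {?f y}" "x \<in> L" "y \<in> L" for x y
    using component_span_inj[OF sk(5,3) that(2,3,1)] .
  have factor: "\<exists>k. k \<noteq> 0 \<and> (\<forall>x\<in>L. ell (?p z) (?f x) = k * ell z x)" if z: "z \<in> Z \<inter> pts L" for z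
  proof (rule functionals_proportional)
    show "line L" "z \<in> pts L" "functional (ell z)"
      using lmn(1) skew_linesD_line[OF skew_lines] z functional_ell by auto
    have pz: "?p z \<in> Z \<inter> pts M"
      using closed lmn z projection_mem_pts[OF skew_lines lmn] unfolding projection_closed_def by blast
    show "functional (\<lambda>x. ell (?p z) (?f x))"
      using functional_comp[OF linear_component[OF sk(5)] functional_ell[OF lmn(2) pz]] .
    fix x assume x: "x \<in> L"
    show "ell z x = 0 \<longleftrightarrow> x \<in> z"
      using ell_eq_0_iff[OF lmn(1) z x] .
    obtain y where y: "y \<in> L" "z = vec.span {y}"
      using z pts_iff[OF sub(1)] by blast
    have "ell (?p z) (?f x) = 0 \<longleftrightarrow> ?f x \<in> vec.span {?f y}"
      using ell_eq_0_iff[OF lmn(2) pz component_mem[OF sk(5)]] y(2) projection_eq_component[OF sk(5)] by simp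
    also have "\<dots> \<longleftrightarrow> x \<in> z"
      using inj0[OF _ x y(1)] y(2) component_scale[OF sk(5)] by (auto simp: mem_span_singleton)
    finally show "ell (?p z) (?f x) = 0 \<longleftrightarrow> x \<in> z" .
  qed
  have "inj_on ?p (Z \<inter> pts L)"
  proof (rule inj_onI)
    fix z z' assume z: "z \<in> Z \<inter> pts L" "z' \<in> Z \<inter> pts L" "?p z = ?p z'"
    obtain y where y: "y \<in> L" "y \<noteq> 0" "z = vec.span {y}"
      using z(1) pts_iff[OF sub(1), of z] by blast
    obtain y' where y': "y' \<in> L" "z' = vec.span {y'}"
      using z(2) pts_iff[OF sub(1), of z'] by blast
    have "y \<in> vec.span {y'}"
      using inj0[of y y'] z(3) y y' projection_eq_component[OF sk(5)] vec.span_base[of "?f y" "{?f y}"] by simp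
    then show "z = z'"
      using span_singleton_eq[OF y(2)] y y' by simp
  qed
  moreover have "?p ` (Z \<inter> pts L) \<subseteq> Z \<inter> pts M"
    using closed lmn projection_mem_pts[OF skew_lines lmn] unfolding projection_closed_def by blast
  ultimately have bij: "bij_betw ?p (Z \<inter> pts L) (Z \<inter> pts M)"
    using card_Z_pts lmn finite_Z_pts[OF lmn(2)]
    by (simp add: bij_betw_def card_image card_subset_eq)
  obtain k where k: "\<And>z. z \<in> Z \<inter> pts L \<Longrightarrow> k z \<noteq> 0"
    "\<And>z x. z \<in> Z \<inter> pts L \<Longrightarrow> x \<in> L \<Longrightarrow> ell (?p z) (?f x) = k z * ell z x"
    using factor by metis
  have "eqn M (?f x) = (\<Prod>z\<in>Z \<inter> pts L. k z) * eqn L x" if "x \<in> L" for x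
  proof -
    have "eqn M (?f x) = (\<Prod>z\<in>Z \<inter> pts L. ell (?p z) (?f x))"
      unfolding eqn_def by (rule prod.reindex_bij_betw[OF bij, symmetric])
    also have "\<dots> = (\<Prod>z\<in>Z \<inter> pts L. k z * ell z x)"
      using k(2) that by (intro prod.cong) auto
    finally show ?thesis
      by (simp add: eqn_def prod.distrib)
  qed
  moreover have "(\<Prod>z\<in>Z \<inter> pts L. k z) \<noteq> 0"
    using k(1) finite_Z_pts[OF lmn(1)] by (simp add: prod_zero_iff)
  ultimately show ?thesis by blast
qed

text \<open>For a vertex \<open>v\<close> of projection, \<open>component L M v\<close> and \<open>- component M L v\<close> are vectors on \<open>L\<close>
  and \<open>M\<close> with the same image, the intersection of the images of \<open>L\<close> and \<open>M\<close>. The condition thus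
  says that multiples of the equations \<open>eqn\<close> glue along the triangle formed by the images of the
  three lines.\<close>

definition cocycle :: "('a^4) set \<Rightarrow> ('a^4) set \<Rightarrow> ('a^4) set \<Rightarrow> 'a^4 \<Rightarrow> bool" where
  "cocycle L M N v \<longleftrightarrow>
     eqn L (component L M v) * eqn M (component M N v) * eqn N (component N L v) =
     (- 1) ^ a * (eqn M (component M L v) * eqn N (component N M v) * eqn L (component L N v))"

text \<open>Everything is transported to \<open>L\<close>. Write \<open>v = u + e + n\<close> with
  \<open>u\<close>, \<open>e\<close> in \<open>L\<close>, \<open>n\<close> in \<open>N\<close> and
  \<open>e + n\<close> in \<open>M\<close>. Up to \<open>eqn_component\<close> the six arguments
  become \<open>u\<close>, \<open>e\<close> and \<open>u + e\<close>, once on each side, and both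
  sides equal the same sign times \<open>k * k' * eqn L u * eqn L e * eqn L (u + e)\<close>.\<close>

lemma projection_closed_imp_cocycle:
  assumes closed: "projection_closed \<L> Z"
    and lmn: "L \<in> \<L>" "M \<in> \<L>" "N \<in> \<L>" "distinct [L, M, N]"
  shows "cocycle L M N v"
proof -
  note sk = skew_linesD_distinct[OF skew_lines lmn]
  obtain k where k: "\<forall>x\<in>L. eqn M (component M N x) = k * eqn L x"
    using eqn_component[OF assms] by blast
  obtain k' where k': "\<forall>x\<in>L. eqn N (component N M x) = k' * eqn L x"
    using eqn_component[OF closed lmn(1,3,2)] lmn(4) by auto
  define u y e n where "u = component L M v" and "y = component M L v"
    and "e = component L N y" and "n = component N L y"
  have v: "v = u + y" and y: "y = e + n"
    using component_sum[OF sk(1), of v] component_sum[OF sk(3), of y] by (auto simp: u_def y_def e_def n_def)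
  have mem: "u \<in> L" "y \<in> M" "e \<in> L" "n \<in> N"
    using component_mem sk by (auto simp: u_def y_def e_def n_def)
  have sub: "vec.subspace L" "vec.subspace N"
    using skew_subspace sk by auto
  have e: "component M N e = y" "component N M e = - n"
    using mem y sk sub by (auto intro!: component_unique simp: vec.subspace_neg)
  have *: "component L N v = u + e" "component N L v = n" "component M N v = component M N (u + e)"
    "component N M v = component N M u"
    using mem sk component_self[OF sk(3) mem(1)] component_eq_0_iff[OF sk(4)]
      component_self[OF sk(5) mem(2)] component_eq_0_iff[OF sk(6)] e
    by (auto simp: v component_add e_def n_def)
  have "eqn N n = (- 1) ^ a * eqn N (component N M e)"
    using eqn_neg[OF lmn(3), of n] e(2) by (simp flip: power_mult_distrib mult.assoc)
  moreover have "u + e \<in> L"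
    using mem sub by (simp add: vec.subspace_add)
  moreover have "eqn M (component M L v) = eqn M (component M N e)"
    using e by (simp add: y_def)
  ultimately show ?thesis
    unfolding cocycle_def * using k k' mem by (simp add: u_def[symmetric])
qed

text \<open>Provides vertices \<open>x + y\<close> for which the cocycle condition can be cancelled
  down to a single factor. Each inequality is attained somewhere on \<open>M\<close>, hence both are
  attained together.\<close>

lemma eqn_combination_nonzero:
  assumes lmn: "L \<in> \<L>" "M \<in> \<L>" "N \<in> \<L>" "distinct [L, M, N]" and x: "x \<in> L"
  shows "\<exists>y\<in>M. eqn M y \<noteq> 0 \<and> eqn L (x + component L N y) \<noteq> 0"
proof -
  note sk = skew_linesD_distinct[OF skew_lines lmn]
  \<comment> \<open>Composition with \<open>component M L\<close> makes these functions on the whole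
    space; \<open>0 +\<close> gives the first one the affine shape required by
    \<open>polynomial_on_lines_affine\<close>.\<close>
  let ?f = "\<lambda>v. eqn M (0 + component M L v)" and ?g = "\<lambda>v. eqn L (x + component L N (component M L v))"
  obtain y where y: "y \<in> M" "eqn M y \<noteq> 0"
    using eqn_nonzero[OF lmn(2)] by blast
  obtain z where z: "z \<in> L" "eqn L z \<noteq> 0"
    using eqn_nonzero[OF lmn(1)] by blast
  \<comment> \<open>On \<open>M\<close> the map \<open>component L N\<close> inverts
    \<open>component M N\<close> on \<open>L\<close>, so this \<open>w\<close> turns the argument of
    \<open>eqn L\<close> into \<open>z\<close>.\<close>
  define w where "w = component M N (z - x)"
  have "z - x \<in> L"
    using z x skew_subspace[OF sk(1)] by (simp add: vec.subspace_diff)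
  have "component L N (component N M (z - x)) = 0"
    using component_eq_0_iff[OF sk(3)] component_mem[OF sk(6)] by simp
  then have "component L N w = component L N (component M N (z - x) + component N M (z - x))"
    by (simp add: w_def component_add sk(3))
  also have "\<dots> = z - x"
    using component_sum[OF sk(5)] component_self[OF sk(3) \<open>z - x \<in> L\<close>] by simp
  finally have w: "w \<in> M" "component L N w = z - x"
    using component_mem[OF sk(5)] by (auto simp: w_def)
  have "\<exists>v. ?f v * ?g v \<noteq> 0"
  proof (rule polynomial_on_lines_nonzero_mult[where u = y and w = w])
    show "polynomial_on_lines ?f"
      by (intro polynomial_on_lines_affine polynomial_on_lines_cone_form[OF cone_form_eqn[OF lmn(2)]]
          linear_component sk)
    have "Vector_Spaces.linear (*s) (*s) (component L N \<circ> component M L)"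
      using Vector_Spaces.linear_compose[OF linear_component[OF sk(2)] linear_component[OF sk(3)]] .
    then show "polynomial_on_lines ?g"
      using polynomial_on_lines_affine[OF polynomial_on_lines_cone_form[OF cone_form_eqn[OF lmn(1)]]]
      by (auto simp: o_def)
    show "?f y \<noteq> 0" "?g w \<noteq> 0"
      using y z w component_self[OF sk(2)] by auto
  qed
  then show ?thesis
    using component_mem[OF sk(2)] by auto
qed

text \<open>Take the vertex \<open>x + y\<close> with \<open>x\<close> spanning the given point and
  \<open>y\<close> in \<open>N\<close>. In the condition for \<open>L\<close>, \<open>N\<close>,
  \<open>M\<close> the factor \<open>eqn L x\<close> kills one side; on the other side only
  \<open>eqn M (component M N x)\<close> can vanish, and its argument spans the image of the
  point.\<close>

lemma cocycle_imp_projection_closed: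
  assumes "\<And>L M N v. L \<in> \<L> \<Longrightarrow> M \<in> \<L> \<Longrightarrow> N \<in> \<L> \<Longrightarrow> distinct [L, M, N] \<Longrightarrow> cocycle L M N v"
  shows "projection_closed \<L> Z"
  unfolding projection_closed_def
proof (intro ballI impI)
  fix L M N p
  assume lmn: "L \<in> \<L>" "M \<in> \<L>" "N \<in> \<L>" "distinct [L, M, N]" and p: "p \<in> Z \<inter> pts L"
  have lnm: "distinct [L, N, M]"
    using lmn(4) by auto
  note sk = skew_linesD_distinct[OF skew_lines lmn]
  obtain x where x: "x \<in> L" "x \<noteq> 0" "p = vec.span {x}"
    using p pts_iff[OF skew_subspace(1)[OF sk(1)]] by blast
  obtain y where y: "y \<in> N" "eqn N y \<noteq> 0" "eqn L (x + component L M y) \<noteq> 0"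
    using eqn_combination_nonzero[OF lmn(1,3,2) lnm x(1)] by blast
  have "component L N (x + y) = x" "component N L (x + y) = y" "component M N (x + y) = component M N x"
    "component L M (x + y) = x + component L M y"
    using component_self[OF sk(3) x(1)] component_self[OF sk(4) y(1)] component_self[OF sk(1) x(1)]
      component_eq_0_iff[OF sk(3)] component_eq_0_iff[OF sk(4)] component_eq_0_iff[OF sk(5)] x y sk
    by (simp_all add: component_add)
  moreover have "eqn L x = 0"
    using eqn_eq_0_iff[OF lmn(1) x(1,2)] p x(3) by simp
  ultimately have "eqn M (component M N x) = 0"
    using assms[OF lmn(1,3,2) lnm, of "x + y"] y unfolding cocycle_def by simp
  moreover have "component M N x \<noteq> 0"
    using component_nonzero[OF sk(5) sk(2) x(1) sk(4) x(2)] .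
  ultimately show "projection N M p \<in> Z"
    using eqn_eq_0_iff[OF lmn(2) component_mem[OF sk(5)]] projection_eq_component[OF sk(5)] x(3) by simp
qed

end

section \<open>Projection from a point\<close>

lemma exists_nonzero_vector: "\<exists>v :: 'a::field^'n. v \<noteq> 0"
  by (rule exI[of _ "axis undefined 1"]) (simp add: axis_eq_0_iff)

lemma span_mem_zeros:
  assumes "form d F" "v \<noteq> 0"
  shows "vec.span {v} \<in> zeros F \<longleftrightarrow> mpoly_eval F v = 0"
  using assms cone_form_homogeneous[OF form_imp_cone_form[OF assms(1)]] point_span vec.span_base[of v "{v}"]
  by (auto simp: zeros_def mem_span_singleton)

text \<open>A nonempty open set contains the complement of a single hypersurface, so one form
  \<open>h\<close> can replace a closed set.\<close>

lemma general_pointD: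
  fixes Q :: "('a::field^'n) set \<Rightarrow> bool"
  assumes "general_point Q"
  shows "\<exists>d h. cone_form 0 d h \<and> (\<exists>v. h v \<noteq> 0) \<and> (\<forall>v. v \<noteq> 0 \<longrightarrow> h v \<noteq> 0 \<longrightarrow> Q (vec.span {v}))"
proof -
  obtain X where X: "zariski_closed X" "X \<noteq> {P. point P}" "\<forall>P. point P \<and> P \<notin> X \<longrightarrow> Q P"
    using assms unfolding general_point_def by blast
  obtain S where S: "\<forall>F\<in>S. \<exists>d. form d F" "X = {p. point p \<and> (\<forall>F\<in>S. p \<in> zeros F)}"
    using X(1) unfolding zariski_closed_def by blast
  obtain p F where F: "point p" "F \<in> S" "p \<notin> zeros F"
    using X(2) S(2) by blast
  then obtain d where d: "form d F"
    using S(1) by blast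
  obtain v where "v \<in> p" "mpoly_eval F v \<noteq> 0"
    using F(1,3) by (auto simp: zeros_def)
  moreover have "Q (vec.span {w})" if "w \<noteq> 0" "mpoly_eval F w \<noteq> 0" for w
  proof -
    have "vec.span {w} \<notin> X"
      using span_mem_zeros[OF d that(1)] that(2) F(2) S(2) by blast
    then show ?thesis
      using X(3) point_span[OF that(1)] by blast
  qed
  ultimately show ?thesis
    using form_imp_cone_form[OF d] by blast
qed

lemma general_pointI:
  fixes Q :: "('a::field^'n) set \<Rightarrow> bool"
  assumes h: "cone_form P d h" "h v \<noteq> 0" and Q: "\<And>v. v \<noteq> 0 \<Longrightarrow> h v \<noteq> 0 \<Longrightarrow> Q (vec.span {v})"
  shows "general_point Q"
proof -
  obtain F where F: "form d F" "\<And>v. mpoly_eval F v = h v"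
    using cone_form_imp_form[OF h(1)] by blast
  let ?X = "{p. point p \<and> (\<forall>G\<in>{F}. p \<in> zeros G)}"
  \<comment> \<open>If \<open>h\<close> is nonzero at the zero vector, homogeneity makes it nonzero
    everywhere, so any nonzero vector will do.\<close>
  obtain w where w: "w \<noteq> 0" "h w \<noteq> 0"
  proof (cases "v = 0")
    case True
    obtain w :: "'a^'n" where "w \<noteq> 0"
      using exists_nonzero_vector by blast
    moreover have "h w \<noteq> 0"
      using cone_form_homogeneous[OF h(1), of 0 w] h(2) True by auto
    ultimately show ?thesis by (rule that)
  qed (use h that in blast)
  have "vec.span {w} \<notin> ?X"
    using span_mem_zeros[OF F(1) w(1)] w(2) F(2) by simp
  then have "?X \<noteq> {P. point P}"
    using point_span[OF w(1)] by blast
  moreover have "zariski_closed ?X"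
    unfolding zariski_closed_def using F(1) by blast
  moreover have "Q p" if "point p" "p \<notin> ?X" for p
  proof -
    obtain u where u: "u \<noteq> 0" "p = vec.span {u}"
      using \<open>point p\<close> point_iff by blast
    then have "h u \<noteq> 0"
      using that span_mem_zeros[OF F(1) u(1)] F(2) by simp
    then show ?thesis
      using Q u by simp
  qed
  ultimately show ?thesis
    unfolding general_point_def by blast
qed

text \<open>The conditions for a general vertex are quantified over all planes missing it; to
  exploit them one such plane is needed.\<close>

lemma exists_plane_avoiding:
  fixes v :: "'a::field^4"
  assumes "v \<noteq> 0"
  shows "\<exists>H. plane H \<and> v \<notin> H"
proof -
  obtain B where B: "{v} \<subseteq> B" "vec.independent B" "vec.span B = UNIV"
    by (rule vec.maximal_independent_subset_extend[of "{v}" UNIV]) (use assms in auto)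
  have "vec.dim (UNIV :: ('a^4) set) = card B"
    using vec.dim_span_eq_card_independent[OF B(2)] B(3) by simp
  then have "card B = 4"
    by (simp add: vec_dim_card del: vec.dim_UNIV)
  moreover have "vec.independent (B - {v})"
    using B(2) vec.independent_mono by blast
  moreover have "card (B - {v}) = card B - 1"
    using B(1) vec.finiteI_independent[OF B(2)] by simp
  ultimately have "plane (vec.span (B - {v}))"
    by (simp add: flat_def vec.dim_span_eq_card_independent del: vec.dim_span)
  moreover have "v \<notin> vec.span (B - {v})"
    using B(1,2) by (auto simp: vec.dependent_def)
  ultimately show ?thesis by blast
qed

lemma plane_functional:
  fixes v :: "'a::field^4"
  assumes "plane H" "v \<notin> H"
  shows "\<exists>l. functional l \<and> l v = 1 \<and> (\<forall>x. x \<in> H \<longleftrightarrow> l x = 0)"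
proof -
  have H: "vec.subspace H" "vec.dim H = 3"
    using assms(1) by (auto simp: flat_def)
  obtain l where l: "functional l" "\<forall>x\<in>H. l x = 0" "l v = 1"
    using functional_extension[OF H(1) assms(2)] by blast
  have spanH: "vec.span H = H"
    using H(1) by simp
  have "vec.dim (vec.span (insert v H)) = vec.dim (UNIV :: ('a^4) set)"
    using assms(2) H spanH by (simp add: vec.dim_insert vec_dim_card del: vec.dim_UNIV vec.span_eq_iff)
  then have UNIV: "vec.span (insert v H) = UNIV"
    by (intro vec.subspace_dim_equal) auto
  have "x \<in> H" if "l x = 0" for x
  proof -
    have "x \<in> vec.span (insert v H)"
      using UNIV by simp
    then obtain k where k: "x - k *s v \<in> H"
      unfolding vec.span_insert spanH by blast
    then have "k = 0"
      using l that by (metis functional_diff functional_scale diff_0 mult.right_neutral neg_equal_0_iff_equal)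
    then show ?thesis
      using k by simp
  qed
  then show ?thesis
    using l by blast
qed

lemma projection_from_point_iff:
  assumes "vec.subspace X"
  shows "w \<in> projection (vec.span {v}) H X \<longleftrightarrow> w \<in> H \<and> (\<exists>x\<in>X. \<exists>t. w = x + t *s v)"
proof -
  have "vec.span X = X" "vec.span (vec.span {v}) = vec.span {v}"
    using assms by simp_all
  then have "w \<in> vec.span (X \<union> vec.span {v}) \<longleftrightarrow> (\<exists>x\<in>X. \<exists>y\<in>vec.span {v}. w = x + y)"
    by (simp only: vec.span_Un) auto
  also have "\<dots> \<longleftrightarrow> (\<exists>x\<in>X. \<exists>t. w = x + t *s v)"
    unfolding vec.span_singleton by blast
  finally show ?thesis
    unfolding projection_def by blast
qed

text \<open>The equation \<open>k\<close> of \<open>H\<close> is normalised at the vertex, so that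
  projection from \<open>v\<close> to \<open>H\<close> becomes a linear map.\<close>

locale point_projection =
  fixes v :: "'a::alg_closed_field^4" and H :: "('a^4) set" and k :: "'a^4 \<Rightarrow> 'a"
  assumes functional_k: "functional k" and k_v: "k v = 1" and mem_H_iff: "\<And>x. x \<in> H \<longleftrightarrow> k x = 0"
begin

definition proj :: "'a^4 \<Rightarrow> 'a^4" where
  "proj x = x - k x *s v"


lemma linear_proj: "Vector_Spaces.linear (*s) (*s) proj"
  using functional_k
  by unfold_locales (auto simp: proj_def functional_simps vec.scale_right_distrib vec.scale_left_distrib
      vec.scale_right_diff_distrib algebra_simps)

lemma proj_mem: "proj x \<in> H"
  using functional_k k_v by (simp add: mem_H_iff proj_def functional_simps)

lemma proj_id: "x \<in> H \<Longrightarrow> proj x = x"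
  by (simp add: mem_H_iff proj_def)

lemma proj_translate: "proj (x + t *s v) = proj x"
  using functional_k k_v by (simp add: proj_def functional_simps algebra_simps)

lemma proj_v: "proj v = 0"
  using k_v by (simp add: proj_def)

lemma proj_eq_translate: "proj x = x + (- k x) *s v"
  by (simp add: proj_def)

lemma proj_eq_0_iff: "proj x = 0 \<longleftrightarrow> x \<in> vec.span {v}"
proof
  assume "proj x = 0"
  then show "x \<in> vec.span {v}"
    by (auto simp: proj_def mem_span_singleton)
next
  assume "x \<in> vec.span {v}"
  then obtain c where "x = 0 + c *s v"
    by (auto simp: mem_span_singleton)
  then show "proj x = 0"
    using proj_translate[of 0 c] functional_0[OF functional_k] by (simp add: proj_def)
qed

lemma projection_point: "projection (vec.span {v}) H (vec.span {x}) = vec.span {proj x}"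
proof (intro equalityI subsetI)
  fix w assume "w \<in> projection (vec.span {v}) H (vec.span {x})"
  then obtain c t where "w \<in> H" "w = c *s x + t *s v"
    by (auto simp: projection_from_point_iff mem_span_singleton)
  then have "w = c *s proj x"
    using proj_id[of w] proj_translate[of "c *s x" t] vec.linear_scale[OF linear_proj] by simp
  then show "w \<in> vec.span {proj x}"
    by (auto simp: mem_span_singleton)
next
  fix w assume "w \<in> vec.span {proj x}"
  then obtain c where w: "w = c *s proj x"
    by (auto simp: mem_span_singleton)
  then have "w = proj (c *s x)"
    using vec.linear_scale[OF linear_proj] by simp
  then have "w \<in> H" "w = c *s x + (- k (c *s x)) *s v"
    using proj_mem proj_eq_translate by metis+
  then show "w \<in> projection (vec.span {v}) H (vec.span {x})"
    unfolding projection_from_point_iff[OF vec.subspace_span]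
    using vec.span_scale[OF vec.span_base[of x "{x}"], of c] by blast
qed

lemma projection_mem_iff:
  assumes "vec.subspace X"
  shows "w \<in> projection (vec.span {v}) H X \<longleftrightarrow> (\<exists>x\<in>X. w = proj x)"
  unfolding projection_from_point_iff[OF assms]
  using proj_id proj_translate proj_eq_translate proj_mem by metis

text \<open>Projection from a vertex off \<open>L\<close> is injective on the points of
  \<open>L\<close>. This prevents a curve that meets the image in finitely many points from
  containing it.\<close>

lemma infinite_projection_line:
  assumes "line L" "v \<notin> L"
  shows "infinite (pts (projection (vec.span {v}) H L))"
proof -
  have L: "vec.subspace L"
    using assms(1) by (simp add: flat_def)
  let ?f = "projection (vec.span {v}) H"
  have nz: "x \<in> L \<Longrightarrow> x \<noteq> 0 \<Longrightarrow> proj x \<noteq> 0" for x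
  proof
    assume x: "x \<in> L" "x \<noteq> 0" "proj x = 0"
    then obtain c where "x = c *s v" "c \<noteq> 0"
      unfolding proj_eq_0_iff mem_span_singleton by auto
    then have "v = inverse c *s x" by simp
    then show False
      using assms(2) x(1) L vec.subspace_scale by metis
  qed
  have "inj_on ?f (pts L)"
  proof (rule inj_onI)
    fix p q assume pq: "p \<in> pts L" "q \<in> pts L" "?f p = ?f q"
    obtain x where x: "x \<in> L" "x \<noteq> 0" "p = vec.span {x}"
      using pq(1) pts_iff[OF L, of p] by blast
    obtain y where y: "y \<in> L" "q = vec.span {y}"
      using pq(2) pts_iff[OF L, of q] by blast
    have "vec.span {proj x} = vec.span {proj y}"
      using pq(3) x y projection_point by simp
    then obtain c where "proj x = c *s proj y"
      using vec.span_base[of "proj x" "{proj x}"] by (auto simp: mem_span_singleton)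
    then have "proj (x - c *s y) = 0"
      by (simp add: vec.linear_diff[OF linear_proj] vec.linear_scale[OF linear_proj])
    moreover have "x - c *s y \<in> L"
      using x y L by (simp add: vec.subspace_diff vec.subspace_scale)
    ultimately have "x - c *s y = 0"
      using nz by blast
    then have "x \<in> vec.span {y}"
      by (auto simp: mem_span_singleton)
    then show "p = q"
      using span_singleton_eq[OF x(2)] x y by simp
  qed
  then have "infinite (?f ` pts L)"
    using infinite_pts_line[OF assms(1)] finite_imageD by blast
  moreover have "?f ` pts L \<subseteq> pts (?f L)"
  proof
    fix q assume "q \<in> ?f ` pts L"
    then obtain p where p: "p \<in> pts L" "q = ?f p" by blast
    obtain x where x: "x \<in> L" "x \<noteq> 0" "p = vec.span {x}"
      using p(1) pts_iff[OF L, of p] by blast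
    have "q = vec.span {proj x}"
      using p(2) x(3) projection_point by simp
    moreover have "?f L = proj ` L"
      using projection_mem_iff[OF L] by blast
    then have "vec.subspace (?f L)"
      using vec.linear_subspace_image[OF linear_proj L] by simp
    moreover have "proj x \<in> ?f L"
      using projection_mem_iff[OF L] x(1) by blast
    ultimately show "q \<in> pts (?f L)"
      using nz[OF x(1,2)] span_mem_pts by blast
  qed
  ultimately show ?thesis
    using finite_subset by blast
qed

end

lemma point_projection_exists:
  assumes "plane H" "\<not> vec.span {v} \<subseteq> H"
  shows "\<exists>k. point_projection v H k"
proof -
  have "vec.subspace H"
    using assms(1) by (simp add: flat_def)
  then have "v \<notin> H"
    using assms(2) span_singleton_subset by blast
  then obtain l where "functional l" "l v = 1" "\<forall>x. x \<in> H \<longleftrightarrow> l x = 0"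
    using plane_functional[OF assms(1)] by blast
  then show ?thesis
    unfolding point_projection_def by blast
qed

text \<open>The values at \<open>x\<close> and \<open>y\<close> form a triangular system, so
  \<open>m\<close> and \<open>n\<close> are a basis of the dual of \<open>L\<close>; this is the
  spanning hypothesis of \<open>cone_form_divide\<close>.\<close>

lemma functionals_span_line:
  assumes "line L" "y \<in> L" "functional m" "m y = 0" "x \<in> L" "m x \<noteq> 0" "functional n" "n y \<noteq> 0"
    and "functional l"
  shows "\<exists>s t. \<forall>v\<in>L. l v = s * m v + t * n v"
proof -
  have y: "y \<noteq> 0"
    using assms(7,8) functional_0 by auto
  have x: "x \<notin> vec.span {y}"
    using assms(3,4,6) by (auto simp: mem_span_singleton functional_scale)
  define t where "t = l y / n y"
  define s where "s = (l x - t * n x) / m x"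
  have sx: "l x = s * m x + t * n x" and ty: "l y = t * n y"
    using assms(6,8) by (simp_all add: s_def t_def)
  have "l v = s * m v + t * n v" if v: "v \<in> L" for v
  proof -
    obtain p q where "v = p *s x + q *s y"
      using line_coordinates[OF assms(1,5,2) y x v] by blast
    then show ?thesis
      using assms(3,4,7,9) sx ty by (simp add: functional_simps algebra_simps)
  qed
  then show ?thesis by blast
qed

text \<open>The vectors \<open>component L M v\<close> and \<open>- component M L v\<close> differ
  by \<open>v\<close> and so have the same value; the sign of the cocycle condition comes from
  here.\<close>

lemma cone_form_glue:
  assumes "cone_form v d f" "skew L M"
  shows "f (component L M v) = (- 1) ^ d * f (component M L v)"
proof -
  have "component L M v = (- 1) *s component M L v + 1 *s v"
    using component_sum[OF assms(2), of v] by (simp add: algebra_simps)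
  then show ?thesis
    using cone_form_translate[OF assms(1), of _ 1] cone_form_homogeneous[OF assms(1), of "- 1"] by metis
qed

lemma cone_form_degree_0: "cone_form P 0 g \<Longrightarrow> g x = g 0"
  using cone_form_homogeneous[of P 0 g 0 x] by simp

section \<open>From a curve in the projection to the cocycle condition\<close>

context points_on_skew_lines
begin

lemma finite_Z: "finite Z"
proof -
  have "Z = (\<Union>L\<in>\<L>. Z \<inter> pts L)"
    using Z_subset by blast
  moreover have "finite \<L>"
    using skew_lines by (simp add: skew_lines_def)
  ultimately show ?thesis
    using finite_Z_pts by (metis finite_UN_I)
qed

text \<open>Division of a form of degree \<open>a\<close> by its \<open>a\<close> linear factors
  leaves a form of degree 0, a constant.\<close>

lemma eqn_divides:
  assumes "L \<in> \<L>" "cone_form P a f"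
    and "\<And>x. x \<in> L \<Longrightarrow> x \<noteq> 0 \<Longrightarrow> vec.span {x} \<in> Z \<Longrightarrow> f x = 0"
  shows "\<exists>c. \<forall>x\<in>L. f x = c * eqn L x"
proof -
  have sub: "vec.subspace L" and line: "line L"
    using skew_linesD_subspace[OF skew_lines assms(1)] skew_linesD_line[OF skew_lines assms(1)] by auto
  have "\<exists>y. y \<in> L \<and> y \<noteq> 0 \<and> z = vec.span {y}" if "z \<in> Z \<inter> pts L" for z
    using that pts_iff[OF sub, of z] by blast
  then obtain y where y: "\<And>z. z \<in> Z \<inter> pts L \<Longrightarrow> y z \<in> L \<and> y z \<noteq> 0 \<and> z = vec.span {y z}"
    by metis
  have ell_y: "ell z (y z') = 0 \<longleftrightarrow> z = z'" if "z \<in> Z \<inter> pts L" "z' \<in> Z \<inter> pts L" for z z'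
  proof -
    have "y z' \<in> z \<longleftrightarrow> z = z'"
      using y[OF that(1)] y[OF that(2)] span_singleton_eq[of "y z'" "y z"] vec.span_base[of "y z'" "{y z'}"]
      by auto
    then show ?thesis
      using ell_eq_0_iff[OF assms(1) that(1)] y[OF that(2)] by simp
  qed
  \<comment> \<open>The vertex is replaced by 0, since the functionals \<open>ell z\<close> are not
    assumed to vanish at \<open>P\<close>.\<close>
  have "\<exists>g. (if card (Z \<inter> pts L) \<le> a then cone_form 0 (a - card (Z \<inter> pts L)) g else g = (\<lambda>x. 0)) \<and>
    (\<forall>x\<in>L. f x = (\<Prod>z\<in>Z \<inter> pts L. ell z x) * g x)"
  proof (rule cone_form_divide[where y = y])
    show "finite (Z \<inter> pts L)" "cone_form 0 a f"
      using finite_Z_pts assms(1,2) cone_form_imp_cone_form_0 by blast+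
    fix z assume z: "z \<in> Z \<inter> pts L"
    show ell: "functional (ell z)" and "ell z 0 = 0"
      using functional_ell[OF assms(1) z] functional_0 by auto
    show "y z \<in> L" "ell z (y z) = 0" "f (y z) = 0"
      using y[OF z] ell_y[OF z z] assms(3) z by auto
    show "ell z' (y z) \<noteq> 0" if "z' \<in> Z \<inter> pts L" "z \<noteq> z'" for z'
      using ell_y[OF that(1) z] that(2) by auto
    obtain n where n: "functional n" "n (y z) = 1"
      using functional_extension[of "{0}" "y z"] y[OF z] by auto
    obtain x where "x \<in> L" "x \<notin> vec.span {y z}"
      using line_not_subset_point[OF line] by blast
    then have x: "x \<in> L" "ell z x \<noteq> 0"
      using y[OF z] ell_eq_0_iff[OF assms(1) z] by auto
    show "\<exists>n. functional n \<and> n 0 = 0 \<and> n (y z) \<noteq> 0 \<and>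
      (\<forall>l. functional l \<longrightarrow> l 0 = 0 \<longrightarrow> (\<exists>s t. \<forall>x\<in>L. l x = s * ell z x + t * n x))"
      using n functional_0[OF n(1)] y[OF z] ell_y[OF z z] x
        functionals_span_line[OF line _ ell _ x n(1), of "y z"] by (intro exI[of _ n]) auto
  qed
  then obtain g where g: "cone_form 0 0 g" "\<forall>x\<in>L. f x = (\<Prod>z\<in>Z \<inter> pts L. ell z x) * g x"
    using card_Z_pts[OF assms(1)] by auto
  have "\<forall>x\<in>L. f x = g 0 * eqn L x"
    using g cone_form_degree_0[OF g(1)] by (metis eqn_def mult.commute)
  then show ?thesis by blast
qed

text \<open>The cone over the curve restricts to \<open>c * eqn K\<close> on each line
  \<open>K\<close>. Here \<open>c\<close> is nonzero, as otherwise the image of \<open>K\<close>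
  would lie in both curves, whose intersection is finite. Multiplying the gluing relations around
  the triangle eliminates the scalars.\<close>

lemma curve_imp_cocycle_at:
  assumes lmn: "L \<in> \<L>" "M \<in> \<L>" "N \<in> \<L>" "distinct [L, M, N]"
    and "v \<notin> L" "v \<notin> M" "v \<notin> N" "point_projection v H k"
    and F: "form a F" and G: "pts H \<inter> zeros G = (\<Union>L\<in>\<L>. pts (projection (vec.span {v}) H L))"
    and FG: "projection (vec.span {v}) H ` Z = pts H \<inter> zeros F \<inter> zeros G"
  shows "cocycle L M N v"
proof -
  interpret point_projection v H k by fact
  define f where "f = (\<lambda>x. mpoly_eval F (proj x))"
  have f: "cone_form v a f"
    unfolding f_def using cone_form_comp[OF form_imp_cone_form[OF F] linear_proj proj_v] .
  have mult: "\<exists>c. c \<noteq> 0 \<and> (\<forall>x\<in>K. f x = c * eqn K x)" if K: "K \<in> \<L>" "v \<notin> K" for K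
  proof -
    have sub: "vec.subspace K"
      using skew_linesD_subspace[OF skew_lines K(1)] .
    have "f x = 0" if "x \<noteq> 0" "vec.span {x} \<in> Z" for x
    proof (cases "proj x = 0")
      case True
      then show ?thesis
        using cone_form_homogeneous[OF form_imp_cone_form[OF F], of 0 0] a_pos
        by (simp add: f_def power_0_left)
    next
      case False
      have "vec.span {proj x} \<in> zeros F"
        using FG that(2) projection_point by blast
      then show ?thesis
        using span_mem_zeros[OF F False] by (simp add: f_def)
    qed
    then obtain c where c: "\<forall>x\<in>K. f x = c * eqn K x"
      using eqn_divides[OF K(1) f] by blast
    have "c \<noteq> 0"
    proof
      assume "c = 0"
      have "pts (projection (vec.span {v}) H K) \<subseteq> projection (vec.span {v}) H ` Z"
      proof
        fix p assume p: "p \<in> pts (projection (vec.span {v}) H K)"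
        then obtain u where u: "u \<noteq> 0" "p = vec.span {u}"
          using point_iff unfolding pts_def by blast
        then have "u \<in> projection (vec.span {v}) H K"
          using p vec.span_base[of u "{u}"] unfolding pts_def by blast
        then obtain x where x: "x \<in> K" "u = proj x"
          using projection_mem_iff[OF sub] by blast
        then have "mpoly_eval F u = 0"
          using c \<open>c = 0\<close> by (simp add: f_def)
        then have "p \<in> zeros F"
          using span_mem_zeros[OF F u(1)] u(2) by simp
        moreover have "p \<in> pts H \<inter> zeros G"
          unfolding G using p K(1) by blast
        ultimately show "p \<in> projection (vec.span {v}) H ` Z"
          unfolding FG by blast
      qed
      then show False
        using infinite_projection_line[OF skew_linesD_line[OF skew_lines K(1)] K(2)] finite_Z
        by (meson finite_imageI finite_subset)
    qed
    then show ?thesis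
      using c by blast
  qed
  obtain c where c: "c \<noteq> 0" "\<forall>x\<in>L. f x = c * eqn L x"
    using mult[OF lmn(1) assms(5)] by blast
  obtain d where d: "d \<noteq> 0" "\<forall>x\<in>M. f x = d * eqn M x"
    using mult[OF lmn(2) assms(6)] by blast
  obtain e where e: "e \<noteq> 0" "\<forall>x\<in>N. f x = e * eqn N x"
    using mult[OF lmn(3) assms(7)] by blast
  note glue = cone_form_glue[OF f]
  note sk = skew_linesD_distinct[OF skew_lines lmn]
  let ?s = "(- 1) ^ a :: 'a"
  have "c * eqn L (component L M v) = ?s * (d * eqn M (component M L v))"
    "d * eqn M (component M N v) = ?s * (e * eqn N (component N M v))"
    "e * eqn N (component N L v) = ?s * (c * eqn L (component L N v))"
    using glue[OF sk(1)] glue[OF sk(5)] glue[OF sk(4)] c(2) d(2) e(2) sk(1-6)[THEN component_mem[of _ _ v]]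
    by simp_all
  \<comment> \<open>Three signs occur on the right, two of which cancel.\<close>
  then have "(c * eqn L (component L M v)) * (d * eqn M (component M N v)) * (e * eqn N (component N L v)) =
    (?s * (d * eqn M (component M L v))) * (?s * (e * eqn N (component N M v))) * (?s * (c * eqn L (component L N v)))"
    by simp
  moreover have "?s * ?s = 1"
    by (simp flip: power_mult_distrib)
  ultimately have "(c * d * e) * (eqn L (component L M v) * eqn M (component M N v) * eqn N (component N L v)) =
    (c * d * e) * (?s * (eqn M (component M L v) * eqn N (component N M v) * eqn L (component L N v)))"
    by (simp add: mult_ac)
  then show ?thesis
    unfolding cocycle_def using c(1) d(1) e(1) by simp
qed

lemma polynomial_on_lines_eqn_component:
  "L \<in> \<L> \<Longrightarrow> skew L M \<Longrightarrow> polynomial_on_lines (\<lambda>v. eqn L (component L M v))"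
  using polynomial_on_lines_cone_form[OF cone_form_comp[OF cone_form_eqn linear_component, of L L M 0]]
    component_self[of L M 0] vec.subspace_0 skew_subspace by auto

text \<open>The curves give the cocycle condition only for general vertices off the three lines.
  Being polynomial, it then holds for all vertices, in particular for the special ones from which
  stability is read off.\<close>

lemma geproci_wrt_imp_projection_closed:
  assumes "geproci_wrt a b \<L> Z"
  shows "projection_closed \<L> Z"
proof (rule cocycle_imp_projection_closed)
  fix L M N v
  assume lmn: "L \<in> \<L>" "M \<in> \<L>" "N \<in> \<L>" "distinct [L, M, N]"
  note sk = skew_linesD_distinct[OF skew_lines lmn]
  let ?Q = "\<lambda>P. \<forall>H. plane H \<and> \<not> P \<subseteq> H \<longrightarrow> (\<exists>F G. plane_curve H a F \<and> plane_curve H b G \<and>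
      pts H \<inter> zeros G = (\<Union>L\<in>\<L>. pts (projection P H L)) \<and>
      transverse_intersection H F G (projection P H ` Z))"
  have "general_point ?Q"
    using assms unfolding geproci_wrt_def by simp
  then obtain d h u where h: "cone_form 0 d h" "h u \<noteq> 0"
    and FG: "\<And>v. v \<noteq> 0 \<Longrightarrow> h v \<noteq> 0 \<Longrightarrow> ?Q (vec.span {v})"
    using general_pointD[of ?Q] by blast
  have avoid: "\<exists>l. functional l \<and> (\<forall>x\<in>K. l x = 0) \<and> (\<exists>w. l w \<noteq> 0)" if "skew K K'" for K K'
  proof -
    obtain w where "w \<in> K'" "w \<noteq> 0"
    proof -
      have "line K'"
        using \<open>skew K K'\<close> by (simp add: skew_def)
      then show thesis
        using line_not_subset_point[of K' 0] that by auto
    qed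
    then have "w \<notin> K"
      using skew_Int[OF that] by blast
    then show ?thesis
      using functional_extension[OF skew_subspace(1)[OF that], of w] by (metis zero_neq_one)
  qed
  obtain l1 w1 where l1: "functional l1" "\<forall>x\<in>L. l1 x = 0" "l1 w1 \<noteq> 0"
    using avoid[OF sk(1)] by blast
  obtain l2 w2 where l2: "functional l2" "\<forall>x\<in>M. l2 x = 0" "l2 w2 \<noteq> 0"
    using avoid[OF sk(2)] by blast
  obtain l3 w3 where l3: "functional l3" "\<forall>x\<in>N. l3 x = 0" "l3 w3 \<noteq> 0"
    using avoid[OF sk(4)] by blast
  note l = l1 l2 l3
  \<comment> \<open>Nonvanishing of \<open>?f\<close> says that the vertex is general and lies on
    none of the three lines; \<open>?g\<close> is the difference of the two sides of the cocycle
    condition.\<close>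
  let ?f = "\<lambda>v. h v * (l1 v * (l2 v * l3 v))"
  let ?g = "\<lambda>v. eqn L (component L M v) * eqn M (component M N v) * eqn N (component N L v) -
     (- 1) ^ a * (eqn M (component M L v) * eqn N (component N M v) * eqn L (component L N v))"
  note pol = polynomial_on_lines_functional[OF l(1)] polynomial_on_lines_functional[OF l(4)]
    polynomial_on_lines_functional[OF l(7)] polynomial_on_lines_cone_form[OF h(1)]
  obtain w where w: "?f w \<noteq> 0"
    using polynomial_on_lines_nonzero_mult[OF pol(2,3) l(6,9)]
      polynomial_on_lines_nonzero_mult[OF pol(1) polynomial_on_lines_mult[OF pol(2,3)] l(3)]
      polynomial_on_lines_nonzero_mult[OF pol(4) polynomial_on_lines_mult[OF pol(1)
          polynomial_on_lines_mult[OF pol(2,3)]] h(2)] by blast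
  have "?g v = 0"
  proof (rule polynomial_on_lines_prod_eq_0[where f = ?f and g = ?g and u = w and w = v])
    show "?f w \<noteq> 0"
      by (rule w)
    show "polynomial_on_lines ?f"
      by (intro polynomial_on_lines_mult pol)
    show "polynomial_on_lines ?g"
      by (intro polynomial_on_lines_mult polynomial_on_lines_diff polynomial_on_lines_const
          polynomial_on_lines_eqn_component lmn sk)
    fix x
    show "?f x * ?g x = 0"
    proof (cases "?f x = 0")
      case False
      then have "h x \<noteq> 0" "x \<notin> L" "x \<notin> M" "x \<notin> N" and x: "x \<noteq> 0"
        using l functional_0[OF l(1)] by auto
      obtain H where "plane H" "x \<notin> H"
        using exists_plane_avoiding[OF x] by blast
      then have H: "plane H" "\<not> vec.span {x} \<subseteq> H"
        using vec.span_base[of x "{x}"] by auto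
      obtain F G where FG: "plane_curve H a F" "pts H \<inter> zeros G = (\<Union>L\<in>\<L>. pts (projection (vec.span {x}) H L))"
        "transverse_intersection H F G (projection (vec.span {x}) H ` Z)"
        using FG[OF x \<open>h x \<noteq> 0\<close>] H by blast
      obtain k where "point_projection x H k"
        using point_projection_exists[OF H] by blast
      moreover have "form a F" "projection (vec.span {x}) H ` Z = pts H \<inter> zeros F \<inter> zeros G"
        using FG by (simp_all add: plane_curve_def transverse_intersection_def)
      ultimately have "cocycle L M N x"
        using curve_imp_cocycle_at[OF lmn \<open>x \<notin> L\<close> \<open>x \<notin> M\<close> \<open>x \<notin> N\<close> _ _ FG(2)] by blast
      then show ?thesis
        by (simp add: cocycle_def)
    qed simp
  qed
  then show "cocycle L M N v"
    by (simp add: cocycle_def)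
qed

end

section \<open>Gluing the equations in the projection\<close>

lemma plane_kernel:
  fixes H :: "('a::field^4) set"
  assumes "plane H"
  shows "\<exists>l. functional l \<and> (\<forall>x. l x = 0 \<longleftrightarrow> x \<in> H)"
proof -
  have "H \<noteq> UNIV"
  proof
    assume "H = UNIV"
    then have "vec.dim (UNIV :: ('a^4) set) = 3"
      using assms by (simp add: flat_def del: vec.dim_UNIV)
    then show False
      by (simp add: vec_dim_card del: vec.dim_UNIV)
  qed
  then obtain v where "v \<notin> H" by blast
  then show ?thesis
    using plane_functional[OF assms] by metis
qed

lemma plane_span_line_point:
  fixes L :: "('a::field^4) set"
  assumes "line L" "v \<notin> L"
  shows "plane (vec.span (insert v L))"
    and "x \<in> vec.span (insert v L) \<longleftrightarrow> (\<exists>y\<in>L. \<exists>t. x = y + t *s v)"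
proof -
  have L: "vec.subspace L" "vec.dim L = 2"
    using assms(1) by (auto simp: flat_def)
  have span: "vec.span L = L"
    using L by simp
  show "plane (vec.span (insert v L))"
    using assms(2) L span by (simp add: flat_def vec.dim_insert del: vec.span_eq_iff)
  show "x \<in> vec.span (insert v L) \<longleftrightarrow> (\<exists>y\<in>L. \<exists>t. x = y + t *s v)"
    unfolding vec.span_insert span mem_Collect_eq
  proof
    assume "\<exists>t. x - t *s v \<in> L"
    then obtain t where "x - t *s v \<in> L" by blast
    then show "\<exists>y\<in>L. \<exists>t. x = y + t *s v"
      by (intro bexI[of _ "x - t *s v"] exI[of _ t]) auto
  next
    assume "\<exists>y\<in>L. \<exists>t. x = y + t *s v"
    then obtain y t where "y \<in> L" "x = y + t *s v" by blast
    then show "\<exists>t. x - t *s v \<in> L"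
      by (intro exI[of _ t]) simp
  qed
qed

text \<open>By the product rule, since every other term contains the vanishing factor. It measures
  simple zeros of both curves.\<close>

lemma pderiv_prod_linear_at_0:
  fixes \<alpha> \<beta> :: "'i \<Rightarrow> 'a::field"
  assumes "finite I" "j \<in> I" "\<alpha> j = 0"
  shows "poly (pderiv (\<Prod>i\<in>I. [:\<alpha> i, \<beta> i:])) 0 = \<beta> j * (\<Prod>i\<in>I - {j}. \<alpha> i)"
proof -
  have "(\<Prod>i\<in>I. [:\<alpha> i, \<beta> i:]) = [:\<alpha> j, \<beta> j:] * (\<Prod>i\<in>I - {j}. [:\<alpha> i, \<beta> i:])"
    by (rule prod.remove[OF assms(1,2)])
  then show ?thesis
    using assms(3) by (simp add: pderiv_mult pderiv_pCons poly_prod)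
qed

text \<open>The form vanishes identically on the one-dimensional subspace, hence so does its
  derivative in the direction of that subspace.\<close>

lemma point_subset_tangent_space:
  fixes F :: "('a::alg_closed_field, 'n::finite) mpoly"
  assumes "vec.span {u} \<in> zeros F"
  shows "vec.span {u} \<subseteq> tangent_space F (vec.span {u})"
  unfolding tangent_space_def
proof (intro subsetI CollectI ballI)
  fix w x assume w: "w \<in> vec.span {u}" "x \<in> vec.span {u}"
  have "x + t *s w \<in> vec.span {u}" for t
    using w by (simp add: vec.span_add vec.span_scale)
  then have "mpoly_eval F (x + t *s w) = poly 0 t" for t
    using assms by (simp add: zeros_def)
  then show "(\<Sum>i\<in>UNIV. mpoly_eval (mpoly_pderiv i F) x * w $ i) = 0"
    using directional_derivative_eq[of F x w 0] by simp
qed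

text \<open>Two open conditions on the vertex: the image of \<open>Z\<close> avoids the points where
  the images of two lines meet, and no three of these images pass through one point.\<close>

locale general_vertex = points_on_skew_lines \<L> Z a ell
  for \<L> :: "('a::alg_closed_field^4) set set" and Z a ell +
  fixes v :: "'a^4"
  assumes closed: "projection_closed \<L> Z"
    and card_lines: "card \<L> \<ge> 3"
    and eqn_component_nonzero: "\<And>L M. L \<in> \<L> \<Longrightarrow> M \<in> \<L> \<Longrightarrow> L \<noteq> M \<Longrightarrow> eqn L (component L M v) \<noteq> 0"
    and not_concurrent: "\<And>L M N. L \<in> \<L> \<Longrightarrow> M \<in> \<L> \<Longrightarrow> N \<in> \<L> \<Longrightarrow> distinct [L, M, N] \<Longrightarrow>
      component L M v \<notin> vec.span {component L N v}"
begin

lemma other_line: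
  assumes "L \<in> \<L>"
  shows "\<exists>M\<in>\<L>. M \<noteq> L"
proof (rule ccontr)
  assume "\<not> ?thesis"
  then have "\<L> = {L}"
    using assms by blast
  then show False
    using card_lines by simp
qed

lemma vertex_notin: "L \<in> \<L> \<Longrightarrow> v \<notin> L"
proof
  assume L: "L \<in> \<L>" "v \<in> L"
  then obtain M where M: "M \<in> \<L>" "M \<noteq> L"
    using other_line by blast
  then have "component M L v = 0"
    using component_eq_0_iff[OF skew_linesD[OF skew_lines M(1) L(1) M(2)]] L(2) by blast
  then show False
    using eqn_component_nonzero[OF M(1) L(1) M(2)] eqn_0[OF M(1)] by simp
qed

text \<open>Since \<open>component L M\<close> kills \<open>M\<close>, the plane spanned by
  \<open>M\<close> and the vertex meets \<open>L\<close> only in the multiples of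
  \<open>component L M v\<close>.\<close>

lemma in_plane_imp_multiple:
  assumes "L \<in> \<L>" "M \<in> \<L>" "L \<noteq> M" "x \<in> L" "y \<in> M" "x = y + t *s v"
  shows "x = t *s component L M v"
proof -
  have sk: "skew L M"
    using skew_linesD[OF skew_lines assms(1-3)] .
  have "component L M x = t *s component L M v"
    using component_eq_0_iff[OF sk, of y] assms(5,6) by (simp add: component_add component_scale sk)
  then show ?thesis
    using component_self[OF sk assms(4)] by simp
qed

text \<open>The only candidate on \<open>L\<close> is spanned by \<open>component L M v\<close>,
  where \<open>eqn L\<close> is nonzero. Injectivity of the projection on \<open>Z\<close> and
  smoothness of the union of the lines at the image of \<open>Z\<close> rest on this.\<close>

lemma point_notin_plane:
  assumes "L \<in> \<L>" "M \<in> \<L>" "L \<noteq> M" "x \<in> L" "x \<noteq> 0" "vec.span {x} \<in> Z" "y \<in> M"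
  shows "x \<noteq> y + t *s v"
proof
  assume "x = y + t *s v"
  then have x: "x = t *s component L M v"
    using in_plane_imp_multiple[OF assms(1-4,7)] by blast
  have "eqn L x = 0"
    using eqn_eq_0_iff[OF assms(1,4,5)] assms(6) by blast
  then have "t ^ a * eqn L (component L M v) = 0"
    using cone_form_homogeneous[OF cone_form_eqn[OF assms(1)]] x by metis
  then have "t = 0"
    using eqn_component_nonzero[OF assms(1-3)] by simp
  then show False
    using x assms(5) by simp
qed

definition plane_eqn :: "('a^4) set \<Rightarrow> 'a^4 \<Rightarrow> 'a" where
  "plane_eqn L = (SOME m. functional m \<and> (\<forall>x. m x = 0 \<longleftrightarrow> (\<exists>y\<in>L. \<exists>t. x = y + t *s v)))"

lemma plane_eqn:
  assumes "L \<in> \<L>"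
  shows "functional (plane_eqn L)" "plane_eqn L x = 0 \<longleftrightarrow> (\<exists>y\<in>L. \<exists>t. x = y + t *s v)"
proof -
  have L: "line L" "v \<notin> L"
    using skew_linesD_line[OF skew_lines assms] vertex_notin[OF assms] .
  have "\<exists>m. functional m \<and> (\<forall>x. m x = 0 \<longleftrightarrow> (\<exists>y\<in>L. \<exists>t. x = y + t *s v))"
    using plane_kernel[OF plane_span_line_point(1)[OF L]] plane_span_line_point(2)[OF L] by simp
  then have "functional (plane_eqn L) \<and> (\<forall>x. plane_eqn L x = 0 \<longleftrightarrow> (\<exists>y\<in>L. \<exists>t. x = y + t *s v))"
    unfolding plane_eqn_def by (rule someI_ex)
  then show "functional (plane_eqn L)" "plane_eqn L x = 0 \<longleftrightarrow> (\<exists>y\<in>L. \<exists>t. x = y + t *s v)"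
    by blast+
qed

lemma plane_eqn_on_line:
  assumes "L \<in> \<L>" "x \<in> L"
  shows "plane_eqn L x = 0"
  unfolding plane_eqn(2)[OF assms(1)] using assms(2) by (intro bexI[of _ x] exI[of _ 0]) auto

lemma plane_eqn_vertex:
  assumes "L \<in> \<L>"
  shows "plane_eqn L v = 0"
  unfolding plane_eqn(2)[OF assms] using vec.subspace_0[OF skew_linesD_subspace[OF skew_lines assms]]
  by (intro bexI[of _ 0] exI[of _ 1]) auto

lemma plane_eqn_nonzero:
  assumes "L \<in> \<L>" "M \<in> \<L>" "L \<noteq> M"
  shows "\<exists>x\<in>L. plane_eqn M x \<noteq> 0"
proof -
  obtain x where x: "x \<in> L" "x \<notin> vec.span {component L M v}"
    using line_not_subset_point[OF skew_linesD_line[OF skew_lines assms(1)]] by blast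
  have "plane_eqn M x \<noteq> 0"
  proof
    assume "plane_eqn M x = 0"
    then obtain y t where "y \<in> M" "x = y + t *s v"
      using plane_eqn(2)[OF assms(2)] by blast
    then have "x = t *s component L M v"
      using in_plane_imp_multiple[OF assms x(1)] by blast
    then show False
      using x(2) by (auto simp: mem_span_singleton)
  qed
  then show ?thesis
    using x(1) by blast
qed

text \<open>On \<open>L\<close> the plane of \<open>N\<close> is met only at the intersection with
  the image of \<open>N\<close>, and these intersections differ for different lines by
  \<open>not_concurrent\<close>. They are the distinct zeros used for division.\<close>

lemma plane_eqn_component:
  assumes "L \<in> \<L>" "M \<in> \<L>" "N \<in> \<L>" "L \<noteq> M" "L \<noteq> N"
  shows "plane_eqn N (component L M v) = 0 \<longleftrightarrow> N = M"
proof
  have sk: "skew L M"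
    using skew_linesD[OF skew_lines assms(1,2,4)] .
  assume "plane_eqn N (component L M v) = 0"
  then obtain y t where "y \<in> N" "component L M v = y + t *s v"
    using plane_eqn(2)[OF assms(3)] by blast
  then have "component L M v = t *s component L N v"
    using in_plane_imp_multiple[OF assms(1,3,5) component_mem[OF sk]] by blast
  then have "component L M v \<in> vec.span {component L N v}"
    by (auto simp: mem_span_singleton)
  then show "N = M"
    using not_concurrent[OF assms(1-3)] assms(4,5) by auto
next
  have sk: "skew L M"
    using skew_linesD[OF skew_lines assms(1,2,4)] .
  have "component L M v = v - component M L v"
    using component_sum[OF sk, of v] by (simp add: algebra_simps)
  then show "plane_eqn N (component L M v) = 0" if "N = M"
    using that plane_eqn_vertex[OF assms(2)] plane_eqn_on_line[OF assms(2) component_mem[OF skew_commute[OF sk]]]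
    by (simp add: functional_diff plane_eqn(1)[OF assms(2)])
qed

text \<open>Scalars are normalised on one line \<open>L\<^sub>0\<close>; the pairs containing it
  determine the others, and a pair \<open>L\<close>, \<open>M\<close> is handled by the cocycle
  condition of the triangle \<open>L\<^sub>0\<close>, \<open>L\<close>, \<open>M\<close>.\<close>

lemma cocycle_trivial:
  "\<exists>c. (\<forall>L\<in>\<L>. c L \<noteq> 0) \<and> (\<forall>L\<in>\<L>. \<forall>M\<in>\<L>. L \<noteq> M \<longrightarrow>
    c L * eqn L (component L M v) = (- 1) ^ a * (c M * eqn M (component M L v)))"
proof -
  let ?s = "(- 1) ^ a :: 'a"
  have ss: "?s * ?s = 1"
    by (simp flip: power_mult_distrib)
  obtain L\<^sub>0 where L0: "L\<^sub>0 \<in> \<L>"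
    using card_lines by fastforce
  \<comment> \<open>Forced by the condition for the pair \<open>L\<close>,
    \<open>L\<^sub>0\<close>.\<close>
  define c where "c L = (if L = L\<^sub>0 then 1 else
    ?s * eqn L\<^sub>0 (component L\<^sub>0 L v) / eqn L (component L L\<^sub>0 v))" for L
  have "c L * eqn L (component L M v) = ?s * (c M * eqn M (component M L v))"
    if lm: "L \<in> \<L>" "M \<in> \<L>" "L \<noteq> M" for L M
  proof -
    consider "L = L\<^sub>0" "M \<noteq> L\<^sub>0" | "M = L\<^sub>0" "L \<noteq> L\<^sub>0" | "L \<noteq> L\<^sub>0" "M \<noteq> L\<^sub>0"
      using lm by blast
    then show ?thesis
    proof cases
      case 1
      then show ?thesis
        using eqn_component_nonzero[OF lm(2) L0] ss by (simp add: c_def flip: mult.assoc)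
    next
      case 2
      then show ?thesis
        using eqn_component_nonzero[OF lm(1) L0] by (simp add: c_def)
    next
      case 3
      have "cocycle L\<^sub>0 L M v"
        using projection_closed_imp_cocycle[OF closed L0 lm(1,2)] 3 lm(3) by simp
      then have eq: "eqn L\<^sub>0 (component L\<^sub>0 L v) * eqn L (component L M v) * eqn M (component M L\<^sub>0 v) =
          ?s * (eqn L (component L L\<^sub>0 v) * eqn M (component M L v) * eqn L\<^sub>0 (component L\<^sub>0 M v))"
        unfolding cocycle_def .
      have nz: "eqn L (component L L\<^sub>0 v) \<noteq> 0" "eqn M (component M L\<^sub>0 v) \<noteq> 0"
        using eqn_component_nonzero[OF lm(1) L0] eqn_component_nonzero[OF lm(2) L0] 3 by auto
      have "c L * eqn L (component L M v) = ?s * (eqn L\<^sub>0 (component L\<^sub>0 L v) *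
          eqn L (component L M v) * eqn M (component M L\<^sub>0 v)) /
          (eqn L (component L L\<^sub>0 v) * eqn M (component M L\<^sub>0 v))"
        using 3 nz by (simp add: c_def)
      also have "\<dots> = ?s * (?s * eqn L\<^sub>0 (component L\<^sub>0 M v) / eqn M (component M L\<^sub>0 v) * eqn M (component M L v))"
        unfolding eq using nz by simp
      finally show ?thesis
        using 3 by (simp add: c_def)
    qed
  qed
  moreover have "c L \<noteq> 0" if "L \<in> \<L>" for L
    using eqn_component_nonzero[OF L0 that] eqn_component_nonzero[OF that L0] by (auto simp: c_def)
  ultimately show ?thesis by blast
qed

text \<open>The lines are added one at a time: where the new line meets the earlier ones the required value
  is already attained, so the correction is divisible on the new line by the product of the equations
  of the earlier ones.\<close>

lemma glue_equations:
  assumes c: "\<And>L M. L \<in> \<L> \<Longrightarrow> M \<in> \<L> \<Longrightarrow> L \<noteq> M \<Longrightarrow>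
      c L * eqn L (component L M v) = (- 1) ^ a * (c M * eqn M (component M L v))"
    and "finite K" "K \<subseteq> \<L>"
  shows "\<exists>f. cone_form v a f \<and> (\<forall>L\<in>K. \<forall>x\<in>L. f x = c L * eqn L x)"
  using assms(2,3)
proof (induction K rule: finite_induct)
  case empty
  then show ?case using cone_form_zero by blast
next
  case (insert L K)
  then obtain f where f: "cone_form v a f" "\<And>M x. M \<in> K \<Longrightarrow> x \<in> M \<Longrightarrow> f x = c M * eqn M x"
    by blast
  have L: "L \<in> \<L>" and K: "\<And>M. M \<in> K \<Longrightarrow> M \<in> \<L> \<and> L \<noteq> M"
    using insert by auto
  have sub: "vec.subspace L" and line: "line L"
    using skew_linesD_subspace[OF skew_lines L] skew_linesD_line[OF skew_lines L] .
  have sk: "skew L M" if "M \<in> K" for M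
    using skew_linesD[OF skew_lines L] K[OF that] by blast
  obtain k where k: "functional k" "\<forall>x\<in>L. k x = 0" "k v = 1"
    using functional_extension[OF sub vertex_notin[OF L]] by blast
  \<comment> \<open>A cone with the prescribed values on the new line \<open>L\<close>; on the
    earlier lines it may be wrong.\<close>
  then obtain g where g: "cone_form v a g" "\<forall>x. k x = 0 \<longrightarrow> g x = c L * eqn L x"
    using cone_form_restrict[OF k(1) _ cone_form_scale[OF cone_form_eqn[OF L]], of v "c L"] by auto
  \<comment> \<open>The discrepancy on \<open>L\<close> vanishes where the image of \<open>L\<close>
    meets the earlier images. If there are more than \<open>a\<close> of them, then \<open>h\<close>
    is zero and \<open>f\<close> is already correct on \<open>L\<close>.\<close>
  have "\<exists>h. (if card K \<le> a then cone_form v (a - card K) h else h = (\<lambda>x. 0)) \<and>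
    (\<forall>x\<in>L. g x - f x = (\<Prod>M\<in>K. plane_eqn M x) * h x)"
  proof (rule cone_form_divide[where y = "\<lambda>M. component L M v"])
    show "finite K" "cone_form v a (\<lambda>x. g x - f x)"
      using insert.hyps cone_form_diff g f by auto
    fix M assume M: "M \<in> K"
    then have LM: "M \<in> \<L>" "L \<noteq> M"
      using K by auto
    show fM: "functional (plane_eqn M)" and "plane_eqn M v = 0" and mem: "component L M v \<in> L"
      using plane_eqn(1)[OF LM(1)] plane_eqn_vertex[OF LM(1)] component_mem[OF sk[OF M]] .
    show y0: "plane_eqn M (component L M v) = 0"
      using plane_eqn_component[OF L LM(1) LM(1) LM(2) LM(2)] by simp
    show "plane_eqn N (component L M v) \<noteq> 0" if "N \<in> K" "M \<noteq> N" for N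
      using plane_eqn_component[OF L LM(1) _ LM(2)] K[OF that(1)] that(2) by auto
    have "f (component L M v) = (- 1) ^ a * (c M * eqn M (component M L v))"
      using cone_form_glue[OF f(1) sk[OF M]] f(2)[OF M component_mem[OF skew_commute[OF sk[OF M]]]] by simp
    then show "g (component L M v) - f (component L M v) = 0"
      using g(2) k(2) mem c[OF L LM] by simp
    have "component L M v \<noteq> 0"
      using eqn_component_nonzero[OF L LM] eqn_0[OF L] by auto
    have "component L M v \<notin> vec.span {v}"
    proof
      assume "component L M v \<in> vec.span {v}"
      then obtain t where t: "component L M v = t *s v"
        by (auto simp: mem_span_singleton)
      then have "t \<noteq> 0"
        using \<open>component L M v \<noteq> 0\<close> by auto
      then have "v = inverse t *s component L M v"
        using t by simp
      then show False
        using vertex_notin[OF L] mem sub vec.subspace_scale by metis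
    qed
    \<comment> \<open>A second coordinate on \<open>L\<close> besides \<open>plane_eqn M\<close>;
      killing \<open>v\<close> makes it admissible for cones.\<close>
    then obtain n where n: "functional n" "\<forall>x\<in>vec.span {v}. n x = 0" "n (component L M v) = 1"
      using functional_extension[OF vec.subspace_span] by blast
    obtain x where x: "x \<in> L" "plane_eqn M x \<noteq> 0"
      using plane_eqn_nonzero[OF L LM] by blast
    show "\<exists>n. functional n \<and> n v = 0 \<and> n (component L M v) \<noteq> 0 \<and>
      (\<forall>l. functional l \<longrightarrow> l v = 0 \<longrightarrow> (\<exists>s t. \<forall>x\<in>L. l x = s * plane_eqn M x + t * n x))"
      using n vec.span_base[of v "{v}"] functionals_span_line[OF line mem fM y0 x n(1)]
      by (intro exI[of _ n]) auto
  qed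
  then obtain h where h: "if card K \<le> a then cone_form v (a - card K) h else h = (\<lambda>x. 0)"
    "\<And>x. x \<in> L \<Longrightarrow> g x - f x = (\<Prod>M\<in>K. plane_eqn M x) * h x"
    by blast
  let ?f = "\<lambda>x. f x + (\<Prod>M\<in>K. plane_eqn M x) * h x"
  have "cone_form v (card K) (\<lambda>x. \<Prod>M\<in>K. plane_eqn M x)"
    using K plane_eqn(1) plane_eqn_vertex by (intro cone_form_prod_functionals) auto
  then have "cone_form v a (\<lambda>x. (\<Prod>M\<in>K. plane_eqn M x) * h x)"
    using h(1) cone_form_times[of v "card K" _ "a - card K" h] cone_form_zero[of v a]
    by (auto split: if_splits)
  then have "cone_form v a ?f"
    by (rule cone_form.add[OF f(1)])
  moreover have "?f x = c M * eqn M x" if M: "M \<in> insert L K" "x \<in> M" for M x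
  proof (cases "M = L")
    case True
    then have "x \<in> L"
      using M(2) by simp
    then have "?f x = g x"
      using h(2)[of x] by (simp add: algebra_simps)
    then show ?thesis
      using g(2) k(2) \<open>x \<in> L\<close> True by simp
  next
    case False
    then have "M \<in> K"
      using M(1) by simp
    then have "(\<Prod>M\<in>K. plane_eqn M x) = 0"
      using plane_eqn_on_line[OF _ M(2)] K insert.hyps(1) by (intro prod_zero) auto
    then show ?thesis
      using f(2)[OF \<open>M \<in> K\<close> M(2)] by simp
  qed
  ultimately show ?case by blast
qed

text \<open>Both curves are built in space as cones with vertex \<open>v\<close>: \<open>F\<close>
  by gluing, \<open>G\<close> as the product of the planes over the lines. They do not depend on
  \<open>H\<close>.\<close>

lemma vertex_curves:
  "\<exists>F G. form a F \<and> form (card \<L>) G \<and>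
    (\<forall>x t. mpoly_eval F (x + t *s v) = mpoly_eval F x) \<and>
    (\<exists>c. \<forall>L\<in>\<L>. c L \<noteq> 0 \<and> (\<forall>x\<in>L. mpoly_eval F x = c L * eqn L x)) \<and>
    (\<forall>x. mpoly_eval G x = (\<Prod>L\<in>\<L>. plane_eqn L x))"
proof -
  obtain c where c': "(\<forall>L\<in>\<L>. c L \<noteq> 0) \<and> (\<forall>L\<in>\<L>. \<forall>M\<in>\<L>. L \<noteq> M \<longrightarrow>
    c L * eqn L (component L M v) = (- 1) ^ a * (c M * eqn M (component M L v)))"
    using cocycle_trivial by (rule exE)
  note c = c'[THEN conjunct1, THEN bspec]
    c'[THEN conjunct2, THEN bspec, THEN bspec, THEN mp]
  have "finite \<L>"
    using skew_lines by (simp add: skew_lines_def)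
  then obtain f where f: "cone_form v a f" "\<forall>L\<in>\<L>. \<forall>x\<in>L. f x = c L * eqn L x"
    using glue_equations[OF c(2), of \<L>] by blast
  obtain F where F: "form a F" "\<forall>x. mpoly_eval F x = f x"
    using cone_form_imp_form[OF f(1)] by blast
  have "cone_form v (card \<L>) (\<lambda>x. \<Prod>L\<in>\<L>. plane_eqn L x)"
    using plane_eqn(1) plane_eqn_vertex by (intro cone_form_prod_functionals) auto
  then obtain G where "form (card \<L>) G" "\<forall>x. mpoly_eval G x = (\<Prod>L\<in>\<L>. plane_eqn L x)"
    using cone_form_imp_form by blast
  then show ?thesis
    using F c(1) f(2) cone_form_translate[OF f(1)] by (intro exI[of _ F] exI[of _ G]) auto
qed

text \<open>Two points with the same image are collinear with \<open>v\<close>. On different lines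
  this contradicts \<open>point_notin_plane\<close>; on the same line it would put \<open>v\<close>
  on that line.\<close>

lemma inj_on_projection:
  assumes "point_projection v H k"
  shows "inj_on (projection (vec.span {v}) H) Z"
proof (rule inj_onI)
  interpret point_projection v H k by fact
  fix p q assume pq: "p \<in> Z" "q \<in> Z" "projection (vec.span {v}) H p = projection (vec.span {v}) H q"
  obtain L where L: "L \<in> \<L>" "p \<in> pts L"
    using pq(1) Z_subset by blast
  obtain M where M: "M \<in> \<L>" "q \<in> pts M"
    using pq(2) Z_subset by blast
  have sub: "vec.subspace L" "vec.subspace M"
    using skew_linesD_subspace[OF skew_lines] L M by auto
  obtain x where x: "x \<in> L" "x \<noteq> 0" "p = vec.span {x}"
    using L(2) pts_iff[OF sub(1), of p] by blast
  obtain y where y: "y \<in> M" "q = vec.span {y}"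
    using M(2) pts_iff[OF sub(2), of q] by blast
  have "vec.span {proj x} = vec.span {proj y}"
    using pq(3) x y projection_point by simp
  then obtain r where "proj x = r *s proj y"
    using vec.span_base[of "proj x" "{proj x}"] by (auto simp: mem_span_singleton)
  then have "proj (x - r *s y) = 0"
    by (simp add: vec.linear_diff[OF linear_proj] vec.linear_scale[OF linear_proj])
  then obtain t where "x - r *s y = t *s v"
    unfolding proj_eq_0_iff mem_span_singleton by blast
  then have t: "x = r *s y + t *s v"
    by (simp add: algebra_simps)
  have ry: "r *s y \<in> M"
    using y(1) sub(2) by (rule vec.subspace_scale[rotated])
  have "L = M"
    using point_notin_plane[OF L(1) M(1) _ x(1,2) _ ry] t pq(1) x(3) by blast
  have "t = 0"
  proof (rule ccontr)
    assume "t \<noteq> 0"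
    then have "v = inverse t *s (x - r *s y)"
      using t by simp
    moreover have "x - r *s y \<in> L"
      using x(1) ry \<open>L = M\<close> sub(1) by (simp add: vec.subspace_diff)
    ultimately show False
      using vertex_notin[OF L(1)] sub(1) vec.subspace_scale by metis
  qed
  then have "x \<in> vec.span {y}"
    using t by (auto simp: mem_span_singleton)
  then show "p = q"
    using span_singleton_eq[OF x(2)] x y by simp
qed

lemma card_Z: "card Z = a * card \<L>"
proof -
  have "Z = (\<Union>L\<in>\<L>. Z \<inter> pts L)"
    using Z_subset by blast
  moreover have "card (\<Union>L\<in>\<L>. Z \<inter> pts L) = (\<Sum>L\<in>\<L>. card (Z \<inter> pts L))"
    using skew_lines finite_Z_pts skew_lines_unique[OF skew_lines]
    by (intro card_UN_disjoint) (auto simp: skew_lines_def)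
  ultimately show ?thesis
    using card_Z_pts by simp
qed

text \<open>At the image of a point of \<open>Z\<close> on \<open>L\<close> only one factor of
  \<open>G\<close> vanishes, so its tangent is the image of \<open>L\<close>; along \<open>L\<close>
  the form \<open>F\<close> is a multiple of \<open>eqn L\<close>, which has a simple zero there.
  Hence the tangents meet in that point only.\<close>

lemma transverse_curves:
  assumes pp: "point_projection v H k"
  shows "\<exists>F G. plane_curve H a F \<and> plane_curve H (card \<L>) G \<and>
    pts H \<inter> zeros G = (\<Union>L\<in>\<L>. pts (projection (vec.span {v}) H L)) \<and>
    transverse_intersection H F G (projection (vec.span {v}) H ` Z)"
proof -
  interpret point_projection v H k by fact
  obtain F G where FG: "form a F \<and> form (card \<L>) G \<and>
    (\<forall>x t. mpoly_eval F (x + t *s v) = mpoly_eval F x) \<and>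
    (\<exists>c. \<forall>L\<in>\<L>. c L \<noteq> 0 \<and> (\<forall>x\<in>L. mpoly_eval F x = c L * eqn L x)) \<and>
    (\<forall>x. mpoly_eval G x = (\<Prod>L\<in>\<L>. plane_eqn L x))"
    using vertex_curves by (elim exE)
  then obtain c where cF: "\<forall>L\<in>\<L>. c L \<noteq> 0 \<and> (\<forall>x\<in>L. mpoly_eval F x = c L * eqn L x)"
    by (elim conjE exE)
  have F: "form a F" and G: "form (card \<L>) G"
    and F_translate: "\<And>x t. mpoly_eval F (x + t *s v) = mpoly_eval F x"
    and c: "\<And>L. L \<in> \<L> \<Longrightarrow> c L \<noteq> 0"
    and F_eval: "\<And>L x. L \<in> \<L> \<Longrightarrow> x \<in> L \<Longrightarrow> mpoly_eval F x = c L * eqn L x"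
    and G_eval: "\<And>x. mpoly_eval G x = (\<Prod>L\<in>\<L>. plane_eqn L x)"
    using FG cF by simp_all
  have fin: "finite \<L>"
    using skew_lines by (simp add: skew_lines_def)
  have subH: "vec.subspace H"
    by (auto simp: vec.subspace_def mem_H_iff functional_simps[OF functional_k])
  have F_proj: "mpoly_eval F (proj x) = mpoly_eval F x" for x
    using F_translate proj_eq_translate by metis
  have m_proj: "plane_eqn L (proj x) = plane_eqn L x" if "L \<in> \<L>" for L x
    using plane_eqn(1)[OF that] plane_eqn_vertex[OF that] by (simp add: proj_def functional_simps)
  have G_proj: "mpoly_eval G (proj x) = mpoly_eval G x" for x
    using m_proj by (simp add: G_eval)
  have proj_nz: "proj x \<noteq> 0" if "x \<in> L" "x \<noteq> 0" "L \<in> \<L>" for x L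
  proof
    assume "proj x = 0"
    then obtain t where t: "x = t *s v"
      unfolding proj_eq_0_iff mem_span_singleton by blast
    then have "v = inverse t *s x"
      using \<open>x \<noteq> 0\<close> by auto
    then show False
      using vertex_notin[OF that(3)] that(1) skew_linesD_subspace[OF skew_lines that(3)] vec.subspace_scale by metis
  qed
  obtain L\<^sub>0 where "L\<^sub>0 \<in> \<L>"
    using card_lines by fastforce
  then obtain M\<^sub>0 where L0: "L\<^sub>0 \<in> \<L>" "M\<^sub>0 \<in> \<L>" "L\<^sub>0 \<noteq> M\<^sub>0"
    using other_line by metis
  \<comment> \<open>The curve \<open>F\<close> avoids the points where the images of two lines meet,
    so it is not zero on \<open>H\<close>.\<close>
  have "mpoly_eval F (proj (component L\<^sub>0 M\<^sub>0 v)) \<noteq> 0"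
    using F_proj F_eval[OF L0(1) component_mem[OF skew_linesD[OF skew_lines L0]]] c[OF L0(1)]
      eqn_component_nonzero[OF L0] by simp
  then have curve_F: "plane_curve H a F"
    using F proj_mem unfolding plane_curve_def by blast
  have "\<exists>x. (\<Prod>L\<in>\<L>. plane_eqn L x) \<noteq> 0"
  proof (rule polynomial_on_lines_nonzero_prod[OF fin])
    fix L assume L: "L \<in> \<L>"
    show "polynomial_on_lines (plane_eqn L)"
      by (rule polynomial_on_lines_functional[OF plane_eqn(1)[OF L]])
    obtain M where "M \<in> \<L>" "M \<noteq> L"
      using other_line[OF L] by blast
    then show "\<exists>x. plane_eqn L x \<noteq> 0"
      using plane_eqn_nonzero L by blast
  qed
  then have "\<exists>x. mpoly_eval G (proj x) \<noteq> 0"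
    by (simp only: G_proj) (simp add: G_eval)
  then have curve_G: "plane_curve H (card \<L>) G"
    using G proj_mem unfolding plane_curve_def by blast
  have G_0_iff: "mpoly_eval G u = 0 \<longleftrightarrow> (\<exists>L\<in>\<L>. \<exists>y\<in>L. \<exists>t. u = y + t *s v)" for u
    using fin plane_eqn(2) by (auto simp: G_eval prod_zero_iff)
  have zeros_G: "pts H \<inter> zeros G = (\<Union>L\<in>\<L>. pts (projection (vec.span {v}) H L))"
  proof -
    have span: "vec.span {u} \<in> pts H \<inter> zeros G \<longleftrightarrow> vec.span {u} \<in> (\<Union>L\<in>\<L>. pts (projection (vec.span {v}) H L))"
      if u: "u \<noteq> 0" for u
    proof -
      have "vec.span {u} \<in> pts (projection (vec.span {v}) H L) \<longleftrightarrow> u \<in> H \<and> (\<exists>y\<in>L. \<exists>t. u = y + t *s v)"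
        if "L \<in> \<L>" for L
      proof -
        have "vec.subspace (projection (vec.span {v}) H L)"
          unfolding projection_def by (intro vec.subspace_inter subH vec.subspace_span)
        then show ?thesis
          using span_mem_pts[OF _ u] projection_from_point_iff[OF skew_linesD_subspace[OF skew_lines that]] by blast
      qed
      then show ?thesis
        using span_mem_pts[OF subH u] span_mem_zeros[OF G u] G_0_iff by auto
    qed
    show ?thesis
    proof (intro set_eqI)
      fix p
      show "p \<in> pts H \<inter> zeros G \<longleftrightarrow> p \<in> (\<Union>L\<in>\<L>. pts (projection (vec.span {v}) H L))"
      proof (cases "point p")
        case True
        then obtain u where "u \<noteq> 0" "p = vec.span {u}"
          using point_iff by blast
        then show ?thesis
          using span by simp
      qed (simp add: pts_def)
    qed
  qed
  have preimage: "\<exists>L\<in>\<L>. \<exists>x\<in>L. x \<noteq> 0 \<and> vec.span {x} \<in> Z \<and> proj x = u"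
    if u: "u \<noteq> 0" "u \<in> H" "mpoly_eval F u = 0" "mpoly_eval G u = 0" for u
  proof -
    obtain L x t where x: "L \<in> \<L>" "x \<in> L" "u = x + t *s v"
      using G_0_iff u(4) by blast
    have proj: "proj x = u"
      using proj_translate[of x t] proj_id[OF u(2)] x(3) by simp
    then have "x \<noteq> 0"
      using u(1) vec.linear_0[OF linear_proj] by auto
    moreover have "eqn L x = 0"
      using u(3) x F_translate F_eval[OF x(1,2)] c[OF x(1)] by simp
    ultimately show ?thesis
      using eqn_eq_0_iff[OF x(1,2)] x(1,2) proj by blast
  qed
  have image: "proj x \<in> H \<and> proj x \<noteq> 0 \<and> mpoly_eval F (proj x) = 0 \<and> mpoly_eval G (proj x) = 0"
    if x: "L \<in> \<L>" "x \<in> L" "x \<noteq> 0" "vec.span {x} \<in> Z" for L x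
  proof -
    have "eqn L x = 0"
      using eqn_eq_0_iff[OF x(1-3)] x(4) by blast
    moreover have "mpoly_eval G x = 0"
      unfolding G_0_iff using x by (intro bexI[of _ L] bexI[of _ x] exI[of _ 0]) auto
    ultimately show ?thesis
      using proj_mem proj_nz x F_proj G_proj F_eval[OF x(1,2)] by simp
  qed
  have "projection (vec.span {v}) H ` Z = pts H \<inter> zeros F \<inter> zeros G"
  proof (intro equalityI subsetI)
    fix q assume "q \<in> projection (vec.span {v}) H ` Z"
    then obtain p where p: "p \<in> Z" "q = projection (vec.span {v}) H p" by blast
    obtain L where L: "L \<in> \<L>" "p \<in> pts L"
      using p(1) Z_subset by blast
    obtain x where x: "x \<in> L" "x \<noteq> 0" "p = vec.span {x}"
      using L(2) pts_iff[OF skew_linesD_subspace[OF skew_lines L(1)], of p] by blast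
    have "q = vec.span {proj x}"
      using p(2) x(3) projection_point by simp
    then show "q \<in> pts H \<inter> zeros F \<inter> zeros G"
      using image[OF L(1) x(1,2)] p(1) x(3) span_mem_pts[OF subH] span_mem_zeros[OF F] span_mem_zeros[OF G] by simp
  next
    fix q assume q: "q \<in> pts H \<inter> zeros F \<inter> zeros G"
    then obtain u where u: "u \<in> H" "u \<noteq> 0" "q = vec.span {u}"
      using pts_iff[OF subH, of q] by blast
    have "mpoly_eval F u = 0" "mpoly_eval G u = 0"
      using q u span_mem_zeros[OF F u(2)] span_mem_zeros[OF G u(2)] by auto
    then obtain L x where "vec.span {x} \<in> Z" "proj x = u"
      using preimage[OF u(2,1)] by blast
    then have "vec.span {x} \<in> Z" "q = projection (vec.span {v}) H (vec.span {x})"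
      using u(3) projection_point by auto
    then show "q \<in> projection (vec.span {v}) H ` Z"
      by blast
  qed
  moreover have "H \<inter> tangent_space F p \<inter> tangent_space G p = p" if p: "p \<in> pts H \<inter> zeros F \<inter> zeros G" for p
  proof
    obtain u where u: "u \<in> H" "u \<noteq> 0" "p = vec.span {u}"
      using p pts_iff[OF subH, of p] by blast
    have up: "u \<in> p"
      using u(3) vec.span_base[of u "{u}"] by simp
    show "p \<subseteq> H \<inter> tangent_space F p \<inter> tangent_space G p"
      using p u(3) point_subset_tangent_space[of u F] point_subset_tangent_space[of u G]
      by (auto simp: pts_def)
    have "mpoly_eval F u = 0" "mpoly_eval G u = 0"
      using p u span_mem_zeros[OF F u(2)] span_mem_zeros[OF G u(2)] by auto
    then obtain L x where x: "L \<in> \<L>" "x \<in> L" "x \<noteq> 0" "vec.span {x} \<in> Z" "proj x = u"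
      using preimage[OF u(2,1)] by blast
    show "H \<inter> tangent_space F p \<inter> tangent_space G p \<subseteq> p"
    proof
      fix w assume w: "w \<in> H \<inter> tangent_space F p \<inter> tangent_space G p"
      \<comment> \<open>The derivative of this product is \<open>plane_eqn L w\<close> times the
        values of the other factors at \<open>u\<close>, which are nonzero. So a tangent direction
        \<open>w\<close> lies in the plane of \<open>L\<close> and \<open>v\<close>.\<close>
      have "mpoly_eval G (u + t *s w) = poly (\<Prod>M\<in>\<L>. [:plane_eqn M u, plane_eqn M w:]) t" for t
        unfolding G_eval poly_prod
        by (intro prod.cong refl) (simp add: functional_simps plane_eqn(1))
      then have "poly (pderiv (\<Prod>M\<in>\<L>. [:plane_eqn M u, plane_eqn M w:])) 0 = 0"
        using directional_derivative_eq[of G u w] w up by (simp add: tangent_space_def)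
      moreover have "plane_eqn L u = 0"
        using m_proj[OF x(1)] plane_eqn_on_line[OF x(1,2)] x(5) by metis
      ultimately have "plane_eqn L w * (\<Prod>M\<in>\<L> - {L}. plane_eqn M u) = 0"
        using pderiv_prod_linear_at_0[OF fin x(1), of "\<lambda>M. plane_eqn M u" "\<lambda>M. plane_eqn M w"] by simp
      moreover have "plane_eqn M u \<noteq> 0" if M: "M \<in> \<L> - {L}" for M
      proof
        assume "plane_eqn M u = 0"
        then have "plane_eqn M x = 0"
          using m_proj[of M x] M x(5) by simp
        then show False
          using point_notin_plane[OF x(1) _ _ x(2-4), of M] plane_eqn(2)[of M x] M by blast
      qed
      ultimately have "plane_eqn L w = 0"
        using fin by (simp add: prod_zero_iff)
      then obtain y t where y: "y \<in> L" "w = y + t *s v"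
        using plane_eqn(2)[OF x(1)] by blast
      let ?z = "vec.span {x}"
      have z: "?z \<in> Z \<inter> pts L"
        using x(1-4) span_mem_pts[OF skew_linesD_subspace[OF skew_lines x(1)]] by blast
      \<comment> \<open>Modulo translation by \<open>v\<close>, moving from \<open>u\<close> along
        \<open>w\<close> is moving on \<open>L\<close> from \<open>x\<close> along \<open>y\<close>,
        where \<open>F\<close> is known. The simple zero at \<open>x\<close> then forces
        \<open>y\<close> to be a multiple of \<open>x\<close>.\<close>
      have "mpoly_eval F (u + s *s w) = poly (smult (c L) (\<Prod>z\<in>Z \<inter> pts L. [:ell z x, ell z y:])) s" for s
      proof -
        have "u = x + (- k x) *s v"
          using x(5) proj_eq_translate by metis
        then have "u + s *s w = (x + s *s y) + (s * t - k x) *s v"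
          using y(2) by (simp add: algebra_simps)
        then have "mpoly_eval F (u + s *s w) = mpoly_eval F (x + s *s y)"
          using F_translate by metis
        also have "\<dots> = c L * eqn L (x + s *s y)"
          using x(1,2) y(1) skew_linesD_subspace[OF skew_lines x(1)]
          by (intro F_eval) (auto intro: vec.subspace_add vec.subspace_scale)
        also have "eqn L (x + s *s y) = (\<Prod>z\<in>Z \<inter> pts L. ell z x + s * ell z y)"
          unfolding eqn_def using functional_ell[OF x(1)]
          by (intro prod.cong refl) (simp add: functional_simps)
        finally show ?thesis
          by (simp add: poly_prod)
      qed
      then have "poly (pderiv (smult (c L) (\<Prod>z\<in>Z \<inter> pts L. [:ell z x, ell z y:]))) 0 = 0"
        using directional_derivative_eq[of F u w] w up by (simp add: tangent_space_def)
      then have "poly (pderiv (\<Prod>z\<in>Z \<inter> pts L. [:ell z x, ell z y:])) 0 = 0"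
        using c[OF x(1)] by (simp add: pderiv_smult)
      moreover have "ell ?z x = 0"
        using ell_eq_0_iff[OF x(1) z x(2)] vec.span_base[of x "{x}"] by simp
      ultimately have "ell ?z y * (\<Prod>z\<in>Z \<inter> pts L - {?z}. ell z x) = 0"
        using pderiv_prod_linear_at_0[OF finite_Z_pts[OF x(1)] z, of "\<lambda>z. ell z x" "\<lambda>z. ell z y"] by simp
      moreover have "ell z x \<noteq> 0" if z': "z \<in> Z \<inter> pts L - {?z}" for z
      proof
        assume "ell z x = 0"
        then have "x \<in> z"
          using ell_eq_0_iff[OF x(1) _ x(2)] z' by blast
        moreover obtain x' where "z = vec.span {x'}"
          using z' pts_iff[OF skew_linesD_subspace[OF skew_lines x(1)], of z] by blast
        ultimately show False
          using span_singleton_eq[OF x(3)] z' by simp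
      qed
      ultimately have "ell ?z y = 0"
        using finite_Z_pts[OF x(1)] by (simp add: prod_zero_iff)
      then obtain r where "y = r *s x"
        using ell_eq_0_iff[OF x(1) z y(1)] by (auto simp: mem_span_singleton)
      then have "proj w = r *s u"
        using y(2) proj_translate[of y t] x(5) vec.linear_scale[OF linear_proj] by simp
      then have "w = r *s u"
        using proj_id w by simp
      then show "w \<in> p"
        unfolding u(3) mem_span_singleton by blast
    qed
  qed
  ultimately show ?thesis
    using curve_F curve_G zeros_G unfolding transverse_intersection_def by blast
qed

end

section \<open>Existence of general vertices, and half grids from stable sets\<close>

context points_on_skew_lines
begin

text \<open>Proportionality of the two components is the vanishing of a determinant, a quadratic
  form in the vertex; one vertex has to be exhibited where it is nonzero.\<close>

lemma not_concurrent_general: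
  assumes lmn: "L \<in> \<L>" "M \<in> \<L>" "N \<in> \<L>" "distinct [L, M, N]"
  shows "\<exists>q. cone_form 0 2 q \<and> (\<exists>v. q v \<noteq> 0) \<and>
    (\<forall>v. q v \<noteq> 0 \<longrightarrow> component L M v \<notin> vec.span {component L N v})"
proof -
  note sk = skew_linesD_distinct[OF skew_lines lmn]
  have line: "line L" and sub: "vec.subspace L"
    using skew_linesD_line[OF skew_lines lmn(1)] skew_linesD_subspace[OF skew_lines lmn(1)] .
  obtain y where y: "y \<in> L" "y \<noteq> 0"
    using line_not_subset_point[OF line, of 0] by auto
  obtain x where x: "x \<in> L" "x \<notin> vec.span {y}"
    using line_not_subset_point[OF line] by blast
  have "y \<notin> vec.span {x}"
    using span_singleton_eq[OF y(2)] x(2) vec.span_base[of x "{x}"] by auto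
  then obtain m where m: "functional m" "\<forall>z\<in>vec.span {x}. m z = 0" "m y = 1"
    using functional_extension[OF vec.subspace_span] by blast
  obtain l where l: "functional l" "\<forall>z\<in>vec.span {y}. l z = 0" "l x = 1"
    using functional_extension[OF vec.subspace_span x(2)] by blast
  have lm: "l y = 0" "m x = 0"
    using l(2) m(2) vec.span_base[of x "{x}"] vec.span_base[of y "{y}"] by auto
  \<comment> \<open>The determinant of the two components in the coordinates \<open>l\<close> and
    \<open>m\<close> of \<open>L\<close>.\<close>
  define q where "q v = l (component L M v) * m (component L N v) - m (component L M v) * l (component L N v)" for v
  have "cone_form 0 (1 + 1) q"
    unfolding q_def
    by (intro cone_form_diff cone_form_times cone_form_functional functional_comp[OF linear_component] sk l m)
      (use component_self[OF sk(1)] component_self[OF sk(3)] vec.subspace_0[OF sub] functional_0 l m in auto)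
  moreover have "q v = 0" if "component L M v \<in> vec.span {component L N v}" for v
    using that l(1) m(1) by (auto simp: q_def mem_span_singleton functional_simps)
  \<comment> \<open>Chosen so that the components are \<open>x + y\<close> and \<open>x\<close>; the
    determinant is then \<open>- 1\<close>.\<close>
  moreover have "q (x + component N M y) \<noteq> 0"
  proof -
    have "component L M (component M N y) = 0"
      using component_eq_0_iff[OF sk(1)] component_mem[OF sk(5)] by blast
    then have "component L M (component N M y) = component L M (component M N y + component N M y)"
      by (simp add: component_add sk(1))
    also have "\<dots> = y"
      using component_sum[OF sk(5)] component_self[OF sk(1) y(1)] by simp
    finally have "component L M (x + component N M y) = x + y"
      using component_self[OF sk(1) x(1)] by (simp add: component_add sk(1))
    moreover have "component L N (x + component N M y) = x"
      using component_self[OF sk(3) x(1)] component_eq_0_iff[OF sk(3)] component_mem[OF sk(6)]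
      by (simp add: component_add sk(3))
    ultimately show ?thesis
      using l m lm by (simp add: q_def functional_simps)
  qed
  ultimately show ?thesis
    by (intro exI[of _ q]) (auto simp: numeral_2_eq_2)
qed

text \<open>Finitely many nonzero forms, one for each pair and each triple of lines, have a nonzero
  product.\<close>

lemma general_vertex_general:
  assumes "projection_closed \<L> Z" "card \<L> \<ge> 3"
  shows "\<exists>d h w. cone_form 0 d h \<and> h w \<noteq> 0 \<and> (\<forall>v. h v \<noteq> 0 \<longrightarrow> general_vertex \<L> Z a ell v)"
proof -
  define I J where "I = {(L, M). L \<in> \<L> \<and> M \<in> \<L> \<and> L \<noteq> M}"
    and "J = {(L, M, N). L \<in> \<L> \<and> M \<in> \<L> \<and> N \<in> \<L> \<and> distinct [L, M, N]}"
  have fin: "finite \<L>"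
    using skew_lines by (simp add: skew_lines_def)
  have finI: "finite I"
    by (rule finite_subset[of _ "\<L> \<times> \<L>"]) (use fin in \<open>auto simp: I_def\<close>)
  have finJ: "finite J"
    by (rule finite_subset[of _ "\<L> \<times> \<L> \<times> \<L>"]) (use fin in \<open>auto simp: J_def\<close>)
  have "\<forall>j\<in>J. \<exists>q. cone_form 0 2 q \<and> (\<exists>v. q v \<noteq> 0) \<and>
    (\<forall>v. q v \<noteq> 0 \<longrightarrow> (case j of (L, M, N) \<Rightarrow> component L M v \<notin> vec.span {component L N v}))"
    using not_concurrent_general unfolding J_def by fast
  then obtain q where "\<forall>j\<in>J. cone_form 0 2 (q j) \<and> (\<exists>v. q j v \<noteq> 0) \<and>
    (\<forall>v. q j v \<noteq> 0 \<longrightarrow> (case j of (L, M, N) \<Rightarrow> component L M v \<notin> vec.span {component L N v}))"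
    by (rule bchoice[THEN exE])
  then have q: "\<And>j. j \<in> J \<Longrightarrow> cone_form 0 2 (q j)" "\<And>j. j \<in> J \<Longrightarrow> \<exists>v. q j v \<noteq> 0"
    "\<And>j v. j \<in> J \<Longrightarrow> q j v \<noteq> 0 \<Longrightarrow> (case j of (L, M, N) \<Rightarrow> component L M v \<notin> vec.span {component L N v})"
    by simp_all
  define e where "e = (\<lambda>(L, M) v. eqn L (component L M v))"
  have e: "cone_form 0 a (e i)" "\<exists>v. e i v \<noteq> 0" if "i \<in> I" for i
  proof -
    obtain L M where i: "i = (L, M)" "L \<in> \<L>" "M \<in> \<L>" "L \<noteq> M"
      using \<open>i \<in> I\<close> unfolding I_def by blast
    have sk: "skew L M"
      using skew_linesD[OF skew_lines i(2-4)] .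
    have "component L M 0 = 0"
      using component_self[OF sk] vec.subspace_0 skew_subspace[OF sk] by blast
    then show "cone_form 0 a (e i)"
      using cone_form_comp[OF cone_form_eqn[OF i(2)] linear_component[OF sk]] i(1) by (simp add: e_def)
    obtain x where "x \<in> L" "eqn L x \<noteq> 0"
      using eqn_nonzero[OF i(2)] by blast
    then show "\<exists>v. e i v \<noteq> 0"
      using component_self[OF sk] i(1) unfolding e_def by (metis (mono_tags, lifting) case_prod_conv)
  qed
  define h where "h v = (\<Prod>i\<in>I. e i v) * (\<Prod>j\<in>J. q j v)" for v
  have "cone_form 0 ((\<Sum>i\<in>I. a) + (\<Sum>j\<in>J. 2)) h"
    unfolding h_def by (intro cone_form_times cone_form_prod e q)
  moreover have "\<exists>w. h w \<noteq> 0"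
  proof -
    have pol: "\<And>i. i \<in> I \<Longrightarrow> polynomial_on_lines (e i)" "\<And>j. j \<in> J \<Longrightarrow> polynomial_on_lines (q j)"
      using polynomial_on_lines_cone_form e(1) q(1) by blast+
    obtain u where u: "(\<Prod>i\<in>I. e i u) \<noteq> 0"
      using polynomial_on_lines_nonzero_prod[of I e] finI pol(1) e(2) by blast
    obtain w where w: "(\<Prod>j\<in>J. q j w) \<noteq> 0"
      using polynomial_on_lines_nonzero_prod[of J q] finJ pol(2) q(2) by blast
    show ?thesis
      unfolding h_def
      by (rule polynomial_on_lines_nonzero_mult[where u = u and w = w])
        (intro polynomial_on_lines_prod pol u w; assumption)+
  qed
  moreover have "general_vertex \<L> Z a ell v" if "h v \<noteq> 0" for v
  proof -
    have I: "e i v \<noteq> 0" if "i \<in> I" for i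
      using \<open>h v \<noteq> 0\<close> finI that by (auto simp: h_def prod_zero_iff)
    have J: "q j v \<noteq> 0" if "j \<in> J" for j
      using \<open>h v \<noteq> 0\<close> finJ that by (auto simp: h_def prod_zero_iff)
    show ?thesis
    proof
      show "projection_closed \<L> Z" "3 \<le> card \<L>"
        by fact+
      show "eqn L (component L M v) \<noteq> 0" if "L \<in> \<L>" "M \<in> \<L>" "L \<noteq> M" for L M
        using I[of "(L, M)"] that by (simp add: I_def e_def)
      show "component L M v \<notin> vec.span {component L N v}"
        if "L \<in> \<L>" "M \<in> \<L>" "N \<in> \<L>" "distinct [L, M, N]" for L M N
        using J[of "(L, M, N)"] q(3)[of "(L, M, N)" v] that by (simp add: J_def)
    qed
  qed
  ultimately show ?thesis by blast
qed

lemma projection_closed_imp_geproci_wrt: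
  assumes "projection_closed \<L> Z" "card \<L> \<ge> 3"
  shows "geproci_wrt a (card \<L>) \<L> Z"
proof -
  obtain d h w where h: "cone_form 0 d h" "h w \<noteq> 0" "\<And>v. h v \<noteq> 0 \<Longrightarrow> general_vertex \<L> Z a ell v"
    using general_vertex_general[OF assms] by blast
  \<comment> \<open>Any one general vertex makes \<open>card_Z\<close> available.\<close>
  interpret gv: general_vertex \<L> Z a ell w
    by (rule h(3)[OF h(2)])
  let ?T = "\<lambda>P H. \<exists>F G. plane_curve H a F \<and> plane_curve H (card \<L>) G \<and>
    pts H \<inter> zeros G = (\<Union>L\<in>\<L>. pts (projection P H L)) \<and>
    transverse_intersection H F G (projection P H ` Z)"
  have T: "?T (vec.span {v}) H" "card (projection (vec.span {v}) H ` Z) = a * card \<L>"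
    if v: "h v \<noteq> 0" "plane H" "\<not> vec.span {v} \<subseteq> H" for v H
  proof -
    obtain k where k: "point_projection v H k"
      using point_projection_exists[OF v(2,3)] by blast
    show "?T (vec.span {v}) H"
      by (rule general_vertex.transverse_curves[OF h(3)[OF v(1)] k])
    show "card (projection (vec.span {v}) H ` Z) = a * card \<L>"
      using card_image[OF general_vertex.inj_on_projection[OF h(3)[OF v(1)] k]] gv.card_Z by simp
  qed
  have "general_point (\<lambda>P. \<forall>H. plane H \<and> \<not> P \<subseteq> H \<longrightarrow> ?T P H)"
    by (rule general_pointI[OF h(1,2)]) (use T(1) in blast)
  moreover have "general_point (\<lambda>P. \<forall>H. plane H \<and> \<not> P \<subseteq> H \<longrightarrow>
       card (projection P H ` Z) = a * card \<L> \<and>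
       (\<exists>F G. plane_curve H a F \<and> plane_curve H (card \<L>) G \<and>
          transverse_intersection H F G (projection P H ` Z)))"
    by (rule general_pointI[OF h(1,2)]) (use T in meson)
  moreover have "\<forall>p\<in>Z. point p"
    using Z_subset by (auto simp: pts_def)
  ultimately show ?thesis
    unfolding geproci_wrt_def geproci_def
    using finite_Z gv.card_Z skew_lines Z_subset card_Z_pts by blast
qed

end

section \<open>Grids\<close>

text \<open>A grid without its two cardinalities, so that the families can be exchanged and compared
  with \<open>\<L>\<close>.\<close>

definition grid_lines ::
  "('a::field^4) set set \<Rightarrow> ('a^4) set set \<Rightarrow> ('a^4) set set \<Rightarrow> bool" where
  "grid_lines A B Z \<longleftrightarrow> skew_lines A \<and> skew_lines B \<and>
     (\<forall>L\<in>A. \<forall>M\<in>B. \<exists>!p. p \<in> pts L \<inter> pts M) \<and> Z = (\<Union>L\<in>A. pts L) \<inter> (\<Union>M\<in>B. pts M)"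

lemma grid_iff: "grid a b Z \<longleftrightarrow> (\<exists>A B. grid_lines A B Z \<and> card A = a \<and> card B = b)"
  unfolding grid_def grid_lines_def by blast

lemma grid_lines_commute: "grid_lines A B Z \<Longrightarrow> grid_lines B A Z"
  unfolding grid_lines_def Ball_def by (metis Int_commute)

lemma grid_lines_meet:
  assumes "grid_lines A B Z" "T \<in> A" "M \<in> B"
  shows "\<exists>p\<in>Z. p \<in> pts T \<and> p \<in> pts M"
proof -
  have "\<exists>!p. p \<in> pts T \<inter> pts M" and Z: "Z = (\<Union>L\<in>A. pts L) \<inter> (\<Union>M\<in>B. pts M)"
    using assms by (simp_all add: grid_lines_def)
  then obtain p where "p \<in> pts T" "p \<in> pts M"
    by blast
  then show ?thesis
    unfolding Z using assms(2,3) by blast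
qed

text \<open>A point lies on a transversal that meets every line of \<open>\<L>\<close> in a point of
  \<open>Z\<close>. Whatever the centre, the map to \<open>M\<close> moves the point along this
  transversal.\<close>

lemma transversals_imp_projection_closed:
  fixes \<L> :: "('a::field^4) set set"
  assumes \<L>: "skew_lines \<L>" and line: "\<And>T. T \<in> A \<Longrightarrow> line T"
    and meet: "\<And>T L. T \<in> A \<Longrightarrow> L \<in> \<L> \<Longrightarrow> \<exists>r\<in>Z. r \<in> pts T \<and> r \<in> pts L"
    and cover: "\<And>p. p \<in> Z \<Longrightarrow> \<exists>T\<in>A. p \<in> pts T"
  shows "projection_closed \<L> Z"
  unfolding projection_closed_def
proof (intro ballI impI)
  fix L M N p
  assume lmn: "L \<in> \<L>" "M \<in> \<L>" "N \<in> \<L>" "distinct [L, M, N]" and p: "p \<in> Z \<inter> pts L"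
  obtain T where T: "T \<in> A" "p \<in> pts T"
    using cover p by blast
  obtain r where r: "r \<in> Z" "r \<in> pts T" "r \<in> pts M"
    using meet[OF T(1) lmn(2)] by blast
  obtain s where s: "s \<in> pts T" "s \<in> pts N"
    using meet[OF T(1) lmn(3)] by blast
  have "p \<noteq> s"
    using skew_lines_unique[OF \<L> lmn(1,3), of p] p s(2) lmn(4) by auto
  then have "projection N M p = r"
    using transversal_meets_in_projection[OF skew_linesD_distinct(5)[OF \<L> lmn] line[OF T(1)] T(2) r(2) s(1) r(3) s(2)]
    by simp
  then show "projection N M p \<in> Z"
    using r(1) by simp
qed

text \<open>If \<open>L\<close> is not in \<open>A\<close>, the three points lie on different lines
  \<open>A1\<close>, \<open>A2\<close>, \<open>A3\<close> of \<open>A\<close>. Through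
  \<open>p\<close> there pass both \<open>L\<close> and a line \<open>B1\<close> of
  \<open>B\<close>, both transversal to \<open>A2\<close> and \<open>A3\<close>; such a transversal
  is unique, so \<open>L = B1\<close>.\<close>

lemma grid_lines_three_points:
  fixes Z :: "('a::field^4) set set"
  assumes grid: "grid_lines A B Z" and L: "line L"
    and pqr: "{p, q, r} \<subseteq> Z \<inter> pts L" "p \<noteq> q" "p \<noteq> r" "q \<noteq> r"
  shows "L \<in> A \<union> B"
proof (rule ccontr)
  assume L_notin: "L \<notin> A \<union> B"
  have A: "skew_lines A" and B: "skew_lines B" and Z: "Z = (\<Union>L\<in>A. pts L) \<inter> (\<Union>M\<in>B. pts M)"
    using grid by (auto simp: grid_lines_def)
  have p: "p \<in> Z" "p \<in> pts L" and q: "q \<in> Z" "q \<in> pts L" and r: "r \<in> Z" "r \<in> pts L"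
    using pqr(1) by auto
  obtain A1 B1 where 1: "A1 \<in> A" "p \<in> pts A1" "B1 \<in> B" "p \<in> pts B1"
    using p(1) Z by blast
  obtain A2 B2 where 2: "A2 \<in> A" "q \<in> pts A2" "B2 \<in> B" "q \<in> pts B2"
    using q(1) Z by blast
  obtain A3 where 3: "A3 \<in> A" "r \<in> pts A3"
    using r(1) Z by blast
  have "A1 \<noteq> A2" "A1 \<noteq> A3" "A2 \<noteq> A3"
    using line_eq_of_two_points[OF L skew_linesD_line[OF A 1(1)] p(2) q(2)]
      line_eq_of_two_points[OF L skew_linesD_line[OF A 1(1)] p(2) r(2)]
      line_eq_of_two_points[OF L skew_linesD_line[OF A 2(1)] q(2) r(2)]
      1 2 3 pqr L_notin by blast+
  obtain q' where q': "q' \<in> pts B1" "q' \<in> pts A2"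
    using grid_lines_meet[OF grid 2(1) 1(3)] by blast
  obtain r' where r': "r' \<in> pts B1" "r' \<in> pts A3"
    using grid_lines_meet[OF grid 3(1) 1(3)] by blast
  have sk: "skew A2 A3"
    using skew_linesD[OF A 2(1) 3(1) \<open>A2 \<noteq> A3\<close>] .
  have "p \<noteq> r'"
    using skew_lines_unique[OF A 1(1) 3(1) 1(2)] r'(2) \<open>A1 \<noteq> A3\<close> by blast
  then have "projection A3 A2 p = q'"
    using transversal_meets_in_projection[OF sk skew_linesD_line[OF B 1(3)] 1(4) q'(1) r'(1) q'(2) r'(2)]
    by blast
  moreover have "projection A3 A2 p = q"
    using transversal_meets_in_projection[OF sk L p(2) q(2) r(2) 2(2) 3(2)] pqr(3) by blast
  ultimately have "q \<in> pts B1"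
    using q'(1) by simp
  then have "L = B1"
    using line_eq_of_two_points[OF L skew_linesD_line[OF B 1(3)] p(2) q(2) 1(4)] pqr(2) by blast
  then show False
    using L_notin 1(3) by blast
qed

text \<open>Each line carries three points and so belongs to one of the families. Mixing is
  impossible: a line of \<open>A\<close> meets a line of \<open>B\<close>, while different lines of
  \<open>\<L>\<close> are disjoint.\<close>

lemma grid_lines_cases:
  fixes Z :: "('a::field^4) set set"
  assumes grid: "grid_lines A B Z" and \<L>: "skew_lines \<L>" and card: "\<And>L. L \<in> \<L> \<Longrightarrow> card (Z \<inter> pts L) \<ge> 3"
  shows "\<L> \<subseteq> A \<or> \<L> \<subseteq> B"
proof -
  have AB: "L \<in> A \<union> B" if "L \<in> \<L>" for L
  proof -
    obtain T where T: "T \<subseteq> Z \<inter> pts L" "card T = 3"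
      using obtain_subset_with_card_n[OF card[OF \<open>L \<in> \<L>\<close>]] by metis
    obtain p q r where "T = {p, q, r}" "p \<noteq> q" "q \<noteq> r" "p \<noteq> r"
      using T(2) unfolding card_3_iff by blast
    then show ?thesis
      using grid_lines_three_points[OF grid skew_linesD_line[OF \<L> that]] T(1) by blast
  qed
  show ?thesis
  proof (rule ccontr)
    assume "\<not> ?thesis"
    then obtain L M where LM: "L \<in> \<L>" "L \<notin> A" "M \<in> \<L>" "M \<notin> B"
      by blast
    then have "L \<in> B" "M \<in> A"
      using AB by blast+
    then have "L = M"
      using grid_lines_meet[OF grid, of M L] skew_lines_unique[OF \<L> LM(1,3)] by blast
    then show False
      using LM(2) \<open>M \<in> A\<close> by blast
  qed
qed

lemma grid_lines_subset_imp_projection_closed: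
  fixes Z :: "('a::field^4) set set"
  assumes grid: "grid_lines A B Z" and "skew_lines \<L>" "\<L> \<subseteq> B"
  shows "projection_closed \<L> Z"
proof (rule transversals_imp_projection_closed[OF assms(2)])
  show "line T" if "T \<in> A" for T
    using that grid skew_linesD_line unfolding grid_lines_def by blast
  show "\<exists>r\<in>Z. r \<in> pts T \<and> r \<in> pts L" if "T \<in> A" "L \<in> \<L>" for T L
    using grid_lines_meet[OF grid that(1)] that(2) assms(3) by blast
  show "\<exists>T\<in>A. p \<in> pts T" if "p \<in> Z" for p
    using that grid unfolding grid_lines_def by blast
qed

text \<open>For \<open>a \<le> 2\<close> the lines of \<open>\<L>\<close> need not belong to the
  grid, but a count shows that the \<open>a\<close> lines of \<open>A\<close> are transversals: the
  \<open>a\<close> points on a line of \<open>\<L>\<close> are spread over all of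
  \<open>A\<close>.\<close>

lemma grid_imp_projection_closed:
  fixes Z :: "('a::field^4) set set"
  assumes \<L>: "skew_lines \<L>" "card \<L> = b" "b \<ge> 3" and a: "a \<ge> 1"
    and card: "\<And>L. L \<in> \<L> \<Longrightarrow> card (Z \<inter> pts L) = a" and grid: "grid a b Z"
  shows "projection_closed \<L> Z"
proof -
  obtain A B where AB: "grid_lines A B Z" "card A = a" "card B = b"
    using grid unfolding grid_iff by blast
  have A: "skew_lines A" and B: "skew_lines B" and Z: "Z = (\<Union>L\<in>A. pts L) \<inter> (\<Union>M\<in>B. pts M)"
    using AB(1) by (auto simp: grid_lines_def)
  show ?thesis
  proof (cases "a \<ge> 3")
    case True
    then show ?thesis
      using grid_lines_cases[OF AB(1) \<L>(1)] card AB(1) \<L>(1)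
        grid_lines_subset_imp_projection_closed grid_lines_commute by metis
  next
    case False
    show ?thesis
    proof (rule transversals_imp_projection_closed[OF \<L>(1)])
      show "line T" if "T \<in> A" for T
        using skew_linesD_line[OF A that] .
      show "\<exists>T\<in>A. p \<in> pts T" if "p \<in> Z" for p
        using that Z by blast
      fix T L assume T: "T \<in> A" and L: "L \<in> \<L>"
      have finL: "finite (Z \<inter> pts L)"
        using card[OF L] a card.infinite[of "Z \<inter> pts L"] by auto
      \<comment> \<open>A line of \<open>A\<close> contains a point of \<open>Z\<close> on each of
        the \<open>b \<ge> 3\<close> lines of \<open>B\<close>, more than the
        \<open>a \<le> 2\<close> points on \<open>L\<close>.\<close>
      have "L \<notin> A"
      proof
        assume "L \<in> A"
        then have "\<forall>M\<in>B. \<exists>p. p \<in> Z \<and> p \<in> pts L \<and> p \<in> pts M"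
          using grid_lines_meet[OF AB(1)] by blast
        then obtain f where f: "\<forall>M\<in>B. f M \<in> Z \<and> f M \<in> pts L \<and> f M \<in> pts M"
          by (rule bchoice[THEN exE])
        have "inj_on f B"
          using f skew_lines_unique[OF B] by (metis inj_onI)
        then have "card B \<le> card (Z \<inter> pts L)"
          using f finL by (intro card_inj_on_le[of f]) auto
        then show False
          using False card[OF L] AB(3) \<L>(3) by simp
      qed
      have "\<forall>p\<in>Z \<inter> pts L. \<exists>T. T \<in> A \<and> p \<in> pts T"
        using Z by blast
      then obtain g where g: "\<forall>p\<in>Z \<inter> pts L. g p \<in> A \<and> p \<in> pts (g p)"
        by (rule bchoice[THEN exE])
      \<comment> \<open>Two points on the same line of \<open>A\<close> would make \<open>L\<close>
        that line. As \<open>A\<close> has exactly \<open>a\<close> members, \<open>g\<close> is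
        then onto.\<close>
      have "inj_on g (Z \<inter> pts L)"
      proof (rule inj_onI, rule ccontr)
        fix p q assume pq: "p \<in> Z \<inter> pts L" "q \<in> Z \<inter> pts L" "g p = g q" "p \<noteq> q"
        have gp: "g p \<in> A" "p \<in> pts (g p)" "q \<in> pts (g p)"
          using bspec[OF g pq(1)] bspec[OF g pq(2)] pq(3) by simp_all
        have "L = g p"
          using line_eq_of_two_points[OF skew_linesD_line[OF \<L>(1) L] skew_linesD_line[OF A gp(1)] _ _ gp(2,3) pq(4)]
            pq(1,2) by blast
        then show False
          using gp(1) \<open>L \<notin> A\<close> by simp
      qed
      then have "card (g ` (Z \<inter> pts L)) = card A"
        using card[OF L] AB(2) by (simp add: card_image)
      moreover have "finite A" "g ` (Z \<inter> pts L) \<subseteq> A"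
        using A g by (auto simp: skew_lines_def)
      ultimately have "g ` (Z \<inter> pts L) = A"
        using card_subset_eq by blast
      then have "T \<in> g ` (Z \<inter> pts L)"
        using T by simp
      then show "\<exists>r\<in>Z. r \<in> pts T \<and> r \<in> pts L"
        using g by blast
    qed
  qed
qed

text \<open>Identifies the type of a grid of unknown parameters: the points on one line of
  \<open>\<L>\<close> correspond to the lines of \<open>A\<close>, and every line of
  \<open>B\<close> contains a point of \<open>Z\<close>, hence coincides with the line of
  \<open>\<L>\<close> through it.\<close>

lemma grid_lines_subset_imp_grid:
  fixes Z :: "('a::field^4) set set"
  assumes grid: "grid_lines A B Z" and sub: "\<L> \<subseteq> B" and \<L>: "card \<L> = b" "b \<ge> 1" and a: "a \<ge> 1"
    and Z_sub: "Z \<subseteq> (\<Union>L\<in>\<L>. pts L)" and card: "\<And>L. L \<in> \<L> \<Longrightarrow> card (Z \<inter> pts L) = a"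
  shows "grid a b Z"
proof -
  have A: "skew_lines A" and B: "skew_lines B" and Z: "Z = (\<Union>L\<in>A. pts L) \<inter> (\<Union>M\<in>B. pts M)"
    using grid by (auto simp: grid_lines_def)
  obtain L where L: "L \<in> \<L>"
    using \<L> by fastforce
  then have "\<forall>T\<in>A. \<exists>p. p \<in> Z \<inter> pts L \<and> p \<in> pts T"
    using grid_lines_meet[OF grid] sub by blast
  then obtain f where f: "\<forall>T\<in>A. f T \<in> Z \<inter> pts L \<and> f T \<in> pts T"
    by (rule bchoice[THEN exE])
  have "inj_on f A"
    using f skew_lines_unique[OF A] by (metis inj_onI)
  moreover have "f ` A = Z \<inter> pts L"
  proof (intro equalityI subsetI)
    fix p assume p: "p \<in> Z \<inter> pts L"
    then obtain T where T: "T \<in> A" "p \<in> pts T"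
      using Z by blast
    then have "\<exists>!p. p \<in> pts T \<inter> pts L"
      using grid L sub unfolding grid_lines_def by blast
    then have "p = f T"
      using f T p by blast
    then show "p \<in> f ` A"
      using T(1) by simp
  qed (use f in blast)
  ultimately have "card A = a"
    using card[OF L] card_image by metis
  moreover have "B \<subseteq> \<L>"
  proof
    fix M assume M: "M \<in> B"
    have "A \<noteq> {}"
      using \<open>card A = a\<close> a by auto
    then obtain p where "p \<in> Z" "p \<in> pts M"
      using grid_lines_meet[OF grid _ M] by blast
    then show "M \<in> \<L>"
      using Z_sub skew_lines_unique[OF B M] sub by blast
  qed
  then have "card B = b"
    using sub \<L>(1) by simp
  ultimately show ?thesis
    using grid unfolding grid_iff by blast
qed

section \<open>At most two points on each line\<close>

lemma card_2_cases: "card S = 2 \<Longrightarrow> p \<in> S \<Longrightarrow> q \<in> S \<Longrightarrow> p \<noteq> q \<Longrightarrow> r \<in> S \<Longrightarrow> r = p \<or> r = q"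
  by (auto simp: card_2_iff)

text \<open>If centres \<open>K\<close> and \<open>K'\<close> gave different images of
  \<open>p\<close>, they would map the two points of \<open>L\<close> to those of \<open>M\<close>
  in opposite ways. In the independent vectors \<open>x\<close>, \<open>x'\<close>,
  \<open>y\<close>, \<open>y'\<close> this determines the points of \<open>Z\<close> on
  \<open>K\<close> and \<open>K'\<close>, and \<open>x\<close> is not a combination of one point
  from each, although stability says it is.\<close>

lemma projection_independent:
  fixes \<L> :: "('a::field^4) set set"
  assumes \<L>: "skew_lines \<L>" and closed: "projection_closed \<L> Z"
    and card: "\<And>L. L \<in> \<L> \<Longrightarrow> card (Z \<inter> pts L) = 2"
    and mem: "L \<in> \<L>" "M \<in> \<L>" "K \<in> \<L>" "K' \<in> \<L>" and dist: "distinct [L, M, K, K']"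
    and p: "p \<in> Z \<inter> pts L"
  shows "projection K M p = projection K' M p"
proof (rule ccontr)
  assume neq: "projection K M p \<noteq> projection K' M p"
  have d: "distinct [L, M, K]" "distinct [L, M, K']" "distinct [L, K, K']"
    using dist by auto
  note sk = skew_linesD_distinct[OF \<L> mem(1,2,3) d(1)] and sk' = skew_linesD_distinct[OF \<L> mem(1,2,4) d(2)]
    and skk = skew_linesD_distinct[OF \<L> mem(1,3,4) d(3)]
  have sub: "vec.subspace L" "vec.subspace M"
    using skew_subspace[OF sk(1)] .
  obtain x where x: "x \<in> L" "x \<noteq> 0" "p = vec.span {x}"
    using p pts_iff[OF sub(1), of p] by blast
  obtain p' where p': "p' \<in> Z \<inter> pts L" "p' \<noteq> p"
    using card[OF mem(1)] by (auto simp: card_2_iff)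
  obtain x' where x': "x' \<in> L" "x' \<noteq> 0" "p' = vec.span {x'}"
    using p'(1) pts_iff[OF sub(1), of p'] by blast
  have nx: "x \<notin> vec.span {x'}"
    using span_singleton_eq[OF x(2)] x(3) x'(3) p'(2) by auto
  have Zc: "vec.span {component N1 N2 z} \<in> Z \<inter> pts N1"
    if "N1 \<in> \<L>" "N2 \<in> \<L>" "distinct [L, N1, N2]" "vec.span {z} \<in> Z \<inter> pts L" for N1 N2 z
  proof -
    have "projection N2 N1 (vec.span {z}) \<in> Z"
      using closed mem(1) that unfolding projection_closed_def by blast
    moreover have "projection N2 N1 (vec.span {z}) \<in> pts N1"
      using projection_mem_pts[OF \<L> mem(1) that(1-3)] that(4) by blast
    ultimately show ?thesis
      using projection_eq_component[OF skew_linesD_distinct(5)[OF \<L> mem(1) that(1-3)]] by simp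
  qed
  have neqc: "vec.span {component N1 N2 x} \<noteq> vec.span {component N1 N2 x'}"
    if "N1 \<in> \<L>" "N2 \<in> \<L>" "distinct [L, N1, N2]" for N1 N2
  proof
    note skn = skew_linesD_distinct[OF \<L> mem(1) that]
    assume "vec.span {component N1 N2 x} = vec.span {component N1 N2 x'}"
    then have "component N1 N2 x \<in> vec.span {component N1 N2 x'}"
      using vec.span_base[of "component N1 N2 x" "{component N1 N2 x}"] by simp
    then show False
      using component_span_inj[OF skn(5,3) x(1) x'(1)] nx by blast
  qed
  have dichotomy: "vec.span {w} = vec.span {component N1 N2 x} \<or> vec.span {w} = vec.span {component N1 N2 x'}"
    if "N1 \<in> \<L>" "N2 \<in> \<L>" "distinct [L, N1, N2]" "vec.span {w} \<in> Z \<inter> pts N1" for N1 N2 w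
    using card_2_cases[OF card[OF that(1)] _ _ neqc[OF that(1-3)] that(4)]
      Zc[OF that(1-3)] p p'(1) x(3) x'(3) by blast
  have mult: "\<exists>c. w = c *s z" if "vec.span {w} = vec.span {z}" for w z :: "'a^4"
    using vec.span_base[of w "{w}"] that unfolding mem_span_singleton[symmetric] by simp
  have dd: "distinct [L, K, M]" "distinct [L, K', M]" "distinct [L, K', K]"
    using dist by auto
  define y y' where "y = component M K x" and "y' = component M K x'"
  have y: "y \<in> M" "y \<noteq> 0" "y' \<in> M" "y' \<noteq> 0"
    using component_mem[OF sk(5)] component_nonzero[OF sk(5) sk(2) x(1) sk(4) x(2)]
      component_nonzero[OF sk(5) sk(2) x'(1) sk(4) x'(2)] by (auto simp: y_def y'_def)
  have ny: "y \<notin> vec.span {y'}"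
    using component_span_inj[OF sk(5,3) x(1) x'(1)] nx by (auto simp: y_def y'_def)
  have "vec.span {component M K' x} \<noteq> vec.span {component M K x}"
    using neq projection_eq_component[OF sk(5), of x] projection_eq_component[OF sk'(5), of x] x(3) by simp
  then have xK': "vec.span {component M K' x} = vec.span {y'}"
    using dichotomy[OF mem(2,3) d(1) Zc[OF mem(2,4) d(2)]] p x(3) by (auto simp: y'_def)
  then obtain c where c: "component M K' x = c *s y'"
    using mult by blast
  have "vec.span {component M K' x'} = vec.span {y}"
    using dichotomy[OF mem(2,3) d(1) Zc[OF mem(2,4) d(2)], of x'] p'(1) x'(3) xK' neqc[OF mem(2,4) d(2)]
    by (auto simp: y'_def y_def)
  then obtain e where e: "component M K' x' = e *s y"
    using mult by blast
  have "c \<noteq> 0"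
    using c component_nonzero[OF sk'(5) sk(2) x(1) sk'(4) x(2)] by auto
  have KM: "component K M x = x - y" "component K M x' = x' - y'"
    "component K' M x = x - c *s y'" "component K' M x' = x' - e *s y"
    using component_sum[OF sk(5), of x] component_sum[OF sk(5), of x'] component_sum[OF sk'(5), of x]
      component_sum[OF sk'(5), of x'] c e
    by (auto simp: y_def y'_def algebra_simps)
  \<comment> \<open>By stability both summands of \<open>x\<close> along \<open>K\<close> and
    \<open>K'\<close> span points of \<open>Z\<close>, which leaves two possibilities for each and
    four cases in all.\<close>
  have "vec.span {component K K' x} \<in> Z \<inter> pts K" "vec.span {component K' K x} \<in> Z \<inter> pts K'"
    using Zc[OF mem(3,4) d(3)] Zc[OF mem(4,3) dd(3)] p x(3) by auto
  then have "vec.span {component K K' x} = vec.span {x - y} \<or> vec.span {component K K' x} = vec.span {x' - y'}"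
    "vec.span {component K' K x} = vec.span {x - c *s y'} \<or> vec.span {component K' K x} = vec.span {x' - e *s y}"
    using dichotomy[OF mem(3,2) dd(1)] dichotomy[OF mem(4,2) dd(2)] KM by auto
  then obtain s t where st: "component K K' x = s *s (x - y) \<or> component K K' x = s *s (x' - y')"
    "component K' K x = t *s (x - c *s y') \<or> component K' K x = t *s (x' - e *s y)"
    using mult by metis
  have sum: "x = component K K' x + component K' K x"
    using component_sum[OF skk(5), of x] by simp
  have zero: "i = 0 \<and> j = 0"
    if "i *s u + j *s w = 0" "u \<notin> vec.span {w}" "w \<noteq> 0" for i j and u w :: "'a^4"
  proof -
    have "i = 0"
    proof (rule ccontr)
      assume "i \<noteq> 0"
      then have "u = inverse i *s (i *s u)"
        by simp
      also have "i *s u = (- j) *s w"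
        using that(1) by (simp add: add_eq_0_iff2)
      finally have "u = (inverse i * (- j)) *s w"
        by (simp only: vec.scale_scale)
      then show False
        using that(2) unfolding mem_span_singleton by blast
    qed
    then show ?thesis
      using that(1,3) by simp
  qed
  \<comment> \<open>Independence of the four vectors: two independent ones on each of two skew
    lines.\<close>
  have ind: "i = 0 \<and> j = 0 \<and> k = 0 \<and> l = 0"
    if "i *s x + j *s x' + (k *s y + l *s y') = 0" for i j k l
  proof -
    have "i *s x + j *s x' \<in> L" "k *s y + l *s y' \<in> M"
      using x(1) x'(1) y sub by (simp_all add: vec.subspace_add vec.subspace_scale)
    moreover have "i *s x + j *s x' = - (k *s y + l *s y')"
      using that by (simp only: eq_neg_iff_add_eq_0)
    ultimately have "i *s x + j *s x' = 0"
      using skew_Int[OF sk(1)] vec.subspace_neg[OF sub(2)] by metis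
    then show ?thesis
      using that zero nx ny x'(2) y(4) by simp
  qed
  consider "x = s *s (x - y) + t *s (x - c *s y')" | "x = s *s (x - y) + t *s (x' - e *s y)"
    | "x = s *s (x' - y') + t *s (x - c *s y')" | "x = s *s (x' - y') + t *s (x' - e *s y)"
    using st sum by metis
  then show False
  proof cases
    case 1
    then have "(s + t - 1) *s x + 0 *s x' + ((- s) *s y + (- (t * c)) *s y') = 0"
      by (simp add: algebra_simps)
    then show False
      using ind[of "s + t - 1" 0 "- s" "- (t * c)"] \<open>c \<noteq> 0\<close> by auto
  next
    case 2
    then have "(s - 1) *s x + t *s x' + ((- s - t * e) *s y + 0 *s y') = 0"
      by (simp add: algebra_simps)
    then show False
      using ind[of "s - 1" t "- s - t * e" 0] by auto
  next
    case 3
    then have "(t - 1) *s x + s *s x' + (0 *s y + (- s - t * c) *s y') = 0"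
      by (simp add: algebra_simps)
    then show False
      using ind[of "t - 1" s 0 "- s - t * c"] \<open>c \<noteq> 0\<close> by auto
  next
    case 4
    then have "(- 1) *s x + (s + t) *s x' + ((- (t * e)) *s y + (- s) *s y') = 0"
      by (simp add: algebra_simps)
    then show False
      using ind[of "- 1" "s + t" "- (t * e)" "- s"] by auto
  qed
qed

lemma three_distinct_elements: "card S \<ge> 3 \<Longrightarrow> \<exists>L M N. L \<in> S \<and> M \<in> S \<and> N \<in> S \<and> distinct [L, M, N]"
proof -
  assume "card S \<ge> 3"
  then obtain T where T: "T \<subseteq> S" "card T = 3"
    using obtain_subset_with_card_n by metis
  then obtain L M N where "T = {L, M, N}" "L \<noteq> M" "M \<noteq> N" "L \<noteq> N"
    unfolding card_3_iff by blast
  then have "L \<in> S \<and> M \<in> S \<and> N \<in> S \<and> distinct [L, M, N]"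
    using T(1) by auto
  then show ?thesis by blast
qed

text \<open>The transversal through a point of \<open>Z\<close> to two further lines meets every
  other line as well, because the image on \<open>M\<close> does not depend on the centre. These
  transversals are the second family of the grid.\<close>

lemma projection_independent_imp_grid:
  fixes \<L> :: "('a::field^4) set set"
  assumes \<L>: "skew_lines \<L>" and closed: "projection_closed \<L> Z"
    and Z: "Z \<subseteq> (\<Union>L\<in>\<L>. pts L)" and card: "\<And>L. L \<in> \<L> \<Longrightarrow> card (Z \<inter> pts L) = a" and a: "a \<ge> 1"
    and b: "card \<L> = b" "b \<ge> 3"
    and indep: "\<And>L M K K' p. L \<in> \<L> \<Longrightarrow> M \<in> \<L> \<Longrightarrow> K \<in> \<L> \<Longrightarrow> K' \<in> \<L> \<Longrightarrow> distinct [L, M, K, K'] \<Longrightarrow>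
      p \<in> Z \<inter> pts L \<Longrightarrow> projection K M p = projection K' M p"
  shows "grid a b Z"
proof -
  \<comment> \<open>No disjointness is imposed; it is derived in \<open>unique\<close>.\<close>
  define A where "A = {T. line T \<and> (\<forall>L\<in>\<L>. \<exists>r\<in>Z. r \<in> pts T \<and> r \<in> pts L)}"
  have A_line: "line T" if "T \<in> A" for T
    using that by (simp add: A_def)
  have A_meet: "\<exists>r\<in>Z. r \<in> pts T \<and> r \<in> pts L" if "T \<in> A" "L \<in> \<L>" for T L
    using that by (simp add: A_def)
  obtain L1 L2 L3 where L123: "L1 \<in> \<L>" "L2 \<in> \<L>" "L3 \<in> \<L>" "distinct [L1, L2, L3]"
    using three_distinct_elements[of \<L>] b by blast
  have others: "\<exists>M N. M \<in> \<L> \<and> N \<in> \<L> \<and> distinct [L, M, N]" for L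
    using L123 by (metis distinct_length_2_or_more distinct_singleton)
  have cover: "\<exists>T\<in>A. p \<in> pts T" if p: "p \<in> Z" for p
  proof -
    obtain L where L: "L \<in> \<L>" "p \<in> pts L"
      using p Z by blast
    obtain M N where MN: "M \<in> \<L>" "N \<in> \<L>" "distinct [L, M, N]"
      using others by blast
    note sk = skew_linesD_distinct[OF \<L> L(1) MN]
    obtain x where x: "x \<in> L" "x \<noteq> 0" "p = vec.span {x}"
      using L(2) pts_iff[OF skew_subspace(1)[OF sk(1)], of p] by blast
    define y where "y = component M N x"
    have y: "y \<in> M" "y \<noteq> 0"
      using component_mem[OF sk(5)] component_nonzero[OF sk(5) sk(2) x(1) sk(4) x(2)] by (auto simp: y_def)
    define T where "T = vec.span {x, y}"
    have "x \<notin> vec.span {y}"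
      using skew_Int[OF sk(1) x(1)] x(2) y(1) skew_subspace(2)[OF sk(1)] span_singleton_subset by blast
    then have T: "line T" "vec.subspace T"
      using line_span_pair[OF y(2)] by (simp_all add: T_def)
    have xT: "x \<in> T" and yT: "y \<in> T"
      using vec.span_base[of _ "{x, y}"] by (simp_all add: T_def)
    have pM: "projection N M p = vec.span {y}"
      using projection_eq_component[OF sk(5)] x(3) by (simp add: y_def)
    have "\<exists>r\<in>Z. r \<in> pts T \<and> r \<in> pts K" if K: "K \<in> \<L>" for K
    proof -
      consider "K = L" | "K = M" | "K \<noteq> L" "K \<noteq> M" by blast
      then show ?thesis
      proof cases
        case 1
        then show ?thesis
          using p L(2) xT x(2,3) span_mem_pts[OF T(2)] by blast
      next
        case 2
        have "vec.span {y} \<in> Z"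
          using closed L MN p pM unfolding projection_closed_def by (metis IntI)
        then show ?thesis
          using 2 y yT span_mem_pts[OF T(2) y(2)] span_mem_pts[OF skew_subspace(1)[OF sk(5)] y(2)] by blast
      next
        case 3
        have dK: "distinct [L, M, K]" "distinct [L, K, M]"
          using 3 MN(3) by auto
        note skK = skew_linesD_distinct[OF \<L> L(1) MN(1) K dK(1)]
        have "projection K M p = projection N M p"
        proof (cases "K = N")
          case False
          then show ?thesis
            using indep[OF L(1) MN(1) K MN(2)] dK(1) MN(3) p L(2) by auto
        qed simp
        then have "vec.span {component M K x} = vec.span {y}"
          using pM projection_eq_component[OF skK(5)] x(3) by simp
        then have "component M K x \<in> T"
          using vec.span_base[of "component M K x" "{component M K x}"] span_singleton_subset[OF T(2), of y] yT by blast
        moreover have "component K M x = x - component M K x"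
          using component_sum[OF skK(5), of x] by (simp add: algebra_simps)
        ultimately have kT: "component K M x \<in> T"
          using vec.subspace_diff[OF T(2) xT] by simp
        have k0: "component K M x \<noteq> 0"
          using component_nonzero[OF skK(6) skK(4) x(1) skK(2) x(2)] .
        have "projection M K p \<in> Z"
          using closed L MN(1) K dK(2) p unfolding projection_closed_def by (metis IntI)
        then have "vec.span {component K M x} \<in> Z"
          using projection_eq_component[OF skK(6)] x(3) by simp
        then show ?thesis
          using span_mem_pts[OF T(2) k0] kT span_mem_pts[OF skew_subspace(1)[OF skK(6)] k0]
            component_mem[OF skK(6)] by blast
      qed
    qed
    then have "T \<in> A"
      using T(1) by (simp add: A_def)
    then show ?thesis
      using span_mem_pts[OF T(2) x(2)] xT x(3) by blast
  qed
  \<comment> \<open>A vector \<open>u\<close> on both transversals decomposes along \<open>L\<close>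
    and \<open>M\<close>. Its summand on \<open>L\<close> lies on the two different points
    \<open>p\<close> and \<open>p'\<close>, so it is zero, and likewise on \<open>M\<close>.\<close>
  have disjoint: False
    if T: "T \<in> A" "T' \<in> A" and w: "w \<in> pts T" "w \<in> pts T'" and LM: "L \<in> \<L>" "M \<in> \<L>" "L \<noteq> M"
      and pq: "p \<in> pts T" "p \<in> pts L" "q \<in> pts T" "q \<in> pts M"
      and pq': "p' \<in> pts T'" "p' \<in> pts L" "q' \<in> pts T'" "q' \<in> pts M" and neq: "p \<noteq> p'" "q \<noteq> q'"
    for T T' w L M p q p' q'
  proof -
    have sk: "skew L M"
      using skew_linesD[OF \<L> LM] .
    have sub: "vec.subspace L" "vec.subspace M" "vec.subspace T" "vec.subspace T'"
      using skew_subspace[OF sk] A_line[OF T(1)] A_line[OF T(2)] by (auto simp: flat_def)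
    obtain x where x: "x \<in> L" "x \<noteq> 0" "p = vec.span {x}"
      using pq(2) pts_iff[OF sub(1), of p] by blast
    obtain x' where x': "x' \<in> L" "x' \<noteq> 0" "p' = vec.span {x'}"
      using pq'(2) pts_iff[OF sub(1), of p'] by blast
    obtain y where y: "y \<in> M" "y \<noteq> 0" "q = vec.span {y}"
      using pq(4) pts_iff[OF sub(2), of q] by blast
    obtain y' where y': "y' \<in> M" "y' \<noteq> 0" "q' = vec.span {y'}"
      using pq'(4) pts_iff[OF sub(2), of q'] by blast
    obtain u where u: "u \<in> T" "u \<noteq> 0" "w = vec.span {u}"
      using w(1) pts_iff[OF sub(3), of w] by blast
    have "u \<in> T'"
      using w(2) u(2,3) span_mem_pts[OF sub(4)] by blast
    have notin: "z \<notin> vec.span {z'}" if "z \<in> L" "z \<noteq> 0" "z' \<in> M" for z z'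
      using skew_Int[OF sk that(1)] that span_singleton_subset[OF sub(2), of z'] by blast
    have T_mem: "x \<in> T" "y \<in> T" "x' \<in> T'" "y' \<in> T'"
      using pq pq' x y x' y' sub by (auto simp: span_mem_pts)
    obtain s t where st: "u = s *s x + t *s y"
      using line_coordinates[OF A_line[OF T(1)] T_mem(1,2) y(2) notin[OF x(1,2) y(1)] u(1)] by blast
    obtain s' t' where st': "u = s' *s x' + t' *s y'"
      using line_coordinates[OF A_line[OF T(2)] T_mem(3,4) y'(2) notin[OF x'(1,2) y'(1)] \<open>u \<in> T'\<close>] by blast
    have diff: "u - s *s x = t *s y" "u - t *s y = s *s x"
      using st by simp_all
    have diff': "u - s' *s x' = t' *s y'" "u - t' *s y' = s' *s x'"
      using st' by simp_all
    have cu: "component L M u = s *s x" "component L M u = s' *s x'"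
      by (rule component_unique[OF sk]; simp only: diff diff' vec.subspace_scale[OF sub(1)] vec.subspace_scale[OF sub(2)]
          x(1) y(1) x'(1) y'(1))+
    have cu': "component M L u = t *s y" "component M L u = t' *s y'"
      by (rule component_unique[OF skew_commute[OF sk]];
          simp only: diff diff' vec.subspace_scale[OF sub(1)] vec.subspace_scale[OF sub(2)] x(1) y(1) x'(1) y'(1))+
    have mult: "vec.span {z} = vec.span {z'}" if "i *s z = j *s z'" "z \<noteq> 0" "i \<noteq> 0" for i j and z z' :: "'a^4"
    proof -
      have "z = inverse i *s (i *s z)"
        using that(3) by simp
      also have "\<dots> = (inverse i * j) *s z'"
        unfolding that(1) by (simp only: vec.scale_scale)
      finally show ?thesis
        using span_singleton_eq[OF that(2)] by (auto simp: mem_span_singleton)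
    qed
    have "s = 0"
      using mult[of s x s' x'] cu x(2,3) x'(3) neq(1) by metis
    moreover have "t = 0"
      using mult[of t y t' y'] cu' y(2,3) y'(3) neq(2) by metis
    ultimately show False
      using st u(2) by simp
  qed
  have unique: "T = T'" if T: "T \<in> A" "T' \<in> A" and w: "w \<in> pts T" "w \<in> pts T'" for T T' w
  proof (rule ccontr)
    assume "T \<noteq> T'"
    obtain p where p: "p \<in> pts T" "p \<in> pts L1"
      using A_meet[OF T(1) L123(1)] by blast
    obtain q where q: "q \<in> pts T" "q \<in> pts L2"
      using A_meet[OF T(1) L123(2)] by blast
    obtain r where r: "r \<in> pts T" "r \<in> pts L3"
      using A_meet[OF T(1) L123(3)] by blast
    obtain p' where p': "p' \<in> pts T'" "p' \<in> pts L1"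
      using A_meet[OF T(2) L123(1)] by blast
    obtain q' where q': "q' \<in> pts T'" "q' \<in> pts L2"
      using A_meet[OF T(2) L123(2)] by blast
    obtain r' where r': "r' \<in> pts T'" "r' \<in> pts L3"
      using A_meet[OF T(2) L123(3)] by blast
    note t = p q r and t' = p' q' r'
    have "p \<noteq> q" "p \<noteq> r" "q \<noteq> r"
      using skew_lines_unique[OF \<L> L123(1,2) t(2)] skew_lines_unique[OF \<L> L123(1,3) t(2)]
        skew_lines_unique[OF \<L> L123(2,3) t(4)] t L123(4) by auto
    \<comment> \<open>Different transversals share at most one of the three points, so there are two
      lines on which they differ and \<open>disjoint\<close> applies.\<close>
    then have "\<not> (p = p' \<and> q = q')" "\<not> (p = p' \<and> r = r')" "\<not> (q = q' \<and> r = r')"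
      using line_eq_of_two_points[OF A_line[OF T(1)] A_line[OF T(2)]] t t' \<open>T \<noteq> T'\<close> by metis+
    then consider "p \<noteq> p'" "q \<noteq> q'" | "p \<noteq> p'" "r \<noteq> r'" | "q \<noteq> q'" "r \<noteq> r'" by blast
    then show False
    proof cases
      case 1
      then show False
        using disjoint[OF T w L123(1,2) _ t(1-4) t'(1-4)] L123(4) by simp
    next
      case 2
      then show False
        using disjoint[OF T w L123(1,3) _ t(1,2,5,6) t'(1,2,5,6)] L123(4) by simp
    next
      case 3
      then show False
        using disjoint[OF T w L123(2,3) _ t(3-6) t'(3-6)] L123(4) by simp
    qed
  qed
  have "A \<inter> \<L> = {}"
  proof (rule equals0I)
    fix T assume T: "T \<in> A \<inter> \<L>"
    obtain M where M: "M \<in> \<L>" "M \<noteq> T"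
      using others[of T] by auto
    then obtain r where "r \<in> pts T" "r \<in> pts M"
      using A_meet T by blast
    then show False
      using skew_lines_unique[OF \<L> M(1)] T M(2) by blast
  qed
  then have one_point: "r = r'"
    if "T \<in> A" "L \<in> \<L>" "r \<in> pts T" "r \<in> pts L" "r' \<in> pts T" "r' \<in> pts L" for T L r r'
    using line_eq_of_two_points[OF A_line[OF that(1)] skew_linesD_line[OF \<L> that(2)] that(3,5,4,6)] that(1,2) by blast
  have "\<forall>T\<in>A. \<exists>r. r \<in> Z \<inter> pts L1 \<and> r \<in> pts T"
    using A_meet L123(1) by blast
  then obtain f where f: "\<forall>T\<in>A. f T \<in> Z \<inter> pts L1 \<and> f T \<in> pts T"
    by (rule bchoice[THEN exE])
  have inj: "inj_on f A"
    using f unique by (metis inj_onI)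
  have im: "f ` A = Z \<inter> pts L1"
  proof (intro equalityI subsetI)
    fix p assume p: "p \<in> Z \<inter> pts L1"
    then obtain T where T: "T \<in> A" "p \<in> pts T"
      using cover by blast
    then have "p = f T"
      using one_point[OF T(1) L123(1) T(2)] f p by blast
    then show "p \<in> f ` A"
      using T(1) by simp
  qed (use f in blast)
  have card_A: "card A = a"
    using card_image[OF inj] im card[OF L123(1)] by simp
  then have "finite A"
    using a card.infinite[of A] by auto
  then have "skew_lines A"
    using A_line unique unfolding skew_lines_def by blast
  moreover have "\<exists>!p. p \<in> pts T \<inter> pts L" if "T \<in> A" "L \<in> \<L>" for T L
    using A_meet[OF that] one_point[OF that] by blast
  moreover have "Z = (\<Union>T\<in>A. pts T) \<inter> (\<Union>L\<in>\<L>. pts L)"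
  proof (intro equalityI subsetI)
    fix r assume "r \<in> (\<Union>T\<in>A. pts T) \<inter> (\<Union>L\<in>\<L>. pts L)"
    then obtain T L where TL: "T \<in> A" "L \<in> \<L>" "r \<in> pts T" "r \<in> pts L" by blast
    then obtain r' where "r' \<in> Z" "r' \<in> pts T" "r' \<in> pts L"
      using A_meet by blast
    then show "r \<in> Z"
      using one_point[OF TL] by blast
  qed (use cover Z in blast)
  ultimately have "grid_lines A \<L> Z"
    using \<L> unfolding grid_lines_def by blast
  then show ?thesis
    using card_A b(1) unfolding grid_iff by blast
qed

text \<open>For \<open>a = 1\<close> the images agree because \<open>M\<close> carries a single
  point of \<open>Z\<close>; for \<open>a = 2\<close> this is
  \<open>projection_independent\<close>.\<close>

lemma projection_closed_small_imp_grid: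
  fixes \<L> :: "('a::field^4) set set"
  assumes \<L>: "skew_lines \<L>" and closed: "projection_closed \<L> Z"
    and Z: "Z \<subseteq> (\<Union>L\<in>\<L>. pts L)" and card: "\<And>L. L \<in> \<L> \<Longrightarrow> card (Z \<inter> pts L) = a" and a: "a \<ge> 1" "a \<le> 2"
    and b: "card \<L> = b" "b \<ge> 3"
  shows "grid a b Z"
proof (rule projection_independent_imp_grid[OF \<L> closed Z card a(1) b])
  fix L M K K' p
  assume mem: "L \<in> \<L>" "M \<in> \<L>" "K \<in> \<L>" "K' \<in> \<L>" and dist: "distinct [L, M, K, K']" and p: "p \<in> Z \<inter> pts L"
  consider "a = 1" | "a = 2"
    using a by linarith
  then show "projection K M p = projection K' M p"
  proof cases
    case 1
    have d: "distinct [L, M, K]" "distinct [L, M, K']"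
      using dist by auto
    have "projection K M p \<in> Z \<inter> pts M" "projection K' M p \<in> Z \<inter> pts M"
      using closed mem d p projection_mem_pts[OF \<L> mem(1,2,3) d(1)] projection_mem_pts[OF \<L> mem(1,2,4) d(2)]
      unfolding projection_closed_def by blast+
    moreover obtain q where "Z \<inter> pts M = {q}"
      using card[OF mem(2)] 1 by (auto simp: card_1_singleton_iff)
    ultimately show ?thesis by simp
  next
    case 2
    then show ?thesis
      using projection_independent[OF \<L> closed _ mem dist p] card by simp
  qed
qed

theorem theorem3p0p3:
  fixes \<L> :: "('a::alg_closed_field^4) set set"
    and Z :: "('a^4) set set"
    and a b :: nat
  assumes "skew_lines \<L>"
    and "card \<L> = b"
    and "b \<ge> 3"
    and "a \<ge> 1"
    and "Z \<subseteq> (\<Union>L\<in>\<L>. pts L)"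
    and "\<forall>L\<in>\<L>. card (Z \<inter> pts L) = a"
  shows "(collinearly_complete \<L> Z \<longleftrightarrow> grid a b Z \<or> half_grid a b \<L> Z) \<and>
    (collinearly_complete \<L> Z \<longleftrightarrow> union_of_orbits \<L> Z)"
proof -
  have card: "card (Z \<inter> pts L) = a" if "L \<in> \<L>" for L
    using assms(6) that by blast
  obtain ell where "points_on_skew_lines \<L> Z a ell"
    using points_on_skew_lines_exists[OF assms(1,5) card assms(4)] by blast
  then interpret points_on_skew_lines \<L> Z a ell .
  obtain L where L: "L \<in> \<L>"
    using assms(2,3) by fastforce
  have "Z \<noteq> {}"
    using card[OF L] assms(4) by auto
  then have cc: "collinearly_complete \<L> Z \<longleftrightarrow> projection_closed \<L> Z"
    using collinearly_complete_iff_projection_closed assms(1,5) by blast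
  have "grid a b Z \<or> half_grid a b \<L> Z" if closed: "projection_closed \<L> Z"
  proof (cases "\<exists>a' b'. grid a' b' Z")
    case True
    then obtain A B where AB: "grid_lines A B Z"
      unfolding grid_iff by blast
    \<comment> \<open>So far \<open>Z\<close> is a grid of some type, with families unrelated to
      \<open>\<L>\<close>; the type has to be shown to be {a,b}.\<close>
    have "grid a b Z"
    proof (cases "a \<ge> 3")
      case True
      have "b \<ge> 1"
        using assms(3) by simp
      consider "\<L> \<subseteq> A" | "\<L> \<subseteq> B"
        using grid_lines_cases[OF AB assms(1)] card True by blast
      then show ?thesis
      proof cases
        case 1
        then show ?thesis
          using grid_lines_subset_imp_grid[OF grid_lines_commute[OF AB] _ assms(2) \<open>b \<ge> 1\<close> assms(4,5) card] by blast
      next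
        case 2
        then show ?thesis
          using grid_lines_subset_imp_grid[OF AB _ assms(2) \<open>b \<ge> 1\<close> assms(4,5) card] by blast
      qed
    next
      case False
      then show ?thesis
        using projection_closed_small_imp_grid[OF assms(1) closed assms(5) card assms(4) _ assms(2,3)] by simp
    qed
    then show ?thesis ..
  next
    case False
    then show ?thesis
      using projection_closed_imp_geproci_wrt[OF closed] assms(2,3) unfolding half_grid_def by blast
  qed
  moreover have "projection_closed \<L> Z" if "grid a b Z \<or> half_grid a b \<L> Z"
    using that grid_imp_projection_closed[OF assms(1-4) card] geproci_wrt_imp_projection_closed
    unfolding half_grid_def by blast
  ultimately show ?thesis
    using cc union_of_orbits_iff_projection_closed[OF assms(1,5)] by blast
qed

end
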